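(* Let $M$ be an invariant submanifold of a generalized Sasakian-space-form $\overline{M}^{2n+1}(f_1,f_2,f_3)$ with respect to the semi-symmetric metric connection, such that $(f_1-f_3)^2+1\neq 0$. Then the second fundamental form $h$ is generalized $2$-recurrent with respect to the semi-symmetric metric connection if and only if $M$ is totally geodesic.
   Context: An almost contact metric manifold $(\overline M,\phi,\xi,\eta,g)$ is a Riemannian manifold $(\overline M,g)$ with a $(1,1)$-tensor field $\phi$, a vector field $\xi$ and a $1$-form $\eta$ such that $\phi^2X=-X+\eta(X)\xi$, $\phi\xi=0$, $\eta(\xi)=1$, $g(X,\xi)=\eta(X)$, $\eta(\phi X)=0$, $g(\phi X,\phi Y)=g(X,Y)-\eta(X)\eta(Y)$. Curvature convention: $R(X,Y)=[\nabla_X,\nabla_Y]-\nabla_{[X,Y]}$. A generalized Sasakian-space-form $\overline M^{2n+1}(f_1,f_2,f_3)$ is an almost contact metric manifold of dimension $2n+1$, $n>1$, with smooth functions $f_1,f_2,f_3$ on $\overline M$ such that the curvature tensor $\overline R$ of its Levi-Civita connection $\overline\nabla$ satisfies $\overline R(X,Y)Z=f_1\{g(Y,Z)X-g(X,Z)Y\}+f_2\{g(X,\phi Z)\phi Y-g(Y,\phi Z)\phi X+2g(X,\phi Y)\phi Z\}+f_3\{\eta(X)\eta(Z)Y-\eta(Y)\eta(Z)X+g(X,Z)\eta(Y)\xi-g(Y,Z)\eta(X)\xi\}.$ Throughout, the following structure equations also hold on $\overline M$: $(\overline\nabla_X\phi)(Y)=(f_1-f_3)[g(X,Y)\xi-\eta(Y)X]$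 and $\overline\nabla_X\xi=-(f_1-f_3)\phi X$. A submanifold $M$ of $\overline M$ is invariant if $\xi$ is tangent to $M$ and $\phi(TM)\subset TM$ at every point of $M$. With $\nabla$ the induced Levi-Civita connection, the second fundamental form $h$ is given by $\overline\nabla_XY=\nabla_XY+h(X,Y)$; $M$ is totally geodesic if $h=0$. The semi-symmetric metric connection on $\overline M$ is $\widetilde{\overline\nabla}_XY=\overline\nabla_XY+\eta(Y)X-g(X,Y)\xi$. Its induced connection on $M$ is $\widetilde\nabla_XY=\nabla_XY+\eta(Y)X-g(X,Y)\xi$, its second fundamental form on $M$ is again $h$, and $\widetilde\nabla^\perp$ denotes the connection it induces on the normal bundle, i.e. $\widetilde\nabla^\perp_XV$ is the normal part of $\widetilde{\overline\nabla}_XV$. For vector fields tangent to $M$ put $(\widetilde{\overline\nabla}_Xh)(Y,Z)=\widetilde\nabla^\perp_X(h(Y,Z))-h(\widetilde\nabla_XY,Z)-h(Y,\widetilde\nabla_XZ)$ and $(\widetilde{\overline\nabla}^2h)(Z,W,X,Y)=\widetilde\nabla^\perp_X((\widetilde{\overline\nabla}_Yh)(Z,W))-(\widetilde{\overline\nabla}_Yh)(\widetilde\nabla_XZ,W)-(\widetilde{\overline\nabla}_Xh)(Z,\widetilde\nabla_YW)-(\widetilde{\overline\nabla}_{\widetilde\nabla_XY}h)(Z,W).$ Then $h$ is generalized $2$-recurrent with respect to the semi-symmetric metric connection if there are a $2$-form $\psi$ and a $1$-form $\rho$ on $M$ with $(\widetilde{\overline\nabla}^2h)(Z,W,X,Y)=\psi(X,Y)h(Z,W)+\rho(X)(\widetilde{\overline\nabla}_Yh)(Z,W)$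 for all $X,Y,Z,W$ tangent to $M$. *)

theory Defs
  imports "HOL-Analysis.Analysis" "HOL-Library.Function_Algebras"
begin

section \<open>Smooth manifolds and tangent vectors\<close>

text \<open>\<open>S\<close> is meant to be open.\<close>

primrec C_k_on :: "nat \<Rightarrow> 'a::euclidean_space set \<Rightarrow> ('a \<Rightarrow> 'b::real_normed_vector) \<Rightarrow> bool" where
  "C_k_on 0 S f \<longleftrightarrow> continuous_on S f"
| "C_k_on (Suc k) S f \<longleftrightarrow> (\<forall>x\<in>S. f differentiable (at x)) \<and>
     (\<forall>u. C_k_on k S (\<lambda>x. frechet_derivative f (at x) u))"

definition smooth_on :: "'a::euclidean_space set \<Rightarrow> ('a \<Rightarrow> 'b::real_normed_vector) \<Rightarrow> bool" where
  "smooth_on S f \<longleftrightarrow> (\<forall>k. C_k_on k S f)"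

text \<open>
  A manifold is a (second countable Hausdorff) type \<open>'m\<close> with an atlas; a chart is a pair of its
  domain and its coordinate map into the model space \<open>'e\<close>, and the dimension is \<open>DIM('e)\<close>.
  The atlas need not be maximal.
\<close>

type_synonym ('m, 'e) atlas = "('m set \<times> ('m \<Rightarrow> 'e)) set"

definition smooth_atlas ::
  "('m::{t2_space,second_countable_topology}, 'e::euclidean_space) atlas \<Rightarrow> bool" where
  "smooth_atlas A \<longleftrightarrow>
     (\<forall>(U, c)\<in>A. open U \<and> open (c ` U) \<and> homeomorphism U (c ` U) c (inv_into U c)) \<and>
     (\<Union>(U, c)\<in>A. U) = UNIV \<and>
     (\<forall>(U, c)\<in>A. \<forall>(V, d)\<in>A. smooth_on (c ` (U \<inter> V)) (d \<circ> inv_into U c))"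

text \<open>
  Functions, vector fields and sections are total functions, of which only the germ at the point
  under consideration matters: \<open>smooth_near A f p\<close> says that \<open>f\<close> is smooth on a neighbourhood
  of \<open>p\<close>.
\<close>

definition smooth_near ::
  "('m::{t2_space,second_countable_topology}, 'e::euclidean_space) atlas \<Rightarrow> ('m \<Rightarrow> real) \<Rightarrow> 'm \<Rightarrow> bool"
where
  "smooth_near A f p \<longleftrightarrow>
     (\<exists>U c V. (U, c) \<in> A \<and> open V \<and> p \<in> V \<and> V \<subseteq> U \<and> smooth_on (c ` V) (f \<circ> inv_into U c))"

text \<open>
  A tangent vector is the directional derivative operator that it induces on functions smooth near
  the base point, set to \<open>0\<close> on all other functions. Addition and subtraction
  of tangent vectors are pointwise (instances from \<^theory>\<open>HOL-Library.Function_Algebras\<close>).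
\<close>

type_synonym 'm tvec = "('m \<Rightarrow> real) \<Rightarrow> real"

definition tvec_scale :: "real \<Rightarrow> 'm tvec \<Rightarrow> 'm tvec" (infixr "*\<^sub>T" 75) where
  "a *\<^sub>T v = (\<lambda>f. a * v f)"

definition tangent_space ::
  "('m::{t2_space,second_countable_topology}, 'e::euclidean_space) atlas \<Rightarrow> 'm \<Rightarrow> 'm tvec set" where
  "tangent_space A p = {v. \<exists>U c u. (U, c) \<in> A \<and> p \<in> U \<and>
     v = (\<lambda>f. if smooth_near A f p then frechet_derivative (f \<circ> inv_into U c) (at (c p)) u else 0)}"

section \<open>Smooth maps, vector fields and sections along a map\<close>

text \<open>\<open>B\<close> is an atlas of the source manifold, \<open>A\<close> one of the target manifold.\<close>

definition smooth_map ::
  "('n::{t2_space,second_countable_topology}, 'k::euclidean_space) atlas \<Rightarrow>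
   ('m::{t2_space,second_countable_topology}, 'e::euclidean_space) atlas \<Rightarrow> ('n \<Rightarrow> 'm) \<Rightarrow> bool" where
  "smooth_map B A \<iota> \<longleftrightarrow> continuous_on UNIV \<iota> \<and>
     (\<forall>p f. smooth_near A f (\<iota> p) \<longrightarrow> smooth_near B (\<lambda>q. f (\<iota> q)) p)"

definition pushforward ::
  "('m::{t2_space,second_countable_topology}, 'e::euclidean_space) atlas \<Rightarrow> ('n \<Rightarrow> 'm) \<Rightarrow>
   'n \<Rightarrow> 'n tvec \<Rightarrow> 'm tvec" where
  "pushforward A \<iota> p v = (\<lambda>f. if smooth_near A f (\<iota> p) then v (\<lambda>q. f (\<iota> q)) else 0)"

definition immersion ::
  "('n::{t2_space,second_countable_topology}, 'k::euclidean_space) atlas \<Rightarrow>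
   ('m::{t2_space,second_countable_topology}, 'e::euclidean_space) atlas \<Rightarrow> ('n \<Rightarrow> 'm) \<Rightarrow> bool" where
  "immersion B A \<iota> \<longleftrightarrow> smooth_map B A \<iota> \<and>
     (\<forall>p. inj_on (pushforward A \<iota> p) (tangent_space B p))"

text \<open>
  Smooth sections over \<open>U\<close> of the pullback along \<open>\<iota>\<close> of the tangent bundle of the target.
  Vector fields are the sections along the identity.
\<close>

definition section_on ::
  "('n::{t2_space,second_countable_topology}, 'k::euclidean_space) atlas \<Rightarrow>
   ('m::{t2_space,second_countable_topology}, 'e::euclidean_space) atlas \<Rightarrow> ('n \<Rightarrow> 'm) \<Rightarrow>
   'n set \<Rightarrow> ('n \<Rightarrow> 'm tvec) \<Rightarrow> bool" where
  "section_on B A \<iota> U V \<longleftrightarrow> open U \<and> (\<forall>q\<in>U. V q \<in> tangent_space A (\<iota> q) \<and>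
     (\<forall>f. smooth_near A f (\<iota> q) \<longrightarrow> smooth_near B (\<lambda>r. V r f) q))"

definition section_near ::
  "('n::{t2_space,second_countable_topology}, 'k::euclidean_space) atlas \<Rightarrow>
   ('m::{t2_space,second_countable_topology}, 'e::euclidean_space) atlas \<Rightarrow> ('n \<Rightarrow> 'm) \<Rightarrow>
   'n \<Rightarrow> ('n \<Rightarrow> 'm tvec) \<Rightarrow> bool" where
  "section_near B A \<iota> p V \<longleftrightarrow> (\<exists>U. p \<in> U \<and> section_on B A \<iota> U V)"

abbreviation vector_field_on ::
  "('m::{t2_space,second_countable_topology}, 'e::euclidean_space) atlas \<Rightarrow>
   'm set \<Rightarrow> ('m \<Rightarrow> 'm tvec) \<Rightarrow> bool" where
  "vector_field_on A U X \<equiv> section_on A A (\<lambda>p. p) U X"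

abbreviation vector_field_near ::
  "('m::{t2_space,second_countable_topology}, 'e::euclidean_space) atlas \<Rightarrow>
   'm \<Rightarrow> ('m \<Rightarrow> 'm tvec) \<Rightarrow> bool" where
  "vector_field_near A p X \<equiv> section_near A A (\<lambda>p. p) p X"

definition lie_bracket ::
  "('m::{t2_space,second_countable_topology}, 'e::euclidean_space) atlas \<Rightarrow>
   ('m \<Rightarrow> 'm tvec) \<Rightarrow> ('m \<Rightarrow> 'm tvec) \<Rightarrow> 'm \<Rightarrow> 'm tvec" where
  "lie_bracket A X Y p =
     (\<lambda>f. if smooth_near A f p then X p (\<lambda>q. Y q f) - Y p (\<lambda>q. X q f) else 0)"

section \<open>Tensor fields\<close>

definition one_form ::
  "('m::{t2_space,second_countable_topology}, 'e::euclidean_space) atlas \<Rightarrow>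
   ('m \<Rightarrow> 'm tvec \<Rightarrow> real) \<Rightarrow> bool" where
  "one_form A \<omega> \<longleftrightarrow>
     (\<forall>p. \<forall>v\<in>tangent_space A p. \<forall>w\<in>tangent_space A p. \<omega> p (v + w) = \<omega> p v + \<omega> p w) \<and>
     (\<forall>p a. \<forall>v\<in>tangent_space A p. \<omega> p (a *\<^sub>T v) = a * \<omega> p v) \<and>
     (\<forall>p X. vector_field_near A p X \<longrightarrow> smooth_near A (\<lambda>q. \<omega> q (X q)) p)"

definition bilinear_form ::
  "('m::{t2_space,second_countable_topology}, 'e::euclidean_space) atlas \<Rightarrow>
   ('m \<Rightarrow> 'm tvec \<Rightarrow> 'm tvec \<Rightarrow> real) \<Rightarrow> bool" where
  "bilinear_form A b \<longleftrightarrow>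
     (\<forall>p. \<forall>u\<in>tangent_space A p. \<forall>v\<in>tangent_space A p. \<forall>w\<in>tangent_space A p.
        b p (u + v) w = b p u w + b p v w \<and> b p w (u + v) = b p w u + b p w v) \<and>
     (\<forall>p a. \<forall>v\<in>tangent_space A p. \<forall>w\<in>tangent_space A p.
        b p (a *\<^sub>T v) w = a * b p v w \<and> b p v (a *\<^sub>T w) = a * b p v w) \<and>
     (\<forall>p X Y. vector_field_near A p X \<longrightarrow> vector_field_near A p Y \<longrightarrow>
        smooth_near A (\<lambda>q. b q (X q) (Y q)) p)"

definition two_form ::
  "('m::{t2_space,second_countable_topology}, 'e::euclidean_space) atlas \<Rightarrow>
   ('m \<Rightarrow> 'm tvec \<Rightarrow> 'm tvec \<Rightarrow> real) \<Rightarrow> bool" where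
  "two_form A \<psi> \<longleftrightarrow> bilinear_form A \<psi> \<and> (\<forall>p. \<forall>v\<in>tangent_space A p. \<psi> p v v = 0)"

definition riemannian_metric ::
  "('m::{t2_space,second_countable_topology}, 'e::euclidean_space) atlas \<Rightarrow>
   ('m \<Rightarrow> 'm tvec \<Rightarrow> 'm tvec \<Rightarrow> real) \<Rightarrow> bool" where
  "riemannian_metric A g \<longleftrightarrow> bilinear_form A g \<and>
     (\<forall>p. \<forall>v\<in>tangent_space A p. \<forall>w\<in>tangent_space A p. g p v w = g p w v) \<and>
     (\<forall>p. \<forall>v\<in>tangent_space A p. v \<noteq> 0 \<longrightarrow> g p v v > 0)"

definition endomorphism_field ::
  "('m::{t2_space,second_countable_topology}, 'e::euclidean_space) atlas \<Rightarrow>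
   ('m \<Rightarrow> 'm tvec \<Rightarrow> 'm tvec) \<Rightarrow> bool" where
  "endomorphism_field A \<phi> \<longleftrightarrow>
     (\<forall>p. \<forall>v\<in>tangent_space A p. \<phi> p v \<in> tangent_space A p) \<and>
     (\<forall>p. \<forall>v\<in>tangent_space A p. \<forall>w\<in>tangent_space A p. \<phi> p (v + w) = \<phi> p v + \<phi> p w) \<and>
     (\<forall>p a. \<forall>v\<in>tangent_space A p. \<phi> p (a *\<^sub>T v) = a *\<^sub>T \<phi> p v) \<and>
     (\<forall>p X. vector_field_near A p X \<longrightarrow> vector_field_near A p (\<lambda>q. \<phi> q (X q)))"

section \<open>Connections\<close>

text \<open>
  \<open>D p v V\<close> is the derivative at \<open>p\<close>, in the direction of the tangent vector \<open>v\<close> of the source, of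
  the section \<open>V\<close> defined near \<open>p\<close>; so \<open>(D\<^sub>X V)\<close> at \<open>p\<close> is \<open>D p (X p) V\<close>.
  Since a function which is constant near \<open>p\<close> is smooth near \<open>p\<close>, the Leibniz rule makes \<open>D p v V\<close>
  depend on the germ of \<open>V\<close> at \<open>p\<close> only.
\<close>

definition connection_along ::
  "('n::{t2_space,second_countable_topology}, 'k::euclidean_space) atlas \<Rightarrow>
   ('m::{t2_space,second_countable_topology}, 'e::euclidean_space) atlas \<Rightarrow> ('n \<Rightarrow> 'm) \<Rightarrow>
   ('n \<Rightarrow> 'n tvec \<Rightarrow> ('n \<Rightarrow> 'm tvec) \<Rightarrow> 'm tvec) \<Rightarrow> bool" where
  "connection_along B A \<iota> D \<longleftrightarrow>
     (\<forall>p V. section_near B A \<iota> p V \<longrightarrow>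
        (\<forall>v\<in>tangent_space B p. D p v V \<in> tangent_space A (\<iota> p)) \<and>
        (\<forall>v\<in>tangent_space B p. \<forall>w\<in>tangent_space B p. D p (v + w) V = D p v V + D p w V) \<and>
        (\<forall>v\<in>tangent_space B p. \<forall>a. D p (a *\<^sub>T v) V = a *\<^sub>T D p v V)) \<and>
     (\<forall>p. \<forall>v\<in>tangent_space B p. \<forall>V W. section_near B A \<iota> p V \<longrightarrow> section_near B A \<iota> p W \<longrightarrow>
        D p v (\<lambda>q. V q + W q) = D p v V + D p v W) \<and>
     (\<forall>p. \<forall>v\<in>tangent_space B p. \<forall>f V. smooth_near B f p \<longrightarrow> section_near B A \<iota> p V \<longrightarrow>
        D p v (\<lambda>q. f q *\<^sub>T V q) = v f *\<^sub>T V p + f p *\<^sub>T D p v V) \<and>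
     (\<forall>p X V. vector_field_near B p X \<longrightarrow> section_near B A \<iota> p V \<longrightarrow>
        section_near B A \<iota> p (\<lambda>q. D q (X q) V))"

abbreviation affine_connection ::
  "('m::{t2_space,second_countable_topology}, 'e::euclidean_space) atlas \<Rightarrow>
   ('m \<Rightarrow> 'm tvec \<Rightarrow> ('m \<Rightarrow> 'm tvec) \<Rightarrow> 'm tvec) \<Rightarrow> bool" where
  "affine_connection A nabla \<equiv> connection_along A A (\<lambda>p. p) nabla"

definition levi_civita ::
  "('m::{t2_space,second_countable_topology}, 'e::euclidean_space) atlas \<Rightarrow>
   ('m \<Rightarrow> 'm tvec \<Rightarrow> 'm tvec \<Rightarrow> real) \<Rightarrow>
   ('m \<Rightarrow> 'm tvec \<Rightarrow> ('m \<Rightarrow> 'm tvec) \<Rightarrow> 'm tvec) \<Rightarrow> bool" where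
  "levi_civita A g nabla \<longleftrightarrow> affine_connection A nabla \<and>
     (\<forall>p X Y. vector_field_near A p X \<longrightarrow> vector_field_near A p Y \<longrightarrow>
        nabla p (X p) Y - nabla p (Y p) X = lie_bracket A X Y p) \<and>
     (\<forall>p. \<forall>v\<in>tangent_space A p. \<forall>Y Z. vector_field_near A p Y \<longrightarrow> vector_field_near A p Z \<longrightarrow>
        v (\<lambda>q. g q (Y q) (Z q)) = g p (nabla p v Y) (Z p) + g p (Y p) (nabla p v Z))"

text \<open>
  The pullback connection: the unique connection along \<open>\<iota>\<close> extending \<open>nabla\<close>. It is what gives a
  meaning to the derivative, in directions tangent to a submanifold, of a field defined only along
  the submanifold.
\<close>

definition pullback_connection ::
  "('n::{t2_space,second_countable_topology}, 'k::euclidean_space) atlas \<Rightarrow>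
   ('m::{t2_space,second_countable_topology}, 'e::euclidean_space) atlas \<Rightarrow> ('n \<Rightarrow> 'm) \<Rightarrow>
   ('m \<Rightarrow> 'm tvec \<Rightarrow> ('m \<Rightarrow> 'm tvec) \<Rightarrow> 'm tvec) \<Rightarrow>
   ('n \<Rightarrow> 'n tvec \<Rightarrow> ('n \<Rightarrow> 'm tvec) \<Rightarrow> 'm tvec) \<Rightarrow> bool" where
  "pullback_connection B A \<iota> nabla D \<longleftrightarrow> connection_along B A \<iota> D \<and>
     (\<forall>p. \<forall>v\<in>tangent_space B p. \<forall>Y. vector_field_near A (\<iota> p) Y \<longrightarrow>
        D p v (\<lambda>q. Y (\<iota> q)) = nabla (\<iota> p) (pushforward A \<iota> p v) Y)"

definition curvature ::
  "('m::{t2_space,second_countable_topology}, 'e::euclidean_space) atlas \<Rightarrow>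
   ('m \<Rightarrow> 'm tvec \<Rightarrow> ('m \<Rightarrow> 'm tvec) \<Rightarrow> 'm tvec) \<Rightarrow>
   ('m \<Rightarrow> 'm tvec) \<Rightarrow> ('m \<Rightarrow> 'm tvec) \<Rightarrow> ('m \<Rightarrow> 'm tvec) \<Rightarrow> 'm \<Rightarrow> 'm tvec" where
  "curvature A nabla X Y Z p =
     nabla p (X p) (\<lambda>q. nabla q (Y q) Z) - nabla p (Y p) (\<lambda>q. nabla q (X q) Z)
     - nabla p (lie_bracket A X Y p) Z"

definition semi_symmetric_connection ::
  "('m \<Rightarrow> 'm tvec \<Rightarrow> 'm tvec \<Rightarrow> real) \<Rightarrow> ('m \<Rightarrow> 'm tvec \<Rightarrow> real) \<Rightarrow> ('m \<Rightarrow> 'm tvec) \<Rightarrow>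
   ('m \<Rightarrow> 'm tvec \<Rightarrow> ('m \<Rightarrow> 'm tvec) \<Rightarrow> 'm tvec) \<Rightarrow>
   'm \<Rightarrow> 'm tvec \<Rightarrow> ('m \<Rightarrow> 'm tvec) \<Rightarrow> 'm tvec" where
  "semi_symmetric_connection g \<eta> \<xi> nabla p v Y =
     nabla p v Y + \<eta> p (Y p) *\<^sub>T v - g p v (Y p) *\<^sub>T \<xi> p"

section \<open>Generalized Sasakian space forms\<close>

definition almost_contact_metric ::
  "('m::{t2_space,second_countable_topology}, 'e::euclidean_space) atlas \<Rightarrow>
   ('m \<Rightarrow> 'm tvec \<Rightarrow> 'm tvec) \<Rightarrow> ('m \<Rightarrow> 'm tvec) \<Rightarrow> ('m \<Rightarrow> 'm tvec \<Rightarrow> real) \<Rightarrow>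
   ('m \<Rightarrow> 'm tvec \<Rightarrow> 'm tvec \<Rightarrow> real) \<Rightarrow> bool" where
  "almost_contact_metric A \<phi> \<xi> \<eta> g \<longleftrightarrow>
     smooth_atlas A \<and> riemannian_metric A g \<and> endomorphism_field A \<phi> \<and>
     vector_field_on A UNIV \<xi> \<and> one_form A \<eta> \<and>
     (\<forall>p. \<phi> p (\<xi> p) = 0 \<and> \<eta> p (\<xi> p) = 1) \<and>
     (\<forall>p. \<forall>x\<in>tangent_space A p.
        \<phi> p (\<phi> p x) = - x + \<eta> p x *\<^sub>T \<xi> p \<and> g p x (\<xi> p) = \<eta> p x \<and> \<eta> p (\<phi> p x) = 0) \<and>
     (\<forall>p. \<forall>x\<in>tangent_space A p. \<forall>y\<in>tangent_space A p.
        g p (\<phi> p x) (\<phi> p y) = g p x y - \<eta> p x * \<eta> p y)"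

definition generalized_sasakian_space_form ::
  "nat \<Rightarrow> ('m::{t2_space,second_countable_topology}, 'e::euclidean_space) atlas \<Rightarrow>
   ('m \<Rightarrow> 'm tvec \<Rightarrow> 'm tvec) \<Rightarrow> ('m \<Rightarrow> 'm tvec) \<Rightarrow> ('m \<Rightarrow> 'm tvec \<Rightarrow> real) \<Rightarrow>
   ('m \<Rightarrow> 'm tvec \<Rightarrow> 'm tvec \<Rightarrow> real) \<Rightarrow> ('m \<Rightarrow> 'm tvec \<Rightarrow> ('m \<Rightarrow> 'm tvec) \<Rightarrow> 'm tvec) \<Rightarrow>
   ('m \<Rightarrow> real) \<Rightarrow> ('m \<Rightarrow> real) \<Rightarrow> ('m \<Rightarrow> real) \<Rightarrow> bool" where
  "generalized_sasakian_space_form n A \<phi> \<xi> \<eta> g nabla f1 f2 f3 \<longleftrightarrow>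
     n > 1 \<and> DIM('e) = 2 * n + 1 \<and> almost_contact_metric A \<phi> \<xi> \<eta> g \<and> levi_civita A g nabla \<and>
     (\<forall>p. smooth_near A f1 p \<and> smooth_near A f2 p \<and> smooth_near A f3 p) \<and>
     (\<forall>p X Y Z.
        vector_field_near A p X \<longrightarrow> vector_field_near A p Y \<longrightarrow> vector_field_near A p Z \<longrightarrow>
        (let x = X p; y = Y p; z = Z p in
         curvature A nabla X Y Z p =
           f1 p *\<^sub>T (g p y z *\<^sub>T x - g p x z *\<^sub>T y)
         + f2 p *\<^sub>T (g p x (\<phi> p z) *\<^sub>T \<phi> p y - g p y (\<phi> p z) *\<^sub>T \<phi> p x
                    + (2 * g p x (\<phi> p y)) *\<^sub>T \<phi> p z)
         + f3 p *\<^sub>T ((\<eta> p x * \<eta> p z) *\<^sub>T y - (\<eta> p y * \<eta> p z) *\<^sub>T x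
                    + (g p x z * \<eta> p y) *\<^sub>T \<xi> p - (g p y z * \<eta> p x) *\<^sub>T \<xi> p)))"

definition structure_equations ::
  "('m::{t2_space,second_countable_topology}, 'e::euclidean_space) atlas \<Rightarrow>
   ('m \<Rightarrow> 'm tvec \<Rightarrow> 'm tvec) \<Rightarrow> ('m \<Rightarrow> 'm tvec) \<Rightarrow> ('m \<Rightarrow> 'm tvec \<Rightarrow> real) \<Rightarrow>
   ('m \<Rightarrow> 'm tvec \<Rightarrow> 'm tvec \<Rightarrow> real) \<Rightarrow> ('m \<Rightarrow> 'm tvec \<Rightarrow> ('m \<Rightarrow> 'm tvec) \<Rightarrow> 'm tvec) \<Rightarrow>
   ('m \<Rightarrow> real) \<Rightarrow> ('m \<Rightarrow> real) \<Rightarrow> bool" where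
  "structure_equations A \<phi> \<xi> \<eta> g nabla f1 f3 \<longleftrightarrow>
     (\<forall>p. \<forall>x\<in>tangent_space A p. \<forall>Y. vector_field_near A p Y \<longrightarrow>
        nabla p x (\<lambda>q. \<phi> q (Y q)) - \<phi> p (nabla p x Y)
          = (f1 p - f3 p) *\<^sub>T (g p x (Y p) *\<^sub>T \<xi> p - \<eta> p (Y p) *\<^sub>T x)) \<and>
     (\<forall>p. \<forall>x\<in>tangent_space A p. nabla p x \<xi> = (- (f1 p - f3 p)) *\<^sub>T \<phi> p x)"

section \<open>Submanifolds\<close>

text \<open>
  A submanifold is given by an immersion \<open>\<iota>\<close>. Vectors tangent to it
  are identified with their images under the differential of \<open>\<iota>\<close>.
\<close>

definition invariant_submanifold ::
  "('n::{t2_space,second_countable_topology}, 'k::euclidean_space) atlas \<Rightarrow>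
   ('m::{t2_space,second_countable_topology}, 'e::euclidean_space) atlas \<Rightarrow> ('n \<Rightarrow> 'm) \<Rightarrow>
   ('m \<Rightarrow> 'm tvec \<Rightarrow> 'm tvec) \<Rightarrow> ('m \<Rightarrow> 'm tvec) \<Rightarrow> bool" where
  "invariant_submanifold B A \<iota> \<phi> \<xi> \<longleftrightarrow> smooth_atlas B \<and> immersion B A \<iota> \<and>
     (\<forall>p. \<xi> (\<iota> p) \<in> pushforward A \<iota> p ` tangent_space B p) \<and>
     (\<forall>p. \<phi> (\<iota> p) ` pushforward A \<iota> p ` tangent_space B p
            \<subseteq> pushforward A \<iota> p ` tangent_space B p)"

definition induced_metric ::
  "('m::{t2_space,second_countable_topology}, 'e::euclidean_space) atlas \<Rightarrow> ('n \<Rightarrow> 'm) \<Rightarrow>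
   ('m \<Rightarrow> 'm tvec \<Rightarrow> 'm tvec \<Rightarrow> real) \<Rightarrow> 'n \<Rightarrow> 'n tvec \<Rightarrow> 'n tvec \<Rightarrow> real" where
  "induced_metric A \<iota> g p v w = g (\<iota> p) (pushforward A \<iota> p v) (pushforward A \<iota> p w)"

definition induced_one_form ::
  "('m::{t2_space,second_countable_topology}, 'e::euclidean_space) atlas \<Rightarrow> ('n \<Rightarrow> 'm) \<Rightarrow>
   ('m \<Rightarrow> 'm tvec \<Rightarrow> real) \<Rightarrow> 'n \<Rightarrow> 'n tvec \<Rightarrow> real" where
  "induced_one_form A \<iota> \<eta> p v = \<eta> (\<iota> p) (pushforward A \<iota> p v)"

text \<open>The field \<open>\<xi>\<close>, when tangent to the submanifold, as a vector field on it.\<close>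

definition induced_field ::
  "('n::{t2_space,second_countable_topology}, 'k::euclidean_space) atlas \<Rightarrow>
   ('m::{t2_space,second_countable_topology}, 'e::euclidean_space) atlas \<Rightarrow> ('n \<Rightarrow> 'm) \<Rightarrow>
   ('m \<Rightarrow> 'm tvec) \<Rightarrow> 'n \<Rightarrow> 'n tvec" where
  "induced_field B A \<iota> \<xi> p = inv_into (tangent_space B p) (pushforward A \<iota> p) (\<xi> (\<iota> p))"

definition normal_space ::
  "('n::{t2_space,second_countable_topology}, 'k::euclidean_space) atlas \<Rightarrow>
   ('m::{t2_space,second_countable_topology}, 'e::euclidean_space) atlas \<Rightarrow> ('n \<Rightarrow> 'm) \<Rightarrow>
   ('m \<Rightarrow> 'm tvec \<Rightarrow> 'm tvec \<Rightarrow> real) \<Rightarrow> 'n \<Rightarrow> 'm tvec set" where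
  "normal_space B A \<iota> g p =
     {w \<in> tangent_space A (\<iota> p). \<forall>v\<in>tangent_space B p. g (\<iota> p) (pushforward A \<iota> p v) w = 0}"

definition normal_part ::
  "('n::{t2_space,second_countable_topology}, 'k::euclidean_space) atlas \<Rightarrow>
   ('m::{t2_space,second_countable_topology}, 'e::euclidean_space) atlas \<Rightarrow> ('n \<Rightarrow> 'm) \<Rightarrow>
   ('m \<Rightarrow> 'm tvec \<Rightarrow> 'm tvec \<Rightarrow> real) \<Rightarrow> 'n \<Rightarrow> 'm tvec \<Rightarrow> 'm tvec" where
  "normal_part B A \<iota> g p w =
     (THE u. u \<in> normal_space B A \<iota> g p \<and> w - u \<in> pushforward A \<iota> p ` tangent_space B p)"

text \<open>
  The second fundamental form, from the Gauss formula. \<open>D\<close> is the pullback of the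
  Levi-Civita connection of the ambient manifold, \<open>nabla\<close> the induced Levi-Civita connection.
\<close>

definition second_fundamental_form ::
  "('m::{t2_space,second_countable_topology}, 'e::euclidean_space) atlas \<Rightarrow> ('n \<Rightarrow> 'm) \<Rightarrow>
   ('n \<Rightarrow> 'n tvec \<Rightarrow> ('n \<Rightarrow> 'm tvec) \<Rightarrow> 'm tvec) \<Rightarrow>
   ('n \<Rightarrow> 'n tvec \<Rightarrow> ('n \<Rightarrow> 'n tvec) \<Rightarrow> 'n tvec) \<Rightarrow>
   ('n \<Rightarrow> 'n tvec) \<Rightarrow> ('n \<Rightarrow> 'n tvec) \<Rightarrow> 'n \<Rightarrow> 'm tvec" where
  "second_fundamental_form A \<iota> D nabla X Y p =
     D p (X p) (\<lambda>q. pushforward A \<iota> q (Y q)) - pushforward A \<iota> p (nabla p (X p) Y)"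

definition totally_geodesic ::
  "('n::{t2_space,second_countable_topology}, 'k::euclidean_space) atlas \<Rightarrow>
   (('n \<Rightarrow> 'n tvec) \<Rightarrow> ('n \<Rightarrow> 'n tvec) \<Rightarrow> 'n \<Rightarrow> 'm tvec) \<Rightarrow> bool" where
  "totally_geodesic B h \<longleftrightarrow>
     (\<forall>p X Y. vector_field_near B p X \<longrightarrow> vector_field_near B p Y \<longrightarrow> h X Y p = 0)"

text \<open>
  In the following, \<open>nabla\<close> is a connection on the submanifold and \<open>D\<close> a connection along \<open>\<iota>\<close> whose
  normal part is the normal connection.
\<close>

definition cov_deriv_form ::
  "('n::{t2_space,second_countable_topology}, 'k::euclidean_space) atlas \<Rightarrow>
   ('m::{t2_space,second_countable_topology}, 'e::euclidean_space) atlas \<Rightarrow> ('n \<Rightarrow> 'm) \<Rightarrow>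
   ('m \<Rightarrow> 'm tvec \<Rightarrow> 'm tvec \<Rightarrow> real) \<Rightarrow>
   ('n \<Rightarrow> 'n tvec \<Rightarrow> ('n \<Rightarrow> 'm tvec) \<Rightarrow> 'm tvec) \<Rightarrow>
   ('n \<Rightarrow> 'n tvec \<Rightarrow> ('n \<Rightarrow> 'n tvec) \<Rightarrow> 'n tvec) \<Rightarrow>
   (('n \<Rightarrow> 'n tvec) \<Rightarrow> ('n \<Rightarrow> 'n tvec) \<Rightarrow> 'n \<Rightarrow> 'm tvec) \<Rightarrow>
   ('n \<Rightarrow> 'n tvec) \<Rightarrow> ('n \<Rightarrow> 'n tvec) \<Rightarrow> ('n \<Rightarrow> 'n tvec) \<Rightarrow> 'n \<Rightarrow> 'm tvec" where
  "cov_deriv_form B A \<iota> g D nabla h X Y Z p =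
     normal_part B A \<iota> g p (D p (X p) (h Y Z))
     - h (\<lambda>q. nabla q (X q) Y) Z p - h Y (\<lambda>q. nabla q (X q) Z) p"

text \<open>
  The directions \<open>X\<close> and \<open>Y\<close> in the third summand below are intentionally as displayed in the source
  definition (\<open>X\<close> differentiates \<open>h\<close>, \<open>Y\<close> differentiates \<open>W\<close>), even though the usual second
  covariant derivative has them interchanged.
\<close>

definition cov_deriv2_form ::
  "('n::{t2_space,second_countable_topology}, 'k::euclidean_space) atlas \<Rightarrow>
   ('m::{t2_space,second_countable_topology}, 'e::euclidean_space) atlas \<Rightarrow> ('n \<Rightarrow> 'm) \<Rightarrow>
   ('m \<Rightarrow> 'm tvec \<Rightarrow> 'm tvec \<Rightarrow> real) \<Rightarrow>
   ('n \<Rightarrow> 'n tvec \<Rightarrow> ('n \<Rightarrow> 'm tvec) \<Rightarrow> 'm tvec) \<Rightarrow>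
   ('n \<Rightarrow> 'n tvec \<Rightarrow> ('n \<Rightarrow> 'n tvec) \<Rightarrow> 'n tvec) \<Rightarrow>
   (('n \<Rightarrow> 'n tvec) \<Rightarrow> ('n \<Rightarrow> 'n tvec) \<Rightarrow> 'n \<Rightarrow> 'm tvec) \<Rightarrow>
   ('n \<Rightarrow> 'n tvec) \<Rightarrow> ('n \<Rightarrow> 'n tvec) \<Rightarrow> ('n \<Rightarrow> 'n tvec) \<Rightarrow> ('n \<Rightarrow> 'n tvec) \<Rightarrow>
   'n \<Rightarrow> 'm tvec" where
  "cov_deriv2_form B A \<iota> g D nabla h Z W X Y p =
     normal_part B A \<iota> g p (D p (X p) (cov_deriv_form B A \<iota> g D nabla h Y Z W))
     - cov_deriv_form B A \<iota> g D nabla h Y (\<lambda>q. nabla q (X q) Z) W p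
     - cov_deriv_form B A \<iota> g D nabla h X Z (\<lambda>q. nabla q (Y q) W) p
     - cov_deriv_form B A \<iota> g D nabla h (\<lambda>q. nabla q (X q) Y) Z W p"

definition generalized_2_recurrent ::
  "('n::{t2_space,second_countable_topology}, 'k::euclidean_space) atlas \<Rightarrow>
   ('m::{t2_space,second_countable_topology}, 'e::euclidean_space) atlas \<Rightarrow> ('n \<Rightarrow> 'm) \<Rightarrow>
   ('m \<Rightarrow> 'm tvec \<Rightarrow> 'm tvec \<Rightarrow> real) \<Rightarrow>
   ('n \<Rightarrow> 'n tvec \<Rightarrow> ('n \<Rightarrow> 'm tvec) \<Rightarrow> 'm tvec) \<Rightarrow>
   ('n \<Rightarrow> 'n tvec \<Rightarrow> ('n \<Rightarrow> 'n tvec) \<Rightarrow> 'n tvec) \<Rightarrow>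
   (('n \<Rightarrow> 'n tvec) \<Rightarrow> ('n \<Rightarrow> 'n tvec) \<Rightarrow> 'n \<Rightarrow> 'm tvec) \<Rightarrow> bool" where
  "generalized_2_recurrent B A \<iota> g D nabla h \<longleftrightarrow>
     (\<exists>\<psi> \<rho>. two_form B \<psi> \<and> one_form B \<rho> \<and>
       (\<forall>p X Y Z W.
          vector_field_near B p X \<longrightarrow> vector_field_near B p Y \<longrightarrow>
          vector_field_near B p Z \<longrightarrow> vector_field_near B p W \<longrightarrow>
          cov_deriv2_form B A \<iota> g D nabla h Z W X Y p =
            \<psi> p (X p) (Y p) *\<^sub>T h Z W p
            + \<rho> p (X p) *\<^sub>T cov_deriv_form B A \<iota> g D nabla h Y Z W p))"

end

theory Submission
  imports Defs
begin

text \<open>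
  Put \<open>F = f1 - f3\<close>. For tangent fields, \<open>h(X, \<xi>) = 0\<close> and \<open>h(X, \<phi> Y) = \<phi> h(X, Y)\<close>, and the
  semi-symmetric derivative of \<open>\<xi>\<close> in the direction \<open>Y\<close> is \<open>Y - F \<phi> Y - \<eta>(Y) \<xi>\<close>. Hence both the
  terms \<open>h(\<xi>, \<xi>)\<close> and \<open>(D\<^sub>Y h)(\<xi>, \<xi>)\<close> vanish, while the second derivative of \<open>h\<close> at \<open>(\<xi>, \<xi>, X, Y)\<close>
  is \<open>2 (1 - F \<phi>)\<^sup>2 h(X, Y)\<close>; so the recurrence equation at \<open>Z = W = \<xi>\<close> forces \<open>h = 0\<close>, because
  \<open>(1 + F \<phi>) (1 - F \<phi>) = 1 + F\<^sup>2\<close> on normal vectors. That \<open>h\<close> is symmetric and normal follows from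
  the pullback connection being metric and torsion-free, which is checked by expanding sections along
  the immersion in coordinate fields.
\<close>

text \<open>The 1 in \<open>F^2 + 1\<close> comes from the semi-symmetric term: since \<eta>(\<xi>)
  = 1, it adds Y to the Levi-Civita derivative -F \<phi> Y of \<xi>. On normal vectors \<phi>
  squares to -1, so 1 - F \<phi> acts like the complex number 1 - iF and is injective. The factor 2
  counts the two summands of the second derivative in which an argument \<xi> is differentiated. The
  interchanged directions in one of them do no harm, because the value found there is symmetric in X
  and Y. Two obstacles shape the proof. The structure equations speak of ambient fields, while
  pushed-forward fields are only sections along the immersion. Instead of extending such sections to
  ambient fields, \<open>section_induct\<close> transports each identity from restricted ambient
  fields to all sections. Moreover \<xi>, as a field on the submanifold, is obtained by a pointwise
  choice, so its smoothness has to be proved before it can be inserted into h at all.\<close>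

section \<open>Smooth functions on Euclidean space\<close>

text \<open>\<open>frechet_derivative\<close> is a choice operator, so it is enough that both
  functions have the same derivatives at x. This covers points without differentiability
  too.\<close>

lemma frechet_derivative_cong_open:
  assumes "open S" "x \<in> S" "\<And>y. y \<in> S \<Longrightarrow> f y = g y"
  shows "frechet_derivative f (at x) = frechet_derivative g (at x)"
proof -
  have "(f has_derivative D) (at x) \<longleftrightarrow> (g has_derivative D) (at x)" for D
    using assms has_derivative_transform_within_open[OF _ assms(1,2)] by metis
  then show ?thesis by (simp add: frechet_derivative_def)
qed

lemma differentiable_cong_open:
  assumes "open S" "x \<in> S" "\<And>y. y \<in> S \<Longrightarrow> f y = g y" "f differentiable (at x)"
  shows "g differentiable (at x)"
  using assms has_derivative_transform_within_open[OF _ assms(1,2)]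
  unfolding differentiable_def by metis

text \<open>Openness matters: \<open>C_k_on\<close> differentiates with the full filter
  \<open>at x\<close>, and only on an open set does agreement on S mean agreement near x.\<close>

lemma C_k_on_cong:
  assumes "open S" "\<And>x. x \<in> S \<Longrightarrow> f x = g x" "C_k_on k S f"
  shows "C_k_on k S g"
  using assms(2,3)
proof (induction k arbitrary: f g)
  case 0
  then show ?case using continuous_on_cong[of S S f g] by simp
next
  case (Suc k)
  have "g differentiable (at x)" if "x \<in> S" for x
    using differentiable_cong_open[OF assms(1) that, of f g] Suc.prems that by auto
  moreover have "C_k_on k S (\<lambda>x. frechet_derivative g (at x) u)" for u
    by (rule Suc.IH[of "\<lambda>x. frechet_derivative f (at x) u"])
       (use Suc.prems frechet_derivative_cong_open[OF assms(1), of _ f g] in auto)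
  ultimately show ?case by simp
qed

lemma C_k_on_subset: "C_k_on k S f \<Longrightarrow> T \<subseteq> S \<Longrightarrow> C_k_on k T f"
  by (induction k arbitrary: f) (auto intro: continuous_on_subset)

lemma C_k_on_lower: "C_k_on (Suc k) S f \<Longrightarrow> C_k_on k S f"
proof (induction k arbitrary: f)
  case 0
  then show ?case
    by (auto intro!: continuous_at_imp_continuous_on differentiable_imp_continuous_within)
next
  case (Suc k)
  then show ?case unfolding C_k_on.simps(2)[of "Suc k"] C_k_on.simps(2)[of k] by blast
qed

lemma C_k_on_const: "C_k_on k S (\<lambda>x. a)"
  by (induction k arbitrary: a) auto

text \<open>The model for the following closure lemmas: compute the derivative \<open>d\<close> in
  closed form, see that it is built from functions of order k, and carry the result over to
  \<open>frechet_derivative\<close> by \<open>C_k_on_cong\<close>.\<close>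

lemma C_k_on_bounded_linear:
  assumes "bounded_linear L" "open S"
  shows "C_k_on k S f \<Longrightarrow> C_k_on k S (\<lambda>x. L (f x))"
proof (induction k arbitrary: f)
  case 0
  then show ?case using bounded_linear.continuous_on[OF assms(1)] by auto
next
  case (Suc k)
  have d: "((\<lambda>x. L (f x)) has_derivative (\<lambda>u. L (frechet_derivative f (at x) u))) (at x)"
    if "x \<in> S" for x
    using Suc.prems that
    by (intro bounded_linear.has_derivative[OF assms(1)] frechet_derivative_works[THEN iffD1]) auto
  show ?case
    unfolding C_k_on.simps
  proof (intro conjI ballI allI)
    show "(\<lambda>x. L (f x)) differentiable at x" if "x \<in> S" for x
      using d[OF that] differentiableI by blast
    show "C_k_on k S (\<lambda>x. frechet_derivative (\<lambda>x. L (f x)) (at x) u)" for u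
      by (rule C_k_on_cong[OF assms(2) _ Suc.IH[of "\<lambda>x. frechet_derivative f (at x) u"]])
         (use Suc.prems in \<open>auto simp: frechet_derivative_at[OF d, symmetric]\<close>)
  qed
qed

lemma C_k_on_add:
  assumes "open S"
  shows "C_k_on k S f \<Longrightarrow> C_k_on k S g \<Longrightarrow> C_k_on k S (\<lambda>x. f x + g x)"
proof (induction k arbitrary: f g)
  case 0
  then show ?case by (auto intro: continuous_intros)
next
  case (Suc k)
  have d: "((\<lambda>x. f x + g x) has_derivative
      (\<lambda>u. frechet_derivative f (at x) u + frechet_derivative g (at x) u)) (at x)"
    if "x \<in> S" for x
    using Suc.prems that by (intro has_derivative_add frechet_derivative_works[THEN iffD1]) auto
  show ?case
    unfolding C_k_on.simps
  proof (intro conjI ballI allI)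
    show "(\<lambda>x. f x + g x) differentiable at x" if "x \<in> S" for x
      using d[OF that] differentiableI by blast
    show "C_k_on k S (\<lambda>x. frechet_derivative (\<lambda>x. f x + g x) (at x) u)" for u
      by (rule C_k_on_cong[OF assms _ Suc.IH[of "\<lambda>x. frechet_derivative f (at x) u"
              "\<lambda>x. frechet_derivative g (at x) u"]])
         (use Suc.prems in \<open>auto simp: frechet_derivative_at[OF d, symmetric]\<close>)
  qed
qed

lemma C_k_on_sum:
  assumes "open S" "finite I" "\<And>i. i \<in> I \<Longrightarrow> C_k_on k S (f i)"
  shows "C_k_on k S (\<lambda>x. \<Sum>i\<in>I. f i x)"
  using assms(2,3) by induction (auto intro: C_k_on_const C_k_on_add[OF assms(1)])

text \<open>Each summand of the product rule contains one undifferentiated factor, which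
  \<open>C_k_on_lower\<close> brings down to order k. The induction therefore has to be over
  arbitrary pairs of functions.\<close>

lemma C_k_on_scaleR:
  assumes "open S"
  shows "C_k_on k S f \<Longrightarrow> C_k_on k S g \<Longrightarrow> C_k_on k S (\<lambda>x. f x *\<^sub>R g x)"
proof (induction k arbitrary: f g)
  case 0
  then show ?case by (auto intro: continuous_intros)
next
  case (Suc k)
  have d: "((\<lambda>x. f x *\<^sub>R g x) has_derivative
      (\<lambda>u. f x *\<^sub>R frechet_derivative g (at x) u + frechet_derivative f (at x) u *\<^sub>R g x)) (at x)"
    if "x \<in> S" for x
    using Suc.prems that by (intro has_derivative_scaleR frechet_derivative_works[THEN iffD1]) auto
  show ?case
    unfolding C_k_on.simps
  proof (intro conjI ballI allI)
    show "(\<lambda>x. f x *\<^sub>R g x) differentiable at x" if "x \<in> S" for x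
      using d[OF that] differentiableI by blast
    have "C_k_on k S (\<lambda>x. f x *\<^sub>R frechet_derivative g (at x) u + frechet_derivative f (at x) u *\<^sub>R g x)"
      for u 
      using Suc.prems C_k_on_lower[OF Suc.prems(1)] C_k_on_lower[OF Suc.prems(2)]
      by (intro C_k_on_add Suc.IH assms) auto
    then show "C_k_on k S (\<lambda>x. frechet_derivative (\<lambda>x. f x *\<^sub>R g x) (at x) u)" for u
      by (rule C_k_on_cong[OF assms, rotated]) (simp add: frechet_derivative_at[OF d, symmetric])
  qed
qed

text \<open>The derivative of 1/f contains 1/f itself, now needed only to order k, which is the
  induction hypothesis for the same f.\<close>

lemma C_k_on_inverse:
  fixes f :: "'a::euclidean_space \<Rightarrow> real"
  assumes "open S" "\<And>x. x \<in> S \<Longrightarrow> f x \<noteq> 0"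
  shows "C_k_on k S f \<Longrightarrow> C_k_on k S (\<lambda>x. inverse (f x))"
proof (induction k)
  case 0
  then show ?case using assms by (auto intro: continuous_intros)
next
  case (Suc k)
  have d: "((\<lambda>x. inverse (f x)) has_derivative
      (\<lambda>u. - (inverse (f x) * frechet_derivative f (at x) u * inverse (f x)))) (at x)"
    if "x \<in> S" for x
    using Suc.prems that assms
    by (intro Deriv.has_derivative_inverse frechet_derivative_works[THEN iffD1]) auto
  show ?case
    unfolding C_k_on.simps
  proof (intro conjI ballI allI)
    show "(\<lambda>x. inverse (f x)) differentiable at x" if "x \<in> S" for x
      using d[OF that] differentiableI by blast
    have i: "C_k_on k S (\<lambda>x. inverse (f x))"
      using Suc C_k_on_lower by blast
    fix u
    have "C_k_on k S (\<lambda>x. (- 1) *\<^sub>R ((inverse (f x) *\<^sub>R frechet_derivative f (at x) u) *\<^sub>R inverse (f x)))"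
      using Suc.prems i by (intro C_k_on_scaleR assms C_k_on_const) auto
    then show "C_k_on k S (\<lambda>x. frechet_derivative (\<lambda>x. inverse (f x)) (at x) u)"
      by (rule C_k_on_cong[OF assms(1), rotated])
         (simp add: frechet_derivative_at[OF d, symmetric] mult_ac)
  qed
qed

lemma C_k_on_compose:
  fixes g :: "'a::euclidean_space \<Rightarrow> 'b::euclidean_space"
  assumes "open S" "open T" "g ` S \<subseteq> T"
  shows "C_k_on k T f \<Longrightarrow> C_k_on k S g \<Longrightarrow> C_k_on k S (\<lambda>x. f (g x))"
proof (induction k arbitrary: f)
  case 0
  then show ?case using assms continuous_on_compose2[of T f S g] by auto
next
  case (Suc k)
  have d: "((\<lambda>x. f (g x)) has_derivative
      (\<lambda>u. frechet_derivative f (at (g x)) (frechet_derivative g (at x) u))) (at x)"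
    if "x \<in> S" for x
    by (rule has_derivative_compose; rule frechet_derivative_works[THEN iffD1])
       (use Suc.prems that assms(3) in auto)
  show ?case
    unfolding C_k_on.simps
  proof (intro conjI ballI allI)
    show "(\<lambda>x. f (g x)) differentiable at x" if "x \<in> S" for x
      using d[OF that] differentiableI by blast
    have lin: "linear (frechet_derivative f (at (g x)))" if "x \<in> S" for x
      using Suc.prems that assms(3) by (intro linear_frechet_derivative) auto
    \<comment> \<open>The inner direction varies with x, whereas \<open>C_k_on\<close> controls
      derivatives in fixed directions only. Expanding it in \<open>Basis\<close> separates the
      varying coefficients from fixed directions.\<close>
    have eq: "frechet_derivative f (at (g x)) (frechet_derivative g (at x) u) =
        (\<Sum>b\<in>Basis. (frechet_derivative g (at x) u \<bullet> b) *\<^sub>R frechet_derivative f (at (g x)) b)"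
      if "x \<in> S" for x u
    proof -
      have "frechet_derivative f (at (g x)) (frechet_derivative g (at x) u) =
        frechet_derivative f (at (g x)) (\<Sum>b\<in>Basis. (frechet_derivative g (at x) u \<bullet> b) *\<^sub>R b)"
        by (simp add: euclidean_representation)
      also have "\<dots> = (\<Sum>b\<in>Basis. (frechet_derivative g (at x) u \<bullet> b) *\<^sub>R frechet_derivative f (at (g x)) b)"
        using lin[OF that] by (simp add: linear_sum linear_scale)
      finally show ?thesis .
    qed
    have "C_k_on k S (\<lambda>x. \<Sum>b\<in>Basis. (frechet_derivative g (at x) u \<bullet> b) *\<^sub>R
          frechet_derivative f (at (g x)) b)" for u
    proof (rule C_k_on_sum[OF assms(1) finite_Basis], rule C_k_on_scaleR[OF assms(1)])
      fix b :: 'b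
      show "C_k_on k S (\<lambda>x. frechet_derivative g (at x) u \<bullet> b)"
        by (rule C_k_on_bounded_linear[OF bounded_linear_inner_left assms(1)]) (use Suc.prems in auto)
      show "C_k_on k S (\<lambda>x. frechet_derivative f (at (g x)) b)"
        using Suc.IH[of "\<lambda>y. frechet_derivative f (at y) b"] Suc.prems C_k_on_lower[OF Suc.prems(2)]
        by auto
    qed
    then show "C_k_on k S (\<lambda>x. frechet_derivative (\<lambda>x. f (g x)) (at x) u)" for u
      by (rule C_k_on_cong[OF assms(1), rotated]) (simp add: frechet_derivative_at[OF d, symmetric] eq)
  qed
qed

lemma C_k_on_id:
  assumes "open S" shows "C_k_on k S (\<lambda>x. x)"
proof (cases k)
  case (Suc l)
  have "frechet_derivative (\<lambda>x. x) (at x) u = u" for x u :: 'a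
    using frechet_derivative_at[OF has_derivative_ident, of x] by metis
  then show ?thesis using Suc by (simp add: C_k_on_const)
qed simp

lemma smooth_on_differentiable:
  assumes "smooth_on S f" "x \<in> S"
  shows "f differentiable (at x)"
proof -
  have "C_k_on (Suc 0) S f" using assms(1) unfolding smooth_on_def by blast
  then show ?thesis using assms(2) by simp
qed

lemma smooth_on_frechet_derivative:
  assumes "smooth_on S f"
  shows "smooth_on S (\<lambda>x. frechet_derivative f (at x) u)"
  unfolding smooth_on_def
proof
  fix k
  have "C_k_on (Suc k) S f" using assms unfolding smooth_on_def by blast
  then show "C_k_on k S (\<lambda>x. frechet_derivative f (at x) u)" by simp
qed

lemma smooth_on_cong:
  "open S \<Longrightarrow> (\<And>x. x \<in> S \<Longrightarrow> f x = g x) \<Longrightarrow> smooth_on S f \<Longrightarrow> smooth_on S g"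
  unfolding smooth_on_def using C_k_on_cong by blast

lemma smooth_on_subset: "smooth_on S f \<Longrightarrow> T \<subseteq> S \<Longrightarrow> smooth_on T f"
  unfolding smooth_on_def using C_k_on_subset by blast

lemma smooth_on_add:
  "open S \<Longrightarrow> smooth_on S f \<Longrightarrow> smooth_on S g \<Longrightarrow> smooth_on S (\<lambda>x. f x + g x)"
  unfolding smooth_on_def by (simp add: C_k_on_add)

lemma smooth_on_mult:
  fixes f g :: "'a::euclidean_space \<Rightarrow> real"
  assumes "open S" "smooth_on S f" "smooth_on S g"
  shows "smooth_on S (\<lambda>x. f x * g x)"
  using C_k_on_scaleR[OF assms(1), of _ f g] assms(2,3) unfolding smooth_on_def by simp

lemma smooth_on_inverse:
  fixes f :: "'a::euclidean_space \<Rightarrow> real"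
  shows "open S \<Longrightarrow> smooth_on S f \<Longrightarrow> (\<And>x. x \<in> S \<Longrightarrow> f x \<noteq> 0) \<Longrightarrow>
    smooth_on S (\<lambda>x. inverse (f x))"
  unfolding smooth_on_def by (simp add: C_k_on_inverse)

lemma smooth_on_compose:
  fixes g :: "'a::euclidean_space \<Rightarrow> 'b::euclidean_space"
  shows "open S \<Longrightarrow> open T \<Longrightarrow> g ` S \<subseteq> T \<Longrightarrow> smooth_on T f \<Longrightarrow> smooth_on S g \<Longrightarrow>
    smooth_on S (\<lambda>x. f (g x))"
  unfolding smooth_on_def using C_k_on_compose by blast

section \<open>Charts\<close>

locale manifold =
  fixes A :: "('m::{t2_space,second_countable_topology}, 'e::euclidean_space) atlas"
  assumes smooth_atlas: "smooth_atlas A"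
begin

lemma chart_open: "(U, c) \<in> A \<Longrightarrow> open U"
  and chart_range_open: "(U, c) \<in> A \<Longrightarrow> open (c ` U)"
  and chart_homeomorphism: "(U, c) \<in> A \<Longrightarrow> homeomorphism U (c ` U) c (inv_into U c)"
  using smooth_atlas unfolding smooth_atlas_def by fast+

lemma chart_inv: "(U, c) \<in> A \<Longrightarrow> p \<in> U \<Longrightarrow> inv_into U c (c p) = p"
  by (rule homeomorphism_apply1[OF chart_homeomorphism])

lemma chart_image_open:
  assumes "(U, c) \<in> A" "open V" "V \<subseteq> U"
  shows "open (c ` V)"
proof -
  have "openin (top_of_set U) V" using assms(2,3) by (simp add: open_subset)
  then have "openin (top_of_set (c ` U)) (c ` V)"
    by (rule homeomorphism_imp_open_map[OF chart_homeomorphism[OF assms(1)]])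
  then show ?thesis by (rule openin_open_trans[OF _ chart_range_open[OF assms(1)]])
qed

lemma chart_exists: obtains U c where "(U, c) \<in> A" "p \<in> U"
proof -
  have "p \<in> (\<Union>(U, c)\<in>A. U)" using smooth_atlas unfolding smooth_atlas_def by simp
  then show ?thesis using that by blast
qed

lemma chart_change:
  "(U, c) \<in> A \<Longrightarrow> (V, d) \<in> A \<Longrightarrow> smooth_on (c ` (U \<inter> V)) (d \<circ> inv_into U c)"
  using smooth_atlas unfolding smooth_atlas_def by fast

text \<open>The definition lets f be tested in some chart. Smooth coordinate changes allow that
  chart to be any prescribed one, at the price of shrinking the neighbourhood to the
  overlap.\<close>

lemma smooth_near_chart:
  assumes "(U, c) \<in> A" "p \<in> U"
  shows "smooth_near A f p \<longleftrightarrow>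
    (\<exists>V. open V \<and> p \<in> V \<and> V \<subseteq> U \<and> smooth_on (c ` V) (\<lambda>x. f (inv_into U c x)))"
proof
  assume "smooth_near A f p"
  then obtain U' c' V where *: "(U', c') \<in> A" "open V" "p \<in> V" "V \<subseteq> U'"
    "smooth_on (c' ` V) (f \<circ> inv_into U' c')"
    unfolding smooth_near_def by blast
  let ?W = "V \<inter> U"
  have W: "open ?W" "?W \<subseteq> U" using * chart_open[OF assms(1)] by auto
  have "smooth_on (c ` ?W) (\<lambda>x. (f \<circ> inv_into U' c') ((c' \<circ> inv_into U c) x))"
  proof (rule smooth_on_compose[where g = "c' \<circ> inv_into U c" and T = "c' ` V"])
    show "open (c ` ?W)" "open (c' ` V)" using W * assms chart_image_open by blast+
    show "(c' \<circ> inv_into U c) ` c ` ?W \<subseteq> c' ` V" using chart_inv[OF assms(1)] by force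
    show "smooth_on (c ` ?W) (c' \<circ> inv_into U c)"
      by (rule smooth_on_subset[OF chart_change[OF assms(1) *(1)]]) (use * in auto)
  qed fact
  then have "smooth_on (c ` ?W) (\<lambda>x. f (inv_into U c x))"
    by (rule smooth_on_cong[OF chart_image_open[OF assms(1) W], rotated])
       (use * chart_inv assms in auto)
  then show "\<exists>V. open V \<and> p \<in> V \<and> V \<subseteq> U \<and> smooth_on (c ` V) (\<lambda>x. f (inv_into U c x))"
    using W * assms by blast
next
  assume "\<exists>V. open V \<and> p \<in> V \<and> V \<subseteq> U \<and> smooth_on (c ` V) (\<lambda>x. f (inv_into U c x))"
  then show "smooth_near A f p"
    unfolding smooth_near_def comp_def using assms(1) by blast
qed

lemma smooth_near_chartE:
  assumes "smooth_near A f p" "(U, c) \<in> A" "p \<in> U"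
  obtains V where "open V" "p \<in> V" "V \<subseteq> U" "smooth_on (c ` V) (\<lambda>x. f (inv_into U c x))"
    "open (c ` V)" "c p \<in> c ` V"
proof -
  obtain V where V: "open V" "p \<in> V" "V \<subseteq> U" "smooth_on (c ` V) (\<lambda>x. f (inv_into U c x))"
    using assms(1) unfolding smooth_near_chart[OF assms(2,3)] by blast
  show ?thesis
    by (rule that[OF V chart_image_open[OF assms(2) V(1,3)]]) (use V in blast)
qed

lemma smooth_near_cong:
  assumes "\<forall>\<^sub>F q in nhds p. f q = g q" "smooth_near A f p"
  shows "smooth_near A g p"
proof -
  obtain U c where c: "(U, c) \<in> A" "p \<in> U" by (rule chart_exists)
  obtain V where V: "open V" "p \<in> V" "V \<subseteq> U" "smooth_on (c ` V) (\<lambda>x. f (inv_into U c x))"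
    "open (c ` V)" "c p \<in> c ` V"
    by (rule smooth_near_chartE[OF assms(2) c])
  obtain W where W: "open W" "p \<in> W" "\<And>q. q \<in> W \<Longrightarrow> f q = g q"
    using assms(1) unfolding eventually_nhds by blast
  have "open (c ` (V \<inter> W))" by (rule chart_image_open[OF c(1)]) (use V W in auto)
  then have "smooth_on (c ` (V \<inter> W)) (\<lambda>x. g (inv_into U c x))"
  proof (rule smooth_on_cong)
    show "smooth_on (c ` (V \<inter> W)) (\<lambda>x. f (inv_into U c x))"
      by (rule smooth_on_subset[OF V(4)]) auto
  qed (use V W chart_inv c in auto)
  then show ?thesis
    unfolding smooth_near_chart[OF c] using V W by (intro exI[of _ "V \<inter> W"]) auto
qed

lemma smooth_near_eventually: "smooth_near A f p \<Longrightarrow> \<forall>\<^sub>F q in nhds p. smooth_near A f q"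
  unfolding smooth_near_def eventually_nhds by blast

lemma smooth_near_const: "smooth_near A (\<lambda>q. a) p"
proof -
  obtain U c where c: "(U, c) \<in> A" "p \<in> U" by (rule chart_exists)
  then show ?thesis
    unfolding smooth_near_chart[OF c] smooth_on_def
    by (intro exI[of _ U]) (auto simp: C_k_on_const chart_open)
qed

lemma smooth_near_add:
  assumes "smooth_near A f p" "smooth_near A g p"
  shows "smooth_near A (\<lambda>q. f q + g q) p"
proof -
  obtain U c where c: "(U, c) \<in> A" "p \<in> U" by (rule chart_exists)
  obtain V where V: "open V" "p \<in> V" "V \<subseteq> U" "smooth_on (c ` V) (\<lambda>x. f (inv_into U c x))"
    "open (c ` V)" "c p \<in> c ` V"
    by (rule smooth_near_chartE[OF assms(1) c])
  obtain W where W: "open W" "p \<in> W" "W \<subseteq> U" "smooth_on (c ` W) (\<lambda>x. g (inv_into U c x))"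
    "open (c ` W)" "c p \<in> c ` W"
    by (rule smooth_near_chartE[OF assms(2) c])
  have "open (c ` (V \<inter> W))" by (rule chart_image_open[OF c(1)]) (use V W in auto)
  moreover have "smooth_on (c ` (V \<inter> W)) (\<lambda>x. f (inv_into U c x))"
    "smooth_on (c ` (V \<inter> W)) (\<lambda>x. g (inv_into U c x))"
    by (rule smooth_on_subset[OF V(4)] smooth_on_subset[OF W(4)]; auto)+
  ultimately have "smooth_on (c ` (V \<inter> W)) (\<lambda>x. f (inv_into U c x) + g (inv_into U c x))"
    by (rule smooth_on_add)
  then show ?thesis
    unfolding smooth_near_chart[OF c] using V W by (intro exI[of _ "V \<inter> W"]) auto
qed

lemma smooth_near_mult:
  assumes "smooth_near A f p" "smooth_near A g p"
  shows "smooth_near A (\<lambda>q. f q * g q) p"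
proof -
  obtain U c where c: "(U, c) \<in> A" "p \<in> U" by (rule chart_exists)
  obtain V where V: "open V" "p \<in> V" "V \<subseteq> U" "smooth_on (c ` V) (\<lambda>x. f (inv_into U c x))"
    "open (c ` V)" "c p \<in> c ` V"
    by (rule smooth_near_chartE[OF assms(1) c])
  obtain W where W: "open W" "p \<in> W" "W \<subseteq> U" "smooth_on (c ` W) (\<lambda>x. g (inv_into U c x))"
    "open (c ` W)" "c p \<in> c ` W"
    by (rule smooth_near_chartE[OF assms(2) c])
  have "open (c ` (V \<inter> W))" by (rule chart_image_open[OF c(1)]) (use V W in auto)
  moreover have "smooth_on (c ` (V \<inter> W)) (\<lambda>x. f (inv_into U c x))"
    "smooth_on (c ` (V \<inter> W)) (\<lambda>x. g (inv_into U c x))"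
    by (rule smooth_on_subset[OF V(4)] smooth_on_subset[OF W(4)]; auto)+
  ultimately have "smooth_on (c ` (V \<inter> W)) (\<lambda>x. f (inv_into U c x) * g (inv_into U c x))"
    by (rule smooth_on_mult)
  then show ?thesis
    unfolding smooth_near_chart[OF c] using V W by (intro exI[of _ "V \<inter> W"]) auto
qed

lemma smooth_near_sum:
  "finite I \<Longrightarrow> (\<And>i. i \<in> I \<Longrightarrow> smooth_near A (f i) p) \<Longrightarrow> smooth_near A (\<lambda>q. \<Sum>i\<in>I. f i q) p"
  by (induction rule: finite_induct) (auto intro: smooth_near_const smooth_near_add)

lemma smooth_near_uminus: "smooth_near A f p \<Longrightarrow> smooth_near A (\<lambda>q. - f q) p"
  using smooth_near_mult[OF smooth_near_const[of "-1"]] by simp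

lemma smooth_near_diff:
  "smooth_near A f p \<Longrightarrow> smooth_near A g p \<Longrightarrow> smooth_near A (\<lambda>q. f q - g q) p"
  using smooth_near_add[OF _ smooth_near_uminus] by fastforce

lemma smooth_near_inverse:
  assumes "smooth_near A f p" "\<forall>\<^sub>F q in nhds p. f q \<noteq> 0"
  shows "smooth_near A (\<lambda>q. inverse (f q)) p"
proof -
  obtain U c where c: "(U, c) \<in> A" "p \<in> U" by (rule chart_exists)
  obtain V where V: "open V" "p \<in> V" "V \<subseteq> U" "smooth_on (c ` V) (\<lambda>x. f (inv_into U c x))"
    "open (c ` V)" "c p \<in> c ` V"
    by (rule smooth_near_chartE[OF assms(1) c])
  obtain W where W: "open W" "p \<in> W" "\<And>q. q \<in> W \<Longrightarrow> f q \<noteq> 0"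
    using assms(2) unfolding eventually_nhds by blast
  have "open (c ` (V \<inter> W))" by (rule chart_image_open[OF c(1)]) (use V W in auto)
  moreover have "smooth_on (c ` (V \<inter> W)) (\<lambda>x. f (inv_into U c x))"
    by (rule smooth_on_subset[OF V(4)]) auto
  moreover have "f (inv_into U c x) \<noteq> 0" if "x \<in> c ` (V \<inter> W)" for x
    using that V W chart_inv c by auto
  ultimately have "smooth_on (c ` (V \<inter> W)) (\<lambda>x. inverse (f (inv_into U c x)))"
    by (intro smooth_on_inverse)
  then show ?thesis
    unfolding smooth_near_chart[OF c] using V W by (intro exI[of _ "V \<inter> W"]) auto
qed

lemma smooth_near_coordinate:
  assumes c: "(U, c) \<in> A" "p \<in> U"
  shows "smooth_near A (\<lambda>q. c q \<bullet> b) p"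
proof -
  have o: "open (c ` U)" using c chart_open chart_image_open by blast
  have "smooth_on (c ` U) (\<lambda>x. x \<bullet> b)"
    unfolding smooth_on_def
    by (intro allI C_k_on_bounded_linear[OF bounded_linear_inner_left o] C_k_on_id[OF o])
  then have "smooth_on (c ` U) (\<lambda>x. c (inv_into U c x) \<bullet> b)"
    by (rule smooth_on_cong[OF o, rotated]) (auto simp: f_inv_into_f)
  then show ?thesis
    unfolding smooth_near_chart[OF c] using c chart_open by (intro exI[of _ U]) auto
qed

lemma smooth_near_differentiable:
  assumes "smooth_near A f p" "(U, c) \<in> A" "p \<in> U"
  shows "(\<lambda>x. f (inv_into U c x)) differentiable (at (c p))"
  proof -
  obtain V where "smooth_on (c ` V) (\<lambda>x. f (inv_into U c x))" "c p \<in> c ` V"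
    by (rule smooth_near_chartE[OF assms])
  then show ?thesis by (rule smooth_on_differentiable)
qed

end

section \<open>Tangent vectors\<close>

text \<open>The vector space is that of all functionals on functions; tangent spaces, images of the
  differential and normal spaces are later shown to be subspaces of it.\<close>

interpretation tvec: vector_space "tvec_scale :: real \<Rightarrow> 'm tvec \<Rightarrow> 'm tvec"
  by unfold_locales (auto simp: tvec_scale_def fun_eq_iff algebra_simps)

lemma tvec_apply:
  "(v + w) f = v f + w f" "(v - w) f = v f - w f" "(- v) f = - v f" "(0::'m tvec) f = 0"
  "(a *\<^sub>T v) f = a * v f" for v w :: "'m tvec"
  by (auto simp: tvec_scale_def)

text \<open>In induction proofs tangent vectors appear eta-expanded, and these rules would then rewrite sums
  of tangent vectors to lambda terms.\<close>

declare plus_fun_apply [simp del] zero_fun_apply [simp del]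
  minus_apply [simp del] uminus_apply [simp del]

lemma tvec_sum_apply: "(\<Sum>i\<in>I. v i) f = (\<Sum>i\<in>I. v i f)" for v :: "'i \<Rightarrow> 'm tvec"
  by (induction I rule: infinite_finite_induct) (auto simp: tvec_apply)

text \<open>Read as a filter statement, being a section near p combines with other local facts
  through \<open>eventually_elim\<close>, without choosing and intersecting open sets.\<close>

lemma section_near_iff:
  "section_near B A \<iota> p V \<longleftrightarrow> (\<forall>\<^sub>F q in nhds p. V q \<in> tangent_space A (\<iota> q) \<and>
     (\<forall>f. smooth_near A f (\<iota> q) \<longrightarrow> smooth_near B (\<lambda>r. V r f) q))"
  unfolding section_near_def section_on_def eventually_nhds by blast

lemma section_near_eventually:
  "section_near B A \<iota> p V \<Longrightarrow> \<forall>\<^sub>F q in nhds p. section_near B A \<iota> q V"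
  unfolding section_near_iff by (simp add: eventually_eventually)

lemma section_near_in_tangent_space: "section_near B A \<iota> p V \<Longrightarrow> V p \<in> tangent_space A (\<iota> p)"
  unfolding section_near_iff by (auto dest: eventually_nhds_x_imp_x)

lemma section_near_smooth:
  "section_near B A \<iota> p V \<Longrightarrow> smooth_near A f (\<iota> p) \<Longrightarrow> smooth_near B (\<lambda>r. V r f) p"
  unfolding section_near_iff by (auto dest: eventually_nhds_x_imp_x)

context manifold
begin

text \<open>The coordinate field of a chart in direction \<open>u\<close>. For \<open>u\<close> in
  \<open>Basis\<close> these fields are the local frames in which sections are expanded.\<close>

definition coordinate_vector :: "'m set \<Rightarrow> ('m \<Rightarrow> 'e) \<Rightarrow> 'e \<Rightarrow> 'm \<Rightarrow> 'm tvec" where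
  "coordinate_vector U c u p = (\<lambda>f. if smooth_near A f p
     then frechet_derivative (\<lambda>x. f (inv_into U c x)) (at (c p)) u else 0)"

lemma tangent_space_eq:
  "tangent_space A p = {v. \<exists>U c u. (U, c) \<in> A \<and> p \<in> U \<and> v = coordinate_vector U c u p}"
  unfolding tangent_space_def coordinate_vector_def comp_def ..

end

text \<open>Vector fields are sections along the identity, so what is proved here also applies to
  fields on a single manifold, by interpreting the locale with the identity map.\<close>

locale manifold_map = source: manifold B + target: manifold A
  for B :: "('n::{t2_space,second_countable_topology}, 'k::euclidean_space) atlas"
    and A :: "('m::{t2_space,second_countable_topology}, 'e::euclidean_space) atlas" +
  fixes \<iota> :: "'n \<Rightarrow> 'm"
  assumes smooth_map: "smooth_map B A \<iota>"
begin

lemma smooth_near_pullback: "smooth_near A f (\<iota> p) \<Longrightarrow> smooth_near B (\<lambda>q. f (\<iota> q)) p"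
  using smooth_map unfolding smooth_map_def by blast

lemma eventually_pullback:
  assumes "\<forall>\<^sub>F x in nhds (\<iota> p). P x" shows "\<forall>\<^sub>F q in nhds p. P (\<iota> q)"
proof -
  have "isCont \<iota> p"
    using smooth_map unfolding smooth_map_def by (simp add: continuous_on_eq_continuous_at)
  then have "filterlim \<iota> (nhds (\<iota> p)) (nhds p)" by (simp add: continuous_at tendsto_nhds_iff)
  then show ?thesis using assms by (rule eventually_compose_filterlim[rotated])
qed

text \<open>The chain rule for the coordinate expression \<open>?G\<close> of the map.\<close>

lemma pushforward_coordinate_vector:
  assumes c: "(U, c) \<in> B" "p \<in> U" and d: "(V, d) \<in> A" "\<iota> p \<in> V"
  shows "pushforward A \<iota> p (source.coordinate_vector U c u p) = target.coordinate_vector V d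
    (frechet_derivative (\<lambda>x. d (\<iota> (inv_into U c x))) (at (c p)) u) (\<iota> p)"
proof
  fix f
  let ?G = "\<lambda>x. d (\<iota> (inv_into U c x))"
  show "pushforward A \<iota> p (source.coordinate_vector U c u p) f = target.coordinate_vector V d
    (frechet_derivative ?G (at (c p)) u) (\<iota> p) f"
  proof (cases "smooth_near A f (\<iota> p)")
    case True
    \<comment> \<open>\<open>smooth_map\<close> says only that smooth functions pull back to smooth
      functions. Applied to the coordinate functions of the target chart, it gives the components of
      \<open>?G\<close>.\<close>
    have "(\<lambda>x. ?G x \<bullet> b) differentiable (at (c p))" for b
      by (rule source.smooth_near_differentiable[OF smooth_near_pullback c])
         (rule target.smooth_near_coordinate[OF d])
    then have "?G differentiable (at (c p))"
      using differentiable_componentwise_within[of ?G "c p" UNIV] by simp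
    then have G: "(?G has_derivative frechet_derivative ?G (at (c p))) (at (c p))"
      by (simp add: frechet_derivative_works)
    have Gp: "?G (c p) = d (\<iota> p)" using source.chart_inv[OF c] by simp
    have F: "((\<lambda>x. f (inv_into V d x)) has_derivative
        frechet_derivative (\<lambda>x. f (inv_into V d x)) (at (d (\<iota> p)))) (at (?G (c p)))"
      unfolding Gp frechet_derivative_works[symmetric]
      by (rule target.smooth_near_differentiable[OF True d])
    have FG: "frechet_derivative (\<lambda>x. f (inv_into V d x)) (at (d (\<iota> p)))
          (frechet_derivative ?G (at (c p)) u)
        = frechet_derivative (\<lambda>x. f (inv_into V d (?G x))) (at (c p)) u"
      using frechet_derivative_at[OF has_derivative_compose[OF G F]] by (rule fun_cong)
    \<comment> \<open>The target chart cancels against its inverse only where the image stays in V,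
      so the two coordinate expressions of f agree merely near p.\<close>
    have "\<forall>\<^sub>F q in nhds p. q \<in> U \<and> \<iota> q \<in> V"
      using c d source.chart_open target.chart_open
      by (intro eventually_conj eventually_pullback) (auto intro: eventually_nhds_in_open)
    then obtain W where W: "open W" "p \<in> W" "\<And>q. q \<in> W \<Longrightarrow> q \<in> U \<and> \<iota> q \<in> V"
      unfolding eventually_nhds by blast
    have "frechet_derivative (\<lambda>x. f (inv_into V d (?G x))) (at (c p))
        = frechet_derivative (\<lambda>x. f (\<iota> (inv_into U c x))) (at (c p))"
    proof (rule frechet_derivative_cong_open)
      show "open (c ` W)" by (rule source.chart_image_open[OF c(1) W(1)]) (use W in blast)
      show "c p \<in> c ` W" using W by blast
      show "f (inv_into V d (?G x)) = f (\<iota> (inv_into U c x))" if "x \<in> c ` W" for x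
        using that W source.chart_inv[OF c(1)] target.chart_inv[OF d(1)] by auto
    qed
    then show ?thesis
      using FG True smooth_near_pullback[OF True]
      by (simp add: pushforward_def source.coordinate_vector_def target.coordinate_vector_def)
  qed (simp add: pushforward_def target.coordinate_vector_def)
qed

end

context manifold
begin

lemma coordinate_vector_nonsmooth: "\<not> smooth_near A f p \<Longrightarrow> coordinate_vector U c u p f = 0"
  by (simp add: coordinate_vector_def)

text \<open>The previous chain rule for the identity map, read in two charts. The identity pushes a
  coordinate vector to itself because that vector is already 0 on functions that are not smooth near
  p.\<close>

lemma coordinate_vector_change:
  assumes c: "(U, c) \<in> A" "p \<in> U" and d: "(V, d) \<in> A" "p \<in> V"
  shows "coordinate_vector U c u p = coordinate_vector V d
    (frechet_derivative (\<lambda>x. d (inv_into U c x)) (at (c p)) u) p"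
proof -
  interpret id: manifold_map A A "\<lambda>p. p" by unfold_locales (simp add: smooth_map_def)
  have "pushforward A (\<lambda>p. p) p (coordinate_vector U c u p) = coordinate_vector U c u p"
    by (simp add: fun_eq_iff pushforward_def coordinate_vector_nonsmooth)
  then show ?thesis using id.pushforward_coordinate_vector[OF c d] by simp
qed

lemma coordinate_vector_in_tangent_space:
  "(U, c) \<in> A \<Longrightarrow> p \<in> U \<Longrightarrow> coordinate_vector U c u p \<in> tangent_space A p"
  unfolding tangent_space_eq by blast

text \<open>Two tangent vectors may come from different charts by definition. Describing all of them
  in one chart makes linear arguments possible, first of all closure under addition.\<close>

lemma tangent_space_chart:
  assumes "(U, c) \<in> A" "p \<in> U"
  shows "tangent_space A p = (\<lambda>u. coordinate_vector U c u p) ` UNIV"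
  unfolding tangent_space_eq using coordinate_vector_change[OF _ _ assms] assms by blast

lemma linear_coordinate_derivative:
  assumes "(U, c) \<in> A" "p \<in> U" "smooth_near A f p"
  shows "linear (frechet_derivative (\<lambda>x. f (inv_into U c x)) (at (c p)))"
  by (rule linear_frechet_derivative[OF smooth_near_differentiable[OF assms(3,1,2)]])

lemma coordinate_vector_add:
  assumes "(U, c) \<in> A" "p \<in> U"
  shows "coordinate_vector U c (u + w) p = coordinate_vector U c u p + coordinate_vector U c w p"
  using linear_add[OF linear_coordinate_derivative[OF assms]]
  by (simp add: fun_eq_iff coordinate_vector_def tvec_apply)

lemma coordinate_vector_scale:
  assumes "(U, c) \<in> A" "p \<in> U"
  shows "coordinate_vector U c (a *\<^sub>R u) p = a *\<^sub>T coordinate_vector U c u p"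
  using linear_scale[OF linear_coordinate_derivative[OF assms]]
  by (simp add: fun_eq_iff coordinate_vector_def tvec_apply)

lemma coordinate_vector_zero:
  assumes "(U, c) \<in> A" "p \<in> U"
  shows "coordinate_vector U c 0 p = 0"
  using linear_0[OF linear_coordinate_derivative[OF assms]]
  by (simp add: fun_eq_iff coordinate_vector_def tvec_apply)

lemma coordinate_vector_sum:
  assumes "(U, c) \<in> A" "p \<in> U"
  shows "coordinate_vector U c (\<Sum>i\<in>I. a i *\<^sub>R u i) p = (\<Sum>i\<in>I. a i *\<^sub>T coordinate_vector U c (u i) p)"
  by (induction I rule: infinite_finite_induct)
     (simp_all add: coordinate_vector_zero[OF assms] coordinate_vector_add[OF assms]
        coordinate_vector_scale[OF assms])

lemma subspace_tangent_space: "tvec.subspace (tangent_space A p)"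
proof -
  obtain U c where c: "(U, c) \<in> A" "p \<in> U" by (rule chart_exists)
  show ?thesis
  proof (rule tvec.subspaceI)
    show "0 \<in> tangent_space A p"
      unfolding tangent_space_chart[OF c] using coordinate_vector_zero[OF c] by (metis rangeI)
    show "v + w \<in> tangent_space A p" if "v \<in> tangent_space A p" "w \<in> tangent_space A p" for v w
      using that unfolding tangent_space_chart[OF c]
      by (auto simp: coordinate_vector_add[OF c, symmetric])
    show "a *\<^sub>T v \<in> tangent_space A p" if "v \<in> tangent_space A p" for a v
      using that unfolding tangent_space_chart[OF c]
      by (auto simp: coordinate_vector_scale[OF c, symmetric])
  qed
qed

lemmas tangent_space_add = tvec.subspace_add[OF subspace_tangent_space]
  and tangent_space_diff = tvec.subspace_diff[OF subspace_tangent_space]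
  and tangent_space_scale = tvec.subspace_scale[OF subspace_tangent_space]
  and tangent_space_zero = tvec.subspace_0[OF subspace_tangent_space]
  and tangent_space_sum = tvec.subspace_sum[OF subspace_tangent_space]

lemma tangent_nonsmooth: "v \<in> tangent_space A p \<Longrightarrow> \<not> smooth_near A f p \<Longrightarrow> v f = 0"
  unfolding tangent_space_eq by (auto simp: coordinate_vector_nonsmooth)

lemma coordinate_vector_coordinate:
  assumes c: "(U, c) \<in> A" "p \<in> U"
  shows "coordinate_vector U c u p (\<lambda>q. c q \<bullet> b) = u \<bullet> b"
proof -
  have "frechet_derivative (\<lambda>x. c (inv_into U c x) \<bullet> b) (at (c p))
      = frechet_derivative (\<lambda>x. x \<bullet> b) (at (c p))"
    by (rule frechet_derivative_cong_open[OF chart_range_open[OF c(1)]])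
       (use c in \<open>auto simp: f_inv_into_f\<close>)
  also have "\<dots> = (\<lambda>u. u \<bullet> b)"
    by (rule frechet_derivative_at[symmetric])
       (intro bounded_linear_imp_has_derivative bounded_linear_inner_left)
  finally show ?thesis by (simp add: coordinate_vector_def smooth_near_coordinate[OF c])
qed

text \<open>The coordinate functions are dual to the coordinate vectors, so applying v to them reads
  off its components.\<close>

lemma tangent_expand:
  assumes c: "(U, c) \<in> A" "p \<in> U" and v: "v \<in> tangent_space A p"
  shows "v = (\<Sum>b\<in>Basis. v (\<lambda>q. c q \<bullet> b) *\<^sub>T coordinate_vector U c b p)"
proof -
  obtain u where u: "v = coordinate_vector U c u p"
    using v unfolding tangent_space_chart[OF c] by blast
  have "v = coordinate_vector U c (\<Sum>b\<in>Basis. (u \<bullet> b) *\<^sub>R b) p"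
    unfolding u by (simp add: euclidean_representation)
  also have "\<dots> = (\<Sum>b\<in>Basis. (u \<bullet> b) *\<^sub>T coordinate_vector U c b p)"
    by (rule coordinate_vector_sum[OF c])
  finally show ?thesis unfolding u coordinate_vector_coordinate[OF c] .
qed

lemma tangent_cong:
  assumes v: "v \<in> tangent_space A p" and fg: "\<forall>\<^sub>F q in nhds p. f q = g q"
  shows "v f = v g"
proof -
  obtain U c u where c: "(U, c) \<in> A" "p \<in> U" and u: "v = coordinate_vector U c u p"
    using v unfolding tangent_space_eq by blast
  have "\<forall>\<^sub>F q in nhds p. q \<in> U \<and> f q = g q"
    using c chart_open fg by (intro eventually_conj) (auto intro: eventually_nhds_in_open)
  then obtain W where W: "open W" "p \<in> W" "\<And>q. q \<in> W \<Longrightarrow> q \<in> U \<and> f q = g q"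
    unfolding eventually_nhds by blast
  have "frechet_derivative (\<lambda>x. f (inv_into U c x)) (at (c p))
      = frechet_derivative (\<lambda>x. g (inv_into U c x)) (at (c p))"
  proof (rule frechet_derivative_cong_open)
    show "open (c ` W)" by (rule chart_image_open[OF c(1) W(1)]) (use W in blast)
  qed (use W chart_inv[OF c(1)] in auto)
  \<comment> \<open>The two functions must also be smooth or non-smooth together; otherwise one
    value could be a derivative and the other the default 0.\<close>
  moreover have "smooth_near A f p \<longleftrightarrow> smooth_near A g p"
    using smooth_near_cong[of f g p] smooth_near_cong[of g f p] fg by (auto simp: eq_commute)
  ultimately show ?thesis by (simp add: u coordinate_vector_def)
qed

lemma tangent_const:
  assumes "v \<in> tangent_space A p" shows "v (\<lambda>q. a) = 0"
  using assms by (auto simp: tangent_space_eq coordinate_vector_def)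

lemma tangent_add_fun:
  assumes v: "v \<in> tangent_space A p" and f: "smooth_near A f p" and g: "smooth_near A g p"
  shows "v (\<lambda>q. f q + g q) = v f + v g"
proof -
  obtain U c u where c: "(U, c) \<in> A" "p \<in> U" and u: "v = coordinate_vector U c u p"
    using v unfolding tangent_space_eq by blast
  note d = has_derivative_add[OF
      smooth_near_differentiable[OF f c, unfolded frechet_derivative_works]
      smooth_near_differentiable[OF g c, unfolded frechet_derivative_works]]
  show ?thesis
    using fun_cong[OF frechet_derivative_at[OF d], of u] f g
    by (simp add: u coordinate_vector_def smooth_near_add)
qed

lemma tangent_mult_fun:
  assumes v: "v \<in> tangent_space A p" and f: "smooth_near A f p" and g: "smooth_near A g p"
  shows "v (\<lambda>q. f q * g q) = v f * g p + f p * v g"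
proof -
  obtain U c u where c: "(U, c) \<in> A" "p \<in> U" and u: "v = coordinate_vector U c u p"
    using v unfolding tangent_space_eq by blast
  note d = has_derivative_mult[OF
      smooth_near_differentiable[OF f c, unfolded frechet_derivative_works]
      smooth_near_differentiable[OF g c, unfolded frechet_derivative_works]]
  show ?thesis
    using fun_cong[OF frechet_derivative_at[OF d], of u] f g
    by (simp add: u coordinate_vector_def smooth_near_mult chart_inv[OF c])
qed

lemma tangent_sum_fun:
  assumes v: "v \<in> tangent_space A p" and "finite I" "\<And>i. i \<in> I \<Longrightarrow> smooth_near A (f i) p"
  shows "v (\<lambda>q. \<Sum>i\<in>I. f i q) = (\<Sum>i\<in>I. v (f i))"
  using assms(2,3)
  by (induction rule: finite_induct)
     (simp_all add: tangent_const[OF v] tangent_add_fun[OF v] smooth_near_sum)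

lemma coordinate_vector_field:
  assumes c: "(U, c) \<in> A" "p \<in> U"
  shows "vector_field_near A p (coordinate_vector U c u)"
  unfolding section_near_def section_on_def
proof (intro exI[of _ U] conjI ballI allI impI)
  fix q assume q: "q \<in> U"
  show "coordinate_vector U c u q \<in> tangent_space A q"
    by (rule coordinate_vector_in_tangent_space[OF c(1) q])
  fix f assume f: "smooth_near A f q"
  obtain V where V: "open V" "q \<in> V" "V \<subseteq> U" "smooth_on (c ` V) (\<lambda>x. f (inv_into U c x))"
    "open (c ` V)" "c q \<in> c ` V"
    by (rule smooth_near_chartE[OF f c(1) q])
  \<comment> \<open>On all of V the default value 0 does not occur, so the function is a genuine
    partial derivative there.\<close>
  have sm: "smooth_near A f r" if "r \<in> V" for r
    using smooth_near_chart[of U c r f] c(1) V that by blast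
  have "smooth_on (c ` V) (\<lambda>x. coordinate_vector U c u (inv_into U c x) f)"
    by (rule smooth_on_cong[OF V(5) _ smooth_on_frechet_derivative[OF V(4), of u]])
       (use V(3) chart_inv[OF c(1)] sm in \<open>auto simp: coordinate_vector_def\<close>)
  then show "smooth_near A (\<lambda>r. coordinate_vector U c u r f) q"
    unfolding smooth_near_chart[OF c(1) q] using V by blast
qed (use c chart_open in auto)

text \<open>Lets identities stated for fields, such as the antisymmetry of h, be applied to single
  vectors. The extension is a coordinate field.\<close>

lemma tangent_extend:
  assumes "v \<in> tangent_space A p"
  obtains X where "vector_field_near A p X" "X p = v"
  using assms coordinate_vector_field unfolding tangent_space_eq by blast

end

section \<open>Sections along a map\<close>

context manifold_map
begin

lemma section_cong:
  assumes "section_near B A \<iota> p V" "\<forall>\<^sub>F q in nhds p. V q = W q"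
  shows "section_near B A \<iota> p W"
  unfolding section_near_iff
proof (rule eventually_elim2[OF section_near_eventually[OF assms(1)]])
  show "\<forall>\<^sub>F q in nhds p. \<forall>\<^sub>F r in nhds q. V r = W r"
    using assms(2) by (simp add: eventually_eventually)
  fix q assume V: "section_near B A \<iota> q V" and eq: "\<forall>\<^sub>F r in nhds q. V r = W r"
  have "W q \<in> tangent_space A (\<iota> q)"
    using section_near_in_tangent_space[OF V] eventually_nhds_x_imp_x[OF eq] by simp
  moreover have "smooth_near B (\<lambda>r. W r f) q" if "smooth_near A f (\<iota> q)" for f
    by (rule source.smooth_near_cong[OF eventually_mono[OF eq] section_near_smooth[OF V that]]) simp
  ultimately show "W q \<in> tangent_space A (\<iota> q) \<and>
      (\<forall>f. smooth_near A f (\<iota> q) \<longrightarrow> smooth_near B (\<lambda>r. W r f) q)" by simp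
qed

lemma section_add:
  assumes "section_near B A \<iota> p V" "section_near B A \<iota> p W"
  shows "section_near B A \<iota> p (\<lambda>q. V q + W q)"
  using assms unfolding section_near_iff
  by eventually_elim (auto simp: tvec_apply intro: target.tangent_space_add source.smooth_near_add)

lemma section_scale:
  assumes "smooth_near B f p" "section_near B A \<iota> p V"
  shows "section_near B A \<iota> p (\<lambda>q. f q *\<^sub>T V q)"
  using source.smooth_near_eventually[OF assms(1)] assms(2) unfolding section_near_iff
  by eventually_elim (auto simp: tvec_apply intro: target.tangent_space_scale source.smooth_near_mult)

lemma section_diff:
  assumes "section_near B A \<iota> p V" "section_near B A \<iota> p W"
  shows "section_near B A \<iota> p (\<lambda>q. V q - W q)"
  using assms unfolding section_near_iff
  by eventually_elim (auto simp: tvec_apply intro: target.tangent_space_diff source.smooth_near_diff)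

lemma section_zero: "section_near B A \<iota> p (\<lambda>q. 0)"
  unfolding section_near_iff
  by (simp add: tvec_apply target.tangent_space_zero source.smooth_near_const)

lemma section_sum:
  assumes "finite I" "\<And>i. i \<in> I \<Longrightarrow> section_near B A \<iota> p (V i)"
  shows "section_near B A \<iota> p (\<lambda>q. \<Sum>i\<in>I. V i q)"
  using assms by (induction rule: finite_induct) (auto intro: section_zero section_add)

lemma section_pullback:
  assumes "vector_field_near A (\<iota> p) Y"
  shows "section_near B A \<iota> p (\<lambda>q. Y (\<iota> q))"
  using eventually_pullback[OF assms[unfolded section_near_iff]] unfolding section_near_iff
  by eventually_elim (auto intro: smooth_near_pullback)

lemma pushforward_add: "pushforward A \<iota> p (v + w) = pushforward A \<iota> p v + pushforward A \<iota> p w"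
  and pushforward_diff: "pushforward A \<iota> p (v - w) = pushforward A \<iota> p v - pushforward A \<iota> p w"
  and pushforward_scale: "pushforward A \<iota> p (a *\<^sub>T v) = a *\<^sub>T pushforward A \<iota> p v"
  and pushforward_zero: "pushforward A \<iota> p 0 = 0"
  by (auto simp: pushforward_def fun_eq_iff tvec_apply)

lemma pushforward_sum: "pushforward A \<iota> p (\<Sum>i\<in>I. v i) = (\<Sum>i\<in>I. pushforward A \<iota> p (v i))"
  by (induction I rule: infinite_finite_induct) (auto simp: pushforward_zero pushforward_add)

lemma pushforward_in_tangent_space:
  assumes "v \<in> tangent_space B p"
  shows "pushforward A \<iota> p v \<in> tangent_space A (\<iota> p)"
proof -
  obtain U c u where c: "(U, c) \<in> B" "p \<in> U" and u: "v = source.coordinate_vector U c u p"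
    using assms unfolding source.tangent_space_eq by blast
  obtain V d where d: "(V, d) \<in> A" "\<iota> p \<in> V" by (rule target.chart_exists)
  show ?thesis
    unfolding u pushforward_coordinate_vector[OF c d]
    by (rule target.coordinate_vector_in_tangent_space[OF d])
qed

lemma section_pushforward:
  assumes "vector_field_near B p X"
  shows "section_near B A \<iota> p (\<lambda>q. pushforward A \<iota> q (X q))"
  using section_near_eventually[OF assms] unfolding section_near_iff[of B A \<iota>]
proof eventually_elim
  fix q assume X: "vector_field_near B q X"
  have "smooth_near B (\<lambda>r. pushforward A \<iota> r (X r) f) q" if f: "smooth_near A f (\<iota> q)" for f
  proof (rule source.smooth_near_cong[OF _ section_near_smooth[OF X smooth_near_pullback[OF f]]])
    \<comment> \<open>The pushforward returns X(f o \<iota>) only at points where f is smooth, hence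
      the detour through a neighbourhood.\<close>
    show "\<forall>\<^sub>F r in nhds q. X r (\<lambda>s. f (\<iota> s)) = pushforward A \<iota> r (X r) f"
      using eventually_pullback[OF target.smooth_near_eventually[OF f]]
      by eventually_elim (simp add: pushforward_def)
  qed
  then show "pushforward A \<iota> q (X q) \<in> tangent_space A (\<iota> q) \<and>
      (\<forall>f. smooth_near A f (\<iota> q) \<longrightarrow> smooth_near B (\<lambda>r. pushforward A \<iota> r (X r) f) q)"
    using pushforward_in_tangent_space section_near_in_tangent_space[OF X] by blast
qed

lemma section_expand:
  assumes d: "(V, d) \<in> A" "\<iota> p \<in> V" and W: "section_near B A \<iota> p W"
  shows "\<forall>\<^sub>F q in nhds p. W q =
    (\<Sum>b\<in>Basis. W q (\<lambda>r. d r \<bullet> b) *\<^sub>T target.coordinate_vector V d b (\<iota> q))"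
proof -
  have "\<forall>\<^sub>F q in nhds p. \<iota> q \<in> V"
    using d target.chart_open by (intro eventually_pullback eventually_nhds_in_open) auto
  then show ?thesis
    using W unfolding section_near_iff
    by eventually_elim (auto intro!: target.tangent_expand[OF d(1)])
qed

text \<open>Near p every section along \<iota> is a combination, with smooth coefficients on the
  source, of restricted coordinate fields of the target. Hence a property stable under sums,
  multiples and change outside a neighbourhood need only be checked on restrictions of ambient
  fields.\<close>

lemma section_induct [consumes 1, case_names pullback add scale cong]:
  assumes W: "section_near B A \<iota> p W"
    and base: "\<And>Y. vector_field_near A (\<iota> p) Y \<Longrightarrow> P (\<lambda>q. Y (\<iota> q))"
    and add: "\<And>V W. section_near B A \<iota> p V \<Longrightarrow> section_near B A \<iota> p W \<Longrightarrow> P V \<Longrightarrow> P W \<Longrightarrow>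
      P (\<lambda>q. V q + W q)"
    and scale: "\<And>f V. smooth_near B f p \<Longrightarrow> section_near B A \<iota> p V \<Longrightarrow> P V \<Longrightarrow> P (\<lambda>q. f q *\<^sub>T V q)"
    and cong: "\<And>V W. section_near B A \<iota> p V \<Longrightarrow> P V \<Longrightarrow> \<forall>\<^sub>F q in nhds p. V q = W q \<Longrightarrow> P W"
  shows "P W"
proof -
  obtain V d where d: "(V, d) \<in> A" "\<iota> p \<in> V" by (rule target.chart_exists)
  let ?T = "\<lambda>b q. W q (\<lambda>r. d r \<bullet> b) *\<^sub>T target.coordinate_vector V d b (\<iota> q)"
  have smooth: "smooth_near B (\<lambda>q. W q (\<lambda>r. d r \<bullet> b)) p" for b
    by (rule section_near_smooth[OF W target.smooth_near_coordinate[OF d]])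
  note field = target.coordinate_vector_field[OF d]
  have sec: "section_near B A \<iota> p (?T b)" for b
    by (rule section_scale[OF smooth section_pullback[OF field]])
  have T: "P (?T b)" for b
    by (rule scale[OF smooth section_pullback[OF field] base[OF field]])
  have "finite I \<Longrightarrow> P (\<lambda>q. \<Sum>b\<in>I. ?T b q)" for I
  proof (induction rule: finite_induct)
    case empty
    \<comment> \<open>The rule has no case for the zero section, so the empty sum is produced as 0
      times a summand with an arbitrary index.\<close>
    have "P (\<lambda>q. (0::real) *\<^sub>T ?T undefined q)"
      by (rule scale[OF source.smooth_near_const sec T])
    then show ?case by simp
  next
    case (insert b I)
    then show ?case using add[OF sec[of b] section_sum[OF insert.hyps(1) sec] T[of b]] by simp
  qed
  then have "P (\<lambda>q. \<Sum>b\<in>Basis. ?T b q)" by simp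
  then show ?thesis
    by (rule cong[OF section_sum[OF finite_Basis sec]])
       (use section_expand[OF d W] in \<open>simp add: eq_commute\<close>)
qed

lemma eventually_section_tangent:
  "section_near B A \<iota> p V \<Longrightarrow> \<forall>\<^sub>F q in nhds p. V q \<in> tangent_space A (\<iota> q)"
  unfolding section_near_iff by (erule eventually_mono) blast

end

section \<open>Tensor fields evaluated on sections along a map\<close>

lemma bilinear_formD:
  assumes "bilinear_form A b" "u \<in> tangent_space A p" "v \<in> tangent_space A p" "w \<in> tangent_space A p"
  shows "b p (u + v) w = b p u w + b p v w" "b p w (u + v) = b p w u + b p w v"
    "b p (a *\<^sub>T v) w = a * b p v w" "b p w (a *\<^sub>T v) = a * b p w v"
  using assms unfolding bilinear_form_def by blast+

lemma riemannian_metricD: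
  assumes "riemannian_metric A g" "v \<in> tangent_space A p" "w \<in> tangent_space A p"
  shows "g p v w = g p w v" "v \<noteq> 0 \<Longrightarrow> g p v v > 0"
  using assms unfolding riemannian_metric_def by blast+

lemma one_formD:
  assumes "one_form A \<omega>" "v \<in> tangent_space A p" "w \<in> tangent_space A p"
  shows "\<omega> p (v + w) = \<omega> p v + \<omega> p w" "\<omega> p (a *\<^sub>T v) = a * \<omega> p v"
  using assms unfolding one_form_def by blast+

lemma endomorphism_fieldD:
  assumes "endomorphism_field A \<phi>" "v \<in> tangent_space A p" "w \<in> tangent_space A p"
  shows "\<phi> p v \<in> tangent_space A p" "\<phi> p (v + w) = \<phi> p v + \<phi> p w" "\<phi> p (a *\<^sub>T v) = a *\<^sub>T \<phi> p v"
  using assms unfolding endomorphism_field_def by blast+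

context manifold_map
begin

lemma one_form_section:
  assumes \<omega>: "one_form A \<omega>" and V: "section_near B A \<iota> p V"
  shows "smooth_near B (\<lambda>q. \<omega> (\<iota> q) (V q)) p"
  using V
proof (induction rule: section_induct)
  case (pullback Y)
  then have "smooth_near A (\<lambda>r. \<omega> r (Y r)) (\<iota> p)" using \<omega> unfolding one_form_def by blast
  then show ?case by (rule smooth_near_pullback)
next
  case (add V W)
  have "\<forall>\<^sub>F q in nhds p. \<omega> (\<iota> q) (V q) + \<omega> (\<iota> q) (W q) = \<omega> (\<iota> q) (V q + W q)"
    using eventually_section_tangent[OF add(1)] eventually_section_tangent[OF add(2)]
    by eventually_elim (simp add: one_formD[OF \<omega>])
  then show ?case by (rule source.smooth_near_cong) (intro source.smooth_near_add add)
next
  case (scale f V)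
  have "\<forall>\<^sub>F q in nhds p. f q * \<omega> (\<iota> q) (V q) = \<omega> (\<iota> q) (f q *\<^sub>T V q)"
    using eventually_section_tangent[OF scale(2)] by eventually_elim (simp add: one_formD[OF \<omega>])
  then show ?case by (rule source.smooth_near_cong) (intro source.smooth_near_mult scale)
next
  case (cong V W)
  show ?case
    by (rule source.smooth_near_cong[OF eventually_mono[OF cong(2)] cong(3)]) simp
qed

text \<open>Reduces one argument to a restricted ambient field. Applied a second time to the flipped
  form, it reduces the other argument as well.\<close>

lemma bilinear_form_section_left:
  assumes b: "bilinear_form A b" and V: "section_near B A \<iota> p V" and W: "section_near B A \<iota> p W"
    and Y: "\<And>Y. vector_field_near A (\<iota> p) Y \<Longrightarrow> smooth_near B (\<lambda>q. b (\<iota> q) (Y (\<iota> q)) (W q)) p"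
  shows "smooth_near B (\<lambda>q. b (\<iota> q) (V q) (W q)) p"
  using V
proof (induction rule: section_induct)
  case (pullback Y)
  then show ?case by (rule Y)
next
  case (add V V')
  have "\<forall>\<^sub>F q in nhds p. b (\<iota> q) (V q) (W q) + b (\<iota> q) (V' q) (W q) = b (\<iota> q) (V q + V' q) (W q)"
    using eventually_section_tangent[OF add(1)] eventually_section_tangent[OF add(2)]
      eventually_section_tangent[OF W]
    by eventually_elim (simp add: bilinear_formD[OF b])
  then show ?case by (rule source.smooth_near_cong) (intro source.smooth_near_add add)
next
  case (scale f V)
  have "\<forall>\<^sub>F q in nhds p. f q * b (\<iota> q) (V q) (W q) = b (\<iota> q) (f q *\<^sub>T V q) (W q)"
    using eventually_section_tangent[OF scale(2)] eventually_section_tangent[OF W]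
    by eventually_elim (simp add: bilinear_formD[OF b])
  then show ?case by (rule source.smooth_near_cong) (intro source.smooth_near_mult scale)
next
  case (cong V W)
  show ?case
    by (rule source.smooth_near_cong[OF eventually_mono[OF cong(2)] cong(3)]) simp
qed

lemma bilinear_form_flip: "bilinear_form A b \<Longrightarrow> bilinear_form A (\<lambda>p v w. b p w v)"
  unfolding bilinear_form_def by blast

lemma bilinear_form_section:
  assumes b: "bilinear_form A b" and V: "section_near B A \<iota> p V" and W: "section_near B A \<iota> p W"
  shows "smooth_near B (\<lambda>q. b (\<iota> q) (V q) (W q)) p"
proof (rule bilinear_form_section_left[OF b V W])
  fix Y assume Y: "vector_field_near A (\<iota> p) Y"
  show "smooth_near B (\<lambda>q. b (\<iota> q) (Y (\<iota> q)) (W q)) p"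
  proof (rule bilinear_form_section_left[OF bilinear_form_flip[OF b] W section_pullback[OF Y]])
    fix Z assume "vector_field_near A (\<iota> p) Z"
    then have "smooth_near A (\<lambda>r. b r (Y r) (Z r)) (\<iota> p)"
      using b Y unfolding bilinear_form_def by blast
    then show "smooth_near B (\<lambda>q. b (\<iota> q) (Y (\<iota> q)) (Z (\<iota> q))) p" by (rule smooth_near_pullback)
  qed
qed

lemma endomorphism_field_section:
  assumes \<phi>: "endomorphism_field A \<phi>" and V: "section_near B A \<iota> p V"
  shows "section_near B A \<iota> p (\<lambda>q. \<phi> (\<iota> q) (V q))"
  using V
proof (induction rule: section_induct)
  case (pullback Y)
  then have "vector_field_near A (\<iota> p) (\<lambda>r. \<phi> r (Y r))"
    using \<phi> unfolding endomorphism_field_def by blast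
  then show ?case by (rule section_pullback)
next
  case (add V W)
  have "\<forall>\<^sub>F q in nhds p. \<phi> (\<iota> q) (V q) + \<phi> (\<iota> q) (W q) = \<phi> (\<iota> q) (V q + W q)"
    using eventually_section_tangent[OF add(1)] eventually_section_tangent[OF add(2)]
    by eventually_elim (simp add: endomorphism_fieldD[OF \<phi>])
  then show ?case by (rule section_cong[rotated]) (intro section_add add)
next
  case (scale f V)
  have "\<forall>\<^sub>F q in nhds p. f q *\<^sub>T \<phi> (\<iota> q) (V q) = \<phi> (\<iota> q) (f q *\<^sub>T V q)"
    using eventually_section_tangent[OF scale(2)]
    by eventually_elim (simp add: endomorphism_fieldD[OF \<phi>])
  then show ?case by (rule section_cong[rotated]) (intro section_scale scale)
next
  case (cong V W)
  show ?case by (rule section_cong[OF cong(3) eventually_mono[OF cong(2)]]) simp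
qed

end

section \<open>Connections along a map\<close>

locale map_connection = manifold_map B A \<iota>
  for B :: "('n::{t2_space,second_countable_topology}, 'k::euclidean_space) atlas"
    and A :: "('m::{t2_space,second_countable_topology}, 'e::euclidean_space) atlas"
    and \<iota> :: "'n \<Rightarrow> 'm" +
  fixes D :: "'n \<Rightarrow> 'n tvec \<Rightarrow> ('n \<Rightarrow> 'm tvec) \<Rightarrow> 'm tvec"
  assumes connection: "connection_along B A \<iota> D"
begin

lemma D_in_tangent_space:
  "section_near B A \<iota> p V \<Longrightarrow> v \<in> tangent_space B p \<Longrightarrow> D p v V \<in> tangent_space A (\<iota> p)"
  using connection unfolding connection_along_def by blast

lemma D_direction_add:
  "section_near B A \<iota> p V \<Longrightarrow> v \<in> tangent_space B p \<Longrightarrow> w \<in> tangent_space B p \<Longrightarrow>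
    D p (v + w) V = D p v V + D p w V"
  using connection unfolding connection_along_def by blast

lemma D_direction_scale:
  "section_near B A \<iota> p V \<Longrightarrow> v \<in> tangent_space B p \<Longrightarrow> D p (a *\<^sub>T v) V = a *\<^sub>T D p v V"
  using connection unfolding connection_along_def by blast

lemma D_direction_sum:
  assumes "section_near B A \<iota> p V" "\<And>i. i \<in> I \<Longrightarrow> v i \<in> tangent_space B p"
  shows "D p (\<Sum>i\<in>I. a i *\<^sub>T v i) V = (\<Sum>i\<in>I. a i *\<^sub>T D p (v i) V)"
proof -
  have "D p (0 *\<^sub>T 0) V = 0 *\<^sub>T D p 0 V"
    by (rule D_direction_scale[OF assms(1) source.tangent_space_zero])
  then have zero: "D p 0 V = 0" by simp
  show ?thesis
    using assms(2)
  proof (induction I rule: infinite_finite_induct)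
    case (insert i I)
    have "(\<Sum>i\<in>I. a i *\<^sub>T v i) \<in> tangent_space B p"
      by (intro source.tangent_space_sum source.tangent_space_scale) (use insert.prems in simp)
    then show ?case
      using insert source.tangent_space_scale[of "v i" p]
      by (simp add: D_direction_add[OF assms(1)] D_direction_scale[OF assms(1)])
  qed (simp_all add: zero)
qed

lemma D_add:
  "v \<in> tangent_space B p \<Longrightarrow> section_near B A \<iota> p V \<Longrightarrow> section_near B A \<iota> p W \<Longrightarrow>
    D p v (\<lambda>q. V q + W q) = D p v V + D p v W"
  using connection unfolding connection_along_def by blast

lemma D_scale:
  "v \<in> tangent_space B p \<Longrightarrow> smooth_near B f p \<Longrightarrow> section_near B A \<iota> p V \<Longrightarrow>
    D p v (\<lambda>q. f q *\<^sub>T V q) = v f *\<^sub>T V p + f p *\<^sub>T D p v V"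
  using connection unfolding connection_along_def by blast

lemma D_section:
  "vector_field_near B p X \<Longrightarrow> section_near B A \<iota> p V \<Longrightarrow> section_near B A \<iota> p (\<lambda>q. D q (X q) V)"
  using connection unfolding connection_along_def by blast

text \<open>Multiplying by the indicator function of a small neighbourhood, which is smooth near the
  point, turns equality of germs into equality of total functions.\<close>

lemma D_cong:
  assumes v: "v \<in> tangent_space B p" and V: "section_near B A \<iota> p V"
    and eq: "\<forall>\<^sub>F q in nhds p. V q = W q"
  shows "D p v V = D p v W"
proof -
  obtain U where U: "open U" "p \<in> U" "\<And>q. q \<in> U \<Longrightarrow> V q = W q"
    using eq unfolding eventually_nhds by blast
  define f where "f = (indicator U :: 'n \<Rightarrow> real)"
  have one: "\<forall>\<^sub>F q in nhds p. 1 = f q"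
    unfolding eventually_nhds f_def using U by (intro exI[of _ U]) auto
  have f: "smooth_near B f p"
    by (rule source.smooth_near_cong[OF one source.smooth_near_const])
  have vf: "v f = 0"
    using source.tangent_cong[OF v one] source.tangent_const[OF v] by simp
  have fp: "f p = 1" using U by (simp add: f_def)
  have "f q *\<^sub>T V q = f q *\<^sub>T W q" for q
    by (cases "q \<in> U") (simp_all add: f_def U(3))
  then have fVW: "(\<lambda>q. f q *\<^sub>T V q) = (\<lambda>q. f q *\<^sub>T W q)" by (rule ext)
  have "D p v V = D p v (\<lambda>q. f q *\<^sub>T V q)"
    using D_scale[OF v f V] by (simp add: vf fp)
  also have "\<dots> = D p v W"
    unfolding fVW using D_scale[OF v f section_cong[OF V eq]] by (simp add: vf fp)
  finally show ?thesis .
qed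

lemma D_zero:
  assumes v: "v \<in> tangent_space B p" and "\<forall>\<^sub>F q in nhds p. V q = 0"
  shows "D p v V = 0"
proof -
  have "\<forall>\<^sub>F q in nhds p. 0 = V q" using assms(2) by (rule eventually_mono) simp
  then have "D p v (\<lambda>q. 0) = D p v V" by (rule D_cong[OF v section_zero])
  moreover have "D p v (\<lambda>q. 0) = 0"
    using D_scale[OF v source.smooth_near_const[of 0] section_zero] by simp
  ultimately show ?thesis by simp
qed

lemma D_diff:
  assumes v: "v \<in> tangent_space B p" and V: "section_near B A \<iota> p V" and W: "section_near B A \<iota> p W"
  shows "D p v (\<lambda>q. V q - W q) = D p v V - D p v W"
  using D_add[OF v section_diff[OF V W] W] by simp

lemma D_sum:
  assumes v: "v \<in> tangent_space B p" and "finite I" "\<And>i. i \<in> I \<Longrightarrow> section_near B A \<iota> p (V i)"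
  shows "D p v (\<lambda>q. \<Sum>i\<in>I. V i q) = (\<Sum>i\<in>I. D p v (V i))"
  using assms(2,3)
  by (induction rule: finite_induct) (simp_all add: D_zero[OF v] D_add[OF v] section_sum)

end

section \<open>The pulled-back Levi-Civita connection is metric and torsion-free\<close>

locale metric_pullback = map_connection B A \<iota> D
  for B :: "('n::{t2_space,second_countable_topology}, 'k::euclidean_space) atlas"
    and A :: "('m::{t2_space,second_countable_topology}, 'e::euclidean_space) atlas"
    and \<iota> :: "'n \<Rightarrow> 'm" and D +
  fixes g :: "'m \<Rightarrow> 'm tvec \<Rightarrow> 'm tvec \<Rightarrow> real"
    and nabla :: "'m \<Rightarrow> 'm tvec \<Rightarrow> ('m \<Rightarrow> 'm tvec) \<Rightarrow> 'm tvec"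
  assumes metric: "riemannian_metric A g" and levi_civita: "levi_civita A g nabla"
    and pullback: "pullback_connection B A \<iota> nabla D"
begin

sublocale nabla: map_connection A A "\<lambda>p. p" nabla
  by unfold_locales (use levi_civita in \<open>auto simp: smooth_map_def levi_civita_def\<close>)

lemma bilinear: "bilinear_form A g"
  using metric unfolding riemannian_metric_def by blast

lemma D_pullback:
  "v \<in> tangent_space B p \<Longrightarrow> vector_field_near A (\<iota> p) Y \<Longrightarrow>
    D p v (\<lambda>q. Y (\<iota> q)) = nabla (\<iota> p) (pushforward A \<iota> p v) Y"
  using pullback unfolding pullback_connection_def by blast

lemma metric_section:
  "section_near B A \<iota> p V \<Longrightarrow> section_near B A \<iota> p W \<Longrightarrow>
    smooth_near B (\<lambda>q. g (\<iota> q) (V q) (W q)) p"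
  by (rule bilinear_form_section[OF bilinear])

text \<open>Both sides are additive and satisfy the same Leibniz rule in each section, so only
  restricted ambient fields remain. There the claim is metric compatibility of \<open>nabla\<close>
  in the pushed-forward direction.\<close>

lemma D_metric:
  assumes v: "v \<in> tangent_space B p" and V: "section_near B A \<iota> p V" and W: "section_near B A \<iota> p W"
  shows "v (\<lambda>q. g (\<iota> q) (V q) (W q)) = g (\<iota> p) (D p v V) (W p) + g (\<iota> p) (V p) (D p v W)"
proof -
  let ?P = "\<lambda>V W. v (\<lambda>q. g (\<iota> q) (V q) (W q)) = g (\<iota> p) (D p v V) (W p) + g (\<iota> p) (V p) (D p v W)"
  note T = section_near_in_tangent_space D_in_tangent_space[OF _ v]
  have sym: "?P V W" if V: "section_near B A \<iota> p V" and W: "section_near B A \<iota> p W" and "?P W V" for V W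
  proof -
    have "\<forall>\<^sub>F q in nhds p. g (\<iota> q) (V q) (W q) = g (\<iota> q) (W q) (V q)"
      using eventually_section_tangent[OF V] eventually_section_tangent[OF W]
      by eventually_elim (rule riemannian_metricD(1)[OF metric])
    then have "v (\<lambda>q. g (\<iota> q) (V q) (W q)) = v (\<lambda>q. g (\<iota> q) (W q) (V q))"
      by (rule source.tangent_cong[OF v])
    then show ?thesis
      using that(3) riemannian_metricD(1)[OF metric T(2)[OF V] T(1)[OF W]]
        riemannian_metricD(1)[OF metric T(1)[OF V] T(2)[OF W]] by simp
  qed
  have left: "?P V W" if V: "section_near B A \<iota> p V" and W: "section_near B A \<iota> p W"
    and Y: "\<And>Y. vector_field_near A (\<iota> p) Y \<Longrightarrow> ?P (\<lambda>q. Y (\<iota> q)) W" for V W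
    using V
  proof (induction rule: section_induct)
    case (pullback Y)
    then show ?case by (rule Y)
  next
    case (add V V')
    have "\<forall>\<^sub>F q in nhds p. g (\<iota> q) (V q + V' q) (W q) = g (\<iota> q) (V q) (W q) + g (\<iota> q) (V' q) (W q)"
      using eventually_section_tangent[OF add(1)] eventually_section_tangent[OF add(2)]
        eventually_section_tangent[OF W]
      by eventually_elim (simp add: bilinear_formD[OF bilinear])
    then have "v (\<lambda>q. g (\<iota> q) (V q + V' q) (W q)) =
        v (\<lambda>q. g (\<iota> q) (V q) (W q) + g (\<iota> q) (V' q) (W q))"
      by (rule source.tangent_cong[OF v])
    also have "\<dots> = v (\<lambda>q. g (\<iota> q) (V q) (W q)) + v (\<lambda>q. g (\<iota> q) (V' q) (W q))"
      by (intro source.tangent_add_fun[OF v] metric_section add W)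
    finally show ?case
      using T[OF add(1)] T[OF add(2)] T[OF W]
      by (simp add: add(3,4) D_add[OF v add(1,2)] bilinear_formD[OF bilinear])
  next
    case (scale f V)
    have "\<forall>\<^sub>F q in nhds p. g (\<iota> q) (f q *\<^sub>T V q) (W q) = f q * g (\<iota> q) (V q) (W q)"
      using eventually_section_tangent[OF scale(2)] eventually_section_tangent[OF W]
      by eventually_elim (simp add: bilinear_formD[OF bilinear])
    then have "v (\<lambda>q. g (\<iota> q) (f q *\<^sub>T V q) (W q)) = v (\<lambda>q. f q * g (\<iota> q) (V q) (W q))"
      by (rule source.tangent_cong[OF v])
    also have "\<dots> = v f * g (\<iota> p) (V p) (W p) + f p * v (\<lambda>q. g (\<iota> q) (V q) (W q))"
      by (intro source.tangent_mult_fun[OF v] metric_section scale W)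
    finally show ?case
      using T[OF scale(2)] T[OF W]
      by (simp add: scale(3) D_scale[OF v scale(1,2)] bilinear_formD[OF bilinear]
          target.tangent_space_scale algebra_simps)
  next
    case (cong V V')
    have "v (\<lambda>q. g (\<iota> q) (V q) (W q)) = v (\<lambda>q. g (\<iota> q) (V' q) (W q))"
      by (rule source.tangent_cong[OF v eventually_mono[OF cong(2)]]) simp
    then show ?case
      using cong(3) D_cong[OF v cong(1,2)] eventually_nhds_x_imp_x[OF cong(2)] by simp
  qed
  show ?thesis
  proof (rule left[OF V W])
    fix Y assume Y: "vector_field_near A (\<iota> p) Y"
    show "?P (\<lambda>q. Y (\<iota> q)) W"
    \<comment> \<open>The first argument is now a restricted field. Swapping the arguments lets
      \<open>left\<close> treat the second one in the same way.\<close>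
    proof (rule sym[OF section_pullback[OF Y] W], rule left[OF W section_pullback[OF Y]])
      fix Z assume Z: "vector_field_near A (\<iota> p) Z"
      have "smooth_near A (\<lambda>r. g r (Z r) (Y r)) (\<iota> p)"
        using bilinear Y Z unfolding bilinear_form_def by blast
      then have "v (\<lambda>q. g (\<iota> q) (Z (\<iota> q)) (Y (\<iota> q)))
          = pushforward A \<iota> p v (\<lambda>r. g r (Z r) (Y r))"
        by (simp add: pushforward_def)
      also have "\<dots> = g (\<iota> p) (nabla (\<iota> p) (pushforward A \<iota> p v) Z) (Y (\<iota> p))
          + g (\<iota> p) (Z (\<iota> p)) (nabla (\<iota> p) (pushforward A \<iota> p v) Y)"
        using levi_civita pushforward_in_tangent_space[OF v] Y Z unfolding levi_civita_def by blast
      finally show "?P (\<lambda>q. Z (\<iota> q)) (\<lambda>q. Y (\<iota> q))"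
        unfolding D_pullback[OF v Y] D_pullback[OF v Z] .
    qed
  qed
qed

text \<open>Both pushed-forward fields are expanded in an ambient coordinate frame, and each
  covariant derivative is compared with the matching iterated derivative of f o \<iota>. The
  difference is a symmetric expression in the two fields, so antisymmetrising leaves just the
  bracket.\<close>

lemma D_torsion_free:
  assumes X: "vector_field_near B p X" and Y: "vector_field_near B p Y"
  shows "D p (X p) (\<lambda>q. pushforward A \<iota> q (Y q)) - D p (Y p) (\<lambda>q. pushforward A \<iota> q (X q))
    = pushforward A \<iota> p (lie_bracket B X Y p)"
proof
  fix f
  note Xp = section_near_in_tangent_space[OF X] and Yp = section_near_in_tangent_space[OF Y]
  show "(D p (X p) (\<lambda>q. pushforward A \<iota> q (Y q)) - D p (Y p) (\<lambda>q. pushforward A \<iota> q (X q))) f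
    = pushforward A \<iota> p (lie_bracket B X Y p) f"
  proof (cases "smooth_near A f (\<iota> p)")
    case False
    then show ?thesis
      using target.tangent_nonsmooth[OF D_in_tangent_space[OF section_pushforward[OF X] Yp]]
        target.tangent_nonsmooth[OF D_in_tangent_space[OF section_pushforward[OF Y] Xp]]
      by (simp add: pushforward_def tvec_apply)
  next
    case f: True
    obtain V d where d: "(V, d) \<in> A" "\<iota> p \<in> V" by (rule target.chart_exists)
    define e where "e = target.coordinate_vector V d"
    define c where "c Z b q = pushforward A \<iota> q (Z q) (\<lambda>r. d r \<bullet> b)" for Z b q
    \<comment> \<open>\<open>N a b\<close> is the frame derivative of \<open>e b\<close> along
      \<open>e a\<close>, applied to f, and \<open>M a b\<close> is the iterated derivative of f.
      Thus \<open>M a b - N a b\<close> is the covariant Hessian of f in the frame, and its symmetry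
      \<open>NM\<close> is the torsion-freeness of \<open>nabla\<close>.\<close>
    define N where "N a b = nabla (\<iota> p) (e a (\<iota> p)) (e b) f" for a b
    define M where "M a b = e a (\<iota> p) (\<lambda>r. e b r f)" for a b
    have e: "vector_field_near A (\<iota> p) (e b)" for b
      unfolding e_def by (rule target.coordinate_vector_field[OF d])
    note eT = section_near_in_tangent_space[OF e]
    have push: "pushforward A \<iota> p v = (\<Sum>a\<in>Basis. pushforward A \<iota> p v (\<lambda>r. d r \<bullet> a) *\<^sub>T e a (\<iota> p))"
      if "v \<in> tangent_space B p" for v
      unfolding e_def by (rule target.tangent_expand[OF d pushforward_in_tangent_space[OF that]])
    have c: "smooth_near B (c Z b) p" if "vector_field_near B p Z" for Z b
      unfolding c_def
      by (rule section_near_smooth[OF section_pushforward[OF that] target.smooth_near_coordinate[OF d]])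
    have expand: "\<forall>\<^sub>F q in nhds p. pushforward A \<iota> q (Z q) = (\<Sum>b\<in>Basis. c Z b q *\<^sub>T e b (\<iota> q))"
      if "vector_field_near B p Z" for Z
      unfolding c_def e_def by (rule section_expand[OF d section_pushforward[OF that]])
    have ND: "D p v (\<lambda>q. pushforward A \<iota> q (Z q)) f =
        (\<Sum>b\<in>Basis. v (c Z b) * e b (\<iota> p) f + c Z b p *
          (\<Sum>a\<in>Basis. pushforward A \<iota> p v (\<lambda>r. d r \<bullet> a) * N a b))"
      if v: "v \<in> tangent_space B p" and Z: "vector_field_near B p Z" for v Z
    proof -
      have nab: "nabla (\<iota> p) (pushforward A \<iota> p v) (e b) =
          (\<Sum>a\<in>Basis. pushforward A \<iota> p v (\<lambda>r. d r \<bullet> a) *\<^sub>T nabla (\<iota> p) (e a (\<iota> p)) (e b))" for b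
        using arg_cong[OF push[OF v], of "\<lambda>w. nabla (\<iota> p) w (e b)"]
        unfolding nabla.D_direction_sum[OF e eT] .
      have "D p v (\<lambda>q. pushforward A \<iota> q (Z q)) = D p v (\<lambda>q. \<Sum>b\<in>Basis. c Z b q *\<^sub>T e b (\<iota> q))"
        by (rule D_cong[OF v section_pushforward[OF Z] expand[OF Z]])
      also have "\<dots> = (\<Sum>b\<in>Basis. D p v (\<lambda>q. c Z b q *\<^sub>T e b (\<iota> q)))"
        by (intro D_sum[OF v] section_scale c Z section_pullback e) simp
      also have "\<dots> = (\<Sum>b\<in>Basis. v (c Z b) *\<^sub>T e b (\<iota> p) + c Z b p *\<^sub>T
          nabla (\<iota> p) (pushforward A \<iota> p v) (e b))"
        by (simp add: D_scale[OF v c[OF Z] section_pullback[OF e]] D_pullback[OF v e])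
      finally show ?thesis by (simp add: tvec_sum_apply tvec_apply N_def nab)
    qed
    have MD: "v (\<lambda>q. Z q (\<lambda>s. f (\<iota> s))) =
        (\<Sum>b\<in>Basis. v (c Z b) * e b (\<iota> p) f + c Z b p *
          (\<Sum>a\<in>Basis. pushforward A \<iota> p v (\<lambda>r. d r \<bullet> a) * M a b))"
      if v: "v \<in> tangent_space B p" and Z: "vector_field_near B p Z" for v Z
    proof -
      have ef: "smooth_near A (\<lambda>r. e b r f) (\<iota> p)" for b by (rule section_near_smooth[OF e f])
      have ve: "v (\<lambda>q. e b (\<iota> q) f) =
          (\<Sum>a\<in>Basis. pushforward A \<iota> p v (\<lambda>r. d r \<bullet> a) * M a b)" for b
      proof -
        have "v (\<lambda>q. e b (\<iota> q) f) = pushforward A \<iota> p v (\<lambda>r. e b r f)"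
          using ef by (simp add: pushforward_def)
        also have "\<dots> = (\<Sum>a\<in>Basis. pushforward A \<iota> p v (\<lambda>r. d r \<bullet> a) *\<^sub>T e a (\<iota> p)) (\<lambda>r. e b r f)"
          using push[OF v] by simp
        finally show ?thesis by (simp add: tvec_sum_apply tvec_apply M_def)
      qed
      have "\<forall>\<^sub>F q in nhds p. Z q (\<lambda>s. f (\<iota> s)) = (\<Sum>b\<in>Basis. c Z b q * e b (\<iota> q) f)"
        using eventually_pullback[OF target.smooth_near_eventually[OF f]] expand[OF Z]
      proof eventually_elim
        case (elim q)
        have "Z q (\<lambda>s. f (\<iota> s)) = pushforward A \<iota> q (Z q) f"
          using elim(1) by (simp add: pushforward_def)
        then show ?case unfolding elim(2) by (simp add: tvec_sum_apply tvec_apply)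
      qed
      then have "v (\<lambda>q. Z q (\<lambda>s. f (\<iota> s))) = v (\<lambda>q. \<Sum>b\<in>Basis. c Z b q * e b (\<iota> q) f)"
        by (rule source.tangent_cong[OF v])
      also have "\<dots> = (\<Sum>b\<in>Basis. v (\<lambda>q. c Z b q * e b (\<iota> q) f))"
        by (intro source.tangent_sum_fun[OF v] source.smooth_near_mult c Z smooth_near_pullback ef) simp
      also have "\<dots> = (\<Sum>b\<in>Basis. v (c Z b) * e b (\<iota> p) f + c Z b p * v (\<lambda>q. e b (\<iota> q) f))"
        by (simp add: source.tangent_mult_fun[OF v c[OF Z] smooth_near_pullback[OF ef]])
      finally show ?thesis unfolding ve .
    qed
    have NM: "N a b - M a b = N b a - M b a" for a b
    proof -
      have "nabla (\<iota> p) (e a (\<iota> p)) (e b) - nabla (\<iota> p) (e b (\<iota> p)) (e a)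
          = lie_bracket A (e a) (e b) (\<iota> p)"
        using levi_civita e unfolding levi_civita_def by blast
      then have "(nabla (\<iota> p) (e a (\<iota> p)) (e b) - nabla (\<iota> p) (e b (\<iota> p)) (e a)) f
          = lie_bracket A (e a) (e b) (\<iota> p) f" by simp
      then show ?thesis using f by (simp add: N_def M_def lie_bracket_def tvec_apply)
    qed
    \<comment> \<open>The derivatives of the coefficients \<open>c Z b\<close> occur identically in
      \<open>ND\<close> and \<open>MD\<close> and cancel. What is left is minus the Hessian of f on
      the two pushed-forward vectors.\<close>
    have diff: "D p v (\<lambda>q. pushforward A \<iota> q (Z q)) f - v (\<lambda>q. Z q (\<lambda>s. f (\<iota> s))) =
        (\<Sum>b\<in>Basis. \<Sum>a\<in>Basis. c Z b p * pushforward A \<iota> p v (\<lambda>r. d r \<bullet> a) * (N a b - M a b))"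
      if v: "v \<in> tangent_space B p" and Z: "vector_field_near B p Z" for v Z
      unfolding ND[OF that] MD[OF that]
      by (simp add: sum_subtractf[symmetric] sum_distrib_left algebra_simps)
    have "D p (X p) (\<lambda>q. pushforward A \<iota> q (Y q)) f - X p (\<lambda>q. Y q (\<lambda>s. f (\<iota> s))) =
        (\<Sum>b\<in>Basis. \<Sum>a\<in>Basis. c Y b p * c X a p * (N a b - M a b))"
      unfolding diff[OF Xp Y] c_def ..
    also have "\<dots> = (\<Sum>a\<in>Basis. \<Sum>b\<in>Basis. c X a p * c Y b p * (N b a - M b a))"
      by (subst sum.swap, intro sum.cong refl) (metis NM mult.commute)
    also have "\<dots> = D p (Y p) (\<lambda>q. pushforward A \<iota> q (X q)) f - Y p (\<lambda>q. X q (\<lambda>s. f (\<iota> s)))"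
      unfolding diff[OF Yp X] c_def ..
    finally have eq: "D p (X p) (\<lambda>q. pushforward A \<iota> q (Y q)) f - X p (\<lambda>q. Y q (\<lambda>s. f (\<iota> s)))
      = D p (Y p) (\<lambda>q. pushforward A \<iota> q (X q)) f - Y p (\<lambda>q. X q (\<lambda>s. f (\<iota> s)))" .
    have "pushforward A \<iota> p (lie_bracket B X Y p) f
        = X p (\<lambda>q. Y q (\<lambda>s. f (\<iota> s))) - Y p (\<lambda>q. X q (\<lambda>s. f (\<iota> s)))"
      using f smooth_near_pullback[OF f] by (simp add: pushforward_def lie_bracket_def)
    with eq show ?thesis unfolding tvec_apply by linarith
  qed
qed

end

section \<open>Vector fields tangent to an immersed submanifold\<close>

lemma positive_definite_diagonal:
  fixes G :: "'i \<Rightarrow> 'i \<Rightarrow> real"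
  assumes S: "finite S" "k \<notin> S"
    and pos: "\<And>c. \<exists>i\<in>insert k S. c i \<noteq> 0 \<Longrightarrow>
      (\<Sum>i\<in>insert k S. \<Sum>j\<in>insert k S. c i * c j * G i j) > 0"
  shows "G k k > 0"
proof -
  \<comment> \<open>The quadratic form is tested on the k-th unit vector.\<close>
  let ?c = "\<lambda>i. of_bool (i = k) :: real"
  have z: "?c i = 0" if "i \<in> S" for i using that S by auto
  have "(\<Sum>i\<in>insert k S. \<Sum>j\<in>insert k S. ?c i * ?c j * G i j) > 0"
    by (rule pos) simp
  moreover have "(\<Sum>j\<in>insert k S. ?c i * ?c j * G i j) = ?c i * G i k" for i
  proof -
    have "(\<Sum>j\<in>S. ?c i * ?c j * G i j) = 0" by (rule sum.neutral) (use z in simp)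
    then show ?thesis using S by simp
  qed
  moreover have "(\<Sum>i\<in>insert k S. ?c i * G i k) = G k k"
  proof -
    have "(\<Sum>i\<in>S. ?c i * G i k) = 0" by (rule sum.neutral) (use z in simp)
    then show ?thesis using S by simp
  qed
  ultimately show ?thesis by simp
qed

text \<open>Completing the square: minimising the quadratic form over its k-th variable leaves the
  form of the Schur complement in the other variables.\<close>

lemma schur_complement_pos:
  fixes G :: "'i \<Rightarrow> 'i \<Rightarrow> real"
  assumes S: "finite S" "k \<notin> S"
    and sym: "\<And>i j. i \<in> insert k S \<Longrightarrow> j \<in> insert k S \<Longrightarrow> G i j = G j i"
    and pos: "\<And>c. \<exists>i\<in>insert k S. c i \<noteq> 0 \<Longrightarrow>
      (\<Sum>i\<in>insert k S. \<Sum>j\<in>insert k S. c i * c j * G i j) > 0"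
    and c: "\<exists>i\<in>S. c i \<noteq> 0"
  shows "(\<Sum>i\<in>S. \<Sum>j\<in>S. c i * c j * (G i j - G i k * inverse (G k k) * G k j)) > 0"
proof -
  have Gkk: "G k k > 0" by (rule positive_definite_diagonal[OF S pos])
  define s where "s = (\<Sum>j\<in>S. c j * G k j)"
  \<comment> \<open>The k-th entry is the minimiser: it is where the derivative of the quadratic
    polynomial in that variable vanishes.\<close>
  define d where "d = c(k := - s / G k k)"
  have d: "d i = c i" if "i \<in> S" for i using that S by (auto simp: d_def)
  have dk: "d k = - s / G k k" by (simp add: d_def)
  have s': "(\<Sum>i\<in>S. c i * G i k) = s"
    unfolding s_def by (intro sum.cong refl) (simp add: sym)
  have "0 < (\<Sum>i\<in>insert k S. \<Sum>j\<in>insert k S. d i * d j * G i j)"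
    by (rule pos) (use c d in auto)
  also have "\<dots> = d k * d k * G k k + (\<Sum>j\<in>S. d k * d j * G k j) + ((\<Sum>i\<in>S. d i * d k * G i k)
      + (\<Sum>i\<in>S. \<Sum>j\<in>S. d i * d j * G i j))"
    using S by (simp add: sum.distrib)
  also have "(\<Sum>j\<in>S. d k * d j * G k j) = d k * s"
    unfolding s_def sum_distrib_left by (intro sum.cong refl) (simp add: d)
  also have "(\<Sum>i\<in>S. d i * d k * G i k) = d k * s"
    unfolding s'[symmetric] sum_distrib_left by (intro sum.cong refl) (simp add: d)
  also have "(\<Sum>i\<in>S. \<Sum>j\<in>S. d i * d j * G i j) = (\<Sum>i\<in>S. \<Sum>j\<in>S. c i * c j * G i j)"
    by (intro sum.cong refl) (simp add: d)
  also have "d k * d k * G k k + d k * s + (d k * s + (\<Sum>i\<in>S. \<Sum>j\<in>S. c i * c j * G i j))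
      = (\<Sum>i\<in>S. \<Sum>j\<in>S. c i * c j * G i j) - s * s * inverse (G k k)"
    unfolding dk using Gkk by (simp add: field_simps)
  also have "s * s * inverse (G k k) = (\<Sum>i\<in>S. c i * G i k) * (\<Sum>j\<in>S. c j * G k j) * inverse (G k k)"
    unfolding s' s_def ..
  also have "\<dots> = (\<Sum>i\<in>S. \<Sum>j\<in>S. c i * c j * (G i k * inverse (G k k) * G k j))"
    by (subst sum_product) (simp add: sum_distrib_left sum_distrib_right mult_ac)
  finally show "(\<Sum>i\<in>S. \<Sum>j\<in>S. c i * c j * (G i j - G i k * inverse (G k k) * G k j)) > 0"
    by (simp add: right_diff_distrib sum_subtractf)
qed

context manifold
begin

text \<open>Gaussian elimination with smooth coefficients. Positive definiteness keeps every pivot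
  \<open>G k k\<close> positive near p, so one can divide by it without pivot search or
  determinants, and it passes to the Schur complement. The solution \<open>a\<close> is given
  beforehand; only its smoothness is at stake.\<close>

lemma smooth_near_linear_system:
  fixes G :: "'i \<Rightarrow> 'i \<Rightarrow> 'm \<Rightarrow> real"
  assumes "finite S"
    and "\<And>i j. i \<in> S \<Longrightarrow> j \<in> S \<Longrightarrow> smooth_near A (G i j) p"
    and "\<And>i. i \<in> S \<Longrightarrow> smooth_near A (b i) p"
    and "\<forall>\<^sub>F q in nhds p. \<forall>i\<in>S. \<forall>j\<in>S. G i j q = G j i q"
    and "\<forall>\<^sub>F q in nhds p. \<forall>c. (\<exists>i\<in>S. c i \<noteq> 0) \<longrightarrow> (\<Sum>i\<in>S. \<Sum>j\<in>S. c i * c j * G i j q) > 0"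
    and "\<forall>\<^sub>F q in nhds p. \<forall>i\<in>S. (\<Sum>j\<in>S. G i j q * a j q) = b i q"
    and "j \<in> S"
  shows "smooth_near A (a j) p"
  using assms
proof (induction S arbitrary: G b j rule: finite_induct)
  case (insert k S)
  note G = insert.prems(1) and b = insert.prems(2)
  \<comment> \<open>Subtracting a multiple of the k-th equation eliminates the k-th unknown.
    \<open>G'\<close> and \<open>b'\<close> are the matrix and right-hand side that remain.\<close>
  define G' where "G' i j q = G i j q - G i k q * inverse (G k k q) * G k j q" for i j q
  define b' where "b' i q = b i q - G i k q * inverse (G k k q) * b k q" for i q
  have pos: "\<forall>\<^sub>F q in nhds p. G k k q > 0"
    using insert.prems(4)
  proof eventually_elim
    case (elim q)
    show "G k k q > 0"
      by (rule positive_definite_diagonal[OF insert.hyps, of "\<lambda>i j. G i j q"]) (use elim in blast)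
  qed
  have inv: "smooth_near A (\<lambda>q. inverse (G k k q)) p"
    by (rule smooth_near_inverse[OF G]) (use pos in \<open>auto elim!: eventually_mono\<close>)
  have aS: "smooth_near A (a i) p" if "i \<in> S" for i
  proof (rule insert.IH[of G' b'])
    show "smooth_near A (G' i j) p" if "i \<in> S" "j \<in> S" for i j
      unfolding G'_def using that by (intro smooth_near_diff smooth_near_mult inv G) auto
    show "smooth_near A (b' i) p" if "i \<in> S" for i
      unfolding b'_def using that by (intro smooth_near_diff smooth_near_mult inv G b) auto
    show "\<forall>\<^sub>F q in nhds p. \<forall>i\<in>S. \<forall>j\<in>S. G' i j q = G' j i q"
      using insert.prems(3)
    proof eventually_elim
      case (elim q)
      have sym: "G i j q = G j i q" if "i \<in> insert k S" "j \<in> insert k S" for i j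
        using elim that by blast
      show ?case
      proof (intro ballI)
        fix i j assume "i \<in> S" "j \<in> S"
        then show "G' i j q = G' j i q"
          using sym[of i j] sym[of i k] sym[of j k] by (simp add: G'_def)
      qed
    qed
    show "\<forall>\<^sub>F q in nhds p. \<forall>c. (\<exists>i\<in>S. c i \<noteq> 0) \<longrightarrow> (\<Sum>i\<in>S. \<Sum>j\<in>S. c i * c j * G' i j q) > 0"
      using insert.prems(3,4)
    proof eventually_elim
      case (elim q)
      show ?case
        unfolding G'_def
        by (intro allI impI schur_complement_pos[OF insert.hyps, of "\<lambda>i j. G i j q"])
           (use elim in blast)+
    qed
    show "\<forall>\<^sub>F q in nhds p. \<forall>i\<in>S. (\<Sum>j\<in>S. G' i j q * a j q) = b' i q"
      using insert.prems(5) pos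
    proof eventually_elim
      case (elim q)
      have eq: "G i k q * a k q + (\<Sum>j\<in>S. G i j q * a j q) = b i q" if "i \<in> insert k S" for i
        using bspec[OF elim(1) that] insert.hyps by simp
      show ?case
      proof
        fix i assume i: "i \<in> S"
        have s1: "(\<Sum>j\<in>S. G i j q * a j q) = b i q - G i k q * a k q"
          using eq[of i] i by simp
        have s2: "(\<Sum>j\<in>S. G k j q * a j q) = b k q - G k k q * a k q"
          using eq[of k] by simp
        have "(\<Sum>j\<in>S. G' i j q * a j q)
          = (\<Sum>j\<in>S. G i j q * a j q) - G i k q * inverse (G k k q) * (\<Sum>j\<in>S. G k j q * a j q)"
          by (simp add: G'_def sum_distrib_left left_diff_distrib right_diff_distrib
              sum_subtractf mult_ac)
        also have "\<dots> = b i q - G i k q * a k q - G i k q * inverse (G k k q) * (b k q - G k k q * a k q)"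
          unfolding s1 s2 ..
        also have "\<dots> = b' i q"
          using elim(2) by (simp add: b'_def field_simps)
        finally show "(\<Sum>j\<in>S. G' i j q * a j q) = b' i q" .
      qed
    qed
  qed (rule that)
  show ?case
  proof (cases "j = k")
    case True
    \<comment> \<open>Back substitution: the k-th equation expresses the eliminated unknown through
      those already known to be smooth.\<close>
    have "smooth_near A (\<lambda>q. inverse (G k k q) * (b k q - (\<Sum>i\<in>S. G k i q * a i q))) p"
      by (intro smooth_near_mult smooth_near_diff smooth_near_sum insert.hyps inv G b aS) auto
    moreover have "\<forall>\<^sub>F q in nhds p. inverse (G k k q) * (b k q - (\<Sum>i\<in>S. G k i q * a i q)) = a j q"
      using insert.prems(5) pos
    proof eventually_elim
      case (elim q)
      have "G k k q * a k q + (\<Sum>j\<in>S. G k j q * a j q) = b k q"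
        using elim(1) insert.hyps by simp
      then show ?case using elim(2) True by (simp add: field_simps)
    qed
    ultimately show ?thesis by (rule smooth_near_cong[rotated])
  qed (use aS insert.prems(6) in blast)
qed simp

end

lemma (in manifold) bilinear_form_sum:
  assumes b: "bilinear_form A b" and v: "\<And>i. i \<in> I \<Longrightarrow> v i \<in> tangent_space A p"
    and w: "w \<in> tangent_space A p"
  shows "b p (\<Sum>i\<in>I. a i *\<^sub>T v i) w = (\<Sum>i\<in>I. a i * b p (v i) w)"
    "b p w (\<Sum>i\<in>I. a i *\<^sub>T v i) = (\<Sum>i\<in>I. a i * b p w (v i))"
proof -
  have "b p (\<Sum>i\<in>I. a i *\<^sub>T v i) w = (\<Sum>i\<in>I. a i * b p (v i) w) \<and>
    b p w (\<Sum>i\<in>I. a i *\<^sub>T v i) = (\<Sum>i\<in>I. a i * b p w (v i))"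
    using v
  proof (induction I rule: infinite_finite_induct)
    case (insert i I)
    have "(\<Sum>i\<in>I. a i *\<^sub>T v i) \<in> tangent_space A p" "a i *\<^sub>T v i \<in> tangent_space A p"
      using insert.prems by (auto intro!: tangent_space_sum tangent_space_scale)
    then show ?case using insert w by (simp add: bilinear_formD[OF b])
  qed (use bilinear_formD(3,4)[OF b w w w, of 0] in simp_all)
  then show "b p (\<Sum>i\<in>I. a i *\<^sub>T v i) w = (\<Sum>i\<in>I. a i * b p (v i) w)"
    "b p w (\<Sum>i\<in>I. a i *\<^sub>T v i) = (\<Sum>i\<in>I. a i * b p w (v i))" by auto
qed

context manifold_map
begin

lemma subspace_pushforward_image: "tvec.subspace (pushforward A \<iota> p ` tangent_space B p)"
proof (rule tvec.subspaceI)
  show "0 \<in> pushforward A \<iota> p ` tangent_space B p"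
    using source.tangent_space_zero pushforward_zero by (metis imageI)
qed (auto simp: pushforward_add[symmetric] pushforward_scale[symmetric]
    intro!: imageI source.tangent_space_add source.tangent_space_scale)

text \<open>The components of the lifted field in a coordinate frame solve a linear system whose matrix
  is the Gram matrix of the pushed-forward frame.\<close>

lemma section_lift:
  assumes g: "riemannian_metric A g" and inj: "\<And>q. inj_on (pushforward A \<iota> q) (tangent_space B q)"
    and V: "section_near B A \<iota> p V"
    and tangent: "\<forall>\<^sub>F q in nhds p. V q \<in> pushforward A \<iota> q ` tangent_space B q"
  shows "vector_field_near B p (\<lambda>q. inv_into (tangent_space B q) (pushforward A \<iota> q) (V q))"
proof -
  interpret id: manifold_map B B "\<lambda>p. p" by unfold_locales (simp add: smooth_map_def)
  obtain U c where c: "(U, c) \<in> B" "p \<in> U" by (rule source.chart_exists)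
  have b: "bilinear_form A g" using g unfolding riemannian_metric_def by blast
  define e where "e = source.coordinate_vector U c"
  define E where "E i q = pushforward A \<iota> q (e i q)" for i q
  define W where "W q = inv_into (tangent_space B q) (pushforward A \<iota> q) (V q)" for q
  define a where "a j q = W q (\<lambda>r. c r \<bullet> j)" for j q
  have e: "vector_field_near B p (e i)" for i
    unfolding e_def by (rule source.coordinate_vector_field[OF c])
  have E: "section_near B A \<iota> p (E i)" for i unfolding E_def by (rule section_pushforward[OF e])
  have U: "\<forall>\<^sub>F q in nhds p. q \<in> U"
    using c source.chart_open by (intro eventually_nhds_in_open) auto
  have eT: "e i q \<in> tangent_space B q" if "q \<in> U" for i q
    unfolding e_def by (rule source.coordinate_vector_in_tangent_space[OF c(1) that])
  have ET: "E i q \<in> tangent_space A (\<iota> q)" if "q \<in> U" for i q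
    unfolding E_def by (rule pushforward_in_tangent_space[OF eT[OF that]])
  have W: "\<forall>\<^sub>F q in nhds p. W q = (\<Sum>j\<in>Basis. a j q *\<^sub>T e j q) \<and> V q = (\<Sum>j\<in>Basis. a j q *\<^sub>T E j q)"
    using U tangent
  proof eventually_elim
    case (elim q)
    have WT: "W q \<in> tangent_space B q" unfolding W_def by (rule inv_into_into[OF elim(2)])
    have 1: "W q = (\<Sum>j\<in>Basis. a j q *\<^sub>T e j q)"
      unfolding a_def e_def by (rule source.tangent_expand[OF c(1) elim(1) WT])
    have "V q = pushforward A \<iota> q (W q)" unfolding W_def by (rule f_inv_into_f[OF elim(2), symmetric])
    also have "\<dots> = pushforward A \<iota> q (\<Sum>j\<in>Basis. a j q *\<^sub>T e j q)" by (rule arg_cong[OF 1])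
    also have "\<dots> = (\<Sum>j\<in>Basis. a j q *\<^sub>T E j q)"
      by (simp only: pushforward_sum pushforward_scale E_def)
    finally show ?case using 1 by blast
  qed
  have a: "smooth_near B (a j) p" if "j \<in> Basis" for j
  proof (rule source.smooth_near_linear_system[where S = Basis
        and G = "\<lambda>i j q. g (\<iota> q) (E i q) (E j q)" and b = "\<lambda>i q. g (\<iota> q) (E i q) (V q)"])
    show "smooth_near B (\<lambda>q. g (\<iota> q) (E i q) (E j q)) p" for i j
      by (rule bilinear_form_section[OF b E E])
    show "smooth_near B (\<lambda>q. g (\<iota> q) (E i q) (V q)) p" for i
      by (rule bilinear_form_section[OF b E V])
    show "\<forall>\<^sub>F q in nhds p. \<forall>i\<in>Basis. \<forall>j\<in>Basis. g (\<iota> q) (E i q) (E j q) = g (\<iota> q) (E j q) (E i q)"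
      using U by eventually_elim (intro ballI riemannian_metricD(1)[OF g] ET)
    show "\<forall>\<^sub>F q in nhds p. \<forall>i\<in>Basis. (\<Sum>j\<in>Basis. g (\<iota> q) (E i q) (E j q) * a j q) = g (\<iota> q) (E i q) (V q)"
      using U W
    proof eventually_elim
      case (elim q)
      have "g (\<iota> q) (E i q) (V q) = (\<Sum>j\<in>Basis. a j q * g (\<iota> q) (E i q) (E j q))" for i
        unfolding elim(2)[THEN conjunct2] by (rule target.bilinear_form_sum[OF b ET ET]) (rule elim)+
      then show ?case by (simp add: mult.commute)
    qed
    \<comment> \<open>A nontrivial combination \<open>?u\<close> of coordinate vectors is nonzero
      because the coordinate functions detect its coefficients. Injectivity of the pushforward
      preserves this, and the metric makes its square norm positive.\<close>
    show "\<forall>\<^sub>F q in nhds p. \<forall>d. (\<exists>i\<in>Basis. d i \<noteq> 0) \<longrightarrow>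
        0 < (\<Sum>i\<in>Basis. \<Sum>j\<in>Basis. d i * d j * g (\<iota> q) (E i q) (E j q))"
      using U
    proof (eventually_elim, intro allI impI)
      fix q and d :: "'k \<Rightarrow> real" assume q: "q \<in> U" and d: "\<exists>i\<in>Basis. d i \<noteq> 0"
      let ?u = "\<Sum>i\<in>Basis. d i *\<^sub>T e i q"
      have u: "?u \<in> tangent_space B q"
        by (intro source.tangent_space_sum source.tangent_space_scale eT q)
      have "?u \<noteq> 0"
      proof
        assume "?u = 0"
        obtain j where j: "j \<in> Basis" "d j \<noteq> 0" using d by blast
        have "?u (\<lambda>r. c r \<bullet> j) = (\<Sum>i\<in>Basis. d i * (i \<bullet> j))"
          by (simp add: tvec_sum_apply tvec_apply e_def source.coordinate_vector_coordinate[OF c(1) q])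
        also have "\<dots> = d j" using j by (simp add: inner_Basis if_distrib cong: if_cong)
        finally show False using \<open>?u = 0\<close> j by (simp add: tvec_apply)
      qed
      then have "pushforward A \<iota> q ?u \<noteq> 0"
        using inj_onD[OF inj, of q ?u 0] u source.tangent_space_zero pushforward_zero by metis
      then have "0 < g (\<iota> q) (pushforward A \<iota> q ?u) (pushforward A \<iota> q ?u)"
        using riemannian_metricD(2)[OF g] pushforward_in_tangent_space[OF u] by blast
      also have "pushforward A \<iota> q ?u = (\<Sum>i\<in>Basis. d i *\<^sub>T E i q)"
        by (simp only: pushforward_sum pushforward_scale E_def)
      also have "g (\<iota> q) (\<Sum>i\<in>Basis. d i *\<^sub>T E i q) (\<Sum>i\<in>Basis. d i *\<^sub>T E i q)
          = (\<Sum>i\<in>Basis. d i * g (\<iota> q) (E i q) (\<Sum>j\<in>Basis. d j *\<^sub>T E j q))"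
        by (rule target.bilinear_form_sum(1)[OF b ET])
           (intro q target.tangent_space_sum target.tangent_space_scale ET)+
      also have "\<dots> = (\<Sum>i\<in>Basis. \<Sum>j\<in>Basis. d i * d j * g (\<iota> q) (E i q) (E j q))"
        by (simp add: target.bilinear_form_sum(2)[OF b ET[OF q] ET[OF q]] sum_distrib_left mult_ac)
      finally show "0 < (\<Sum>i\<in>Basis. \<Sum>j\<in>Basis. d i * d j * g (\<iota> q) (E i q) (E j q))" .
    qed
  qed (use that in auto)
  have "vector_field_near B p (\<lambda>q. \<Sum>j\<in>Basis. a j q *\<^sub>T e j q)"
    by (intro id.section_sum id.section_scale a e) auto
  moreover have "\<forall>\<^sub>F q in nhds p. (\<Sum>j\<in>Basis. a j q *\<^sub>T e j q) = W q"
    using W by eventually_elim simp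
  ultimately have "vector_field_near B p W" by (rule id.section_cong)
  then show ?thesis unfolding W_def .
qed

end

section \<open>The second fundamental form of an invariant submanifold\<close>

text \<open>\<open>F\<close> stands for \<open>f1 - f3\<close>, the combination through which both
  structure equations depend on these functions.\<close>

locale invariant_geometry = metric_pullback B A \<iota> D g nabla
  for B :: "('n::{t2_space,second_countable_topology}, 'k::euclidean_space) atlas"
    and A :: "('m::{t2_space,second_countable_topology}, 'e::euclidean_space) atlas"
    and \<iota> :: "'n \<Rightarrow> 'm" and D g nabla +
  fixes \<phi> :: "'m \<Rightarrow> 'm tvec \<Rightarrow> 'm tvec" and \<xi> :: "'m \<Rightarrow> 'm tvec"
    and \<eta> :: "'m \<Rightarrow> 'm tvec \<Rightarrow> real" and F :: "'m \<Rightarrow> real"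
    and nablaM :: "'n \<Rightarrow> 'n tvec \<Rightarrow> ('n \<Rightarrow> 'n tvec) \<Rightarrow> 'n tvec"
    and Dss :: "'n \<Rightarrow> 'n tvec \<Rightarrow> ('n \<Rightarrow> 'm tvec) \<Rightarrow> 'm tvec"
  assumes inj: "inj_on (pushforward A \<iota> p) (tangent_space B p)"
    and contact: "almost_contact_metric A \<phi> \<xi> \<eta> g"
    and F_smooth: "smooth_near A F x"
    and nabla_\<phi>: "v \<in> tangent_space A x \<Longrightarrow> vector_field_near A x Y \<Longrightarrow>
      nabla x v (\<lambda>q. \<phi> q (Y q)) - \<phi> x (nabla x v Y)
        = F x *\<^sub>T (g x v (Y x) *\<^sub>T \<xi> x - \<eta> x (Y x) *\<^sub>T v)"
    and nabla_\<xi>: "v \<in> tangent_space A x \<Longrightarrow> nabla x v \<xi> = (- F x) *\<^sub>T \<phi> x v"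
    and \<xi>_tangent: "\<xi> (\<iota> p) \<in> pushforward A \<iota> p ` tangent_space B p"
    and \<phi>_tangent: "w \<in> pushforward A \<iota> p ` tangent_space B p \<Longrightarrow>
      \<phi> (\<iota> p) w \<in> pushforward A \<iota> p ` tangent_space B p"
    and levi_civitaM: "levi_civita B (induced_metric A \<iota> g) nablaM"
    and connection_ss: "connection_along B A \<iota> Dss"
begin

sublocale M: map_connection B B "\<lambda>p. p" nablaM
  by unfold_locales (use levi_civitaM in \<open>auto simp: smooth_map_def levi_civita_def\<close>)

sublocale ss: map_connection B A \<iota> Dss
  by unfold_locales (rule connection_ss)

abbreviation tangential :: "'n \<Rightarrow> 'm tvec set" where
  "tangential p \<equiv> pushforward A \<iota> p ` tangent_space B p"

abbreviation normal :: "'n \<Rightarrow> 'm tvec set" where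
  "normal \<equiv> normal_space B A \<iota> g"

abbreviation push :: "('n \<Rightarrow> 'n tvec) \<Rightarrow> 'n \<Rightarrow> 'm tvec" where
  "push X \<equiv> \<lambda>q. pushforward A \<iota> q (X q)"

section \<open>Tangential and normal vectors and their behaviour under \<phi>\<close>

lemmas tangential_add = tvec.subspace_add[OF subspace_pushforward_image]
  and tangential_diff = tvec.subspace_diff[OF subspace_pushforward_image]
  and tangential_scale = tvec.subspace_scale[OF subspace_pushforward_image]
  and tangential_zero = tvec.subspace_0[OF subspace_pushforward_image]

lemma tangential_tangent: "w \<in> tangential p \<Longrightarrow> w \<in> tangent_space A (\<iota> p)"
  using pushforward_in_tangent_space by blast

lemma endo: "endomorphism_field A \<phi>"
  and oneform: "one_form A \<eta>"
  and \<eta>_\<xi>: "\<eta> x (\<xi> x) = 1"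
  using contact unfolding almost_contact_metric_def by blast+

lemma \<phi>_\<phi>: "v \<in> tangent_space A x \<Longrightarrow> \<phi> x (\<phi> x v) = - v + \<eta> x v *\<^sub>T \<xi> x"
  and g_\<xi>: "v \<in> tangent_space A x \<Longrightarrow> g x v (\<xi> x) = \<eta> x v"
  and \<eta>_\<phi>: "v \<in> tangent_space A x \<Longrightarrow> \<eta> x (\<phi> x v) = 0"
  using contact unfolding almost_contact_metric_def by blast+

lemma g_\<phi>_\<phi>: "v \<in> tangent_space A x \<Longrightarrow> w \<in> tangent_space A x \<Longrightarrow>
    g x (\<phi> x v) (\<phi> x w) = g x v w - \<eta> x v * \<eta> x w"
  using contact unfolding almost_contact_metric_def by blast

lemma \<xi>_field: "vector_field_near A x \<xi>"
proof -
  have "vector_field_on A UNIV \<xi>" using contact unfolding almost_contact_metric_def by blast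
  then show ?thesis unfolding section_near_def by (intro exI[of _ UNIV]) simp
qed

lemma g_diff:
  assumes "u \<in> tangent_space A x" "v \<in> tangent_space A x" "w \<in> tangent_space A x"
  shows "g x (u - v) w = g x u w - g x v w" "g x w (u - v) = g x w u - g x w v"
proof -
  have uv: "u - v \<in> tangent_space A x" using assms by (intro target.tangent_space_diff)
  show "g x (u - v) w = g x u w - g x v w" "g x w (u - v) = g x w u - g x w v"
    using bilinear_formD(1,2)[OF bilinear uv assms(2,3)] by simp_all
qed

lemma normal_iff:
  "w \<in> normal p \<longleftrightarrow> w \<in> tangent_space A (\<iota> p) \<and> (\<forall>t\<in>tangential p. g (\<iota> p) t w = 0)"
  unfolding normal_space_def by auto

lemma normal_tangent: "w \<in> normal p \<Longrightarrow> w \<in> tangent_space A (\<iota> p)"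
  unfolding normal_iff by blast

lemma g_zero: "w \<in> tangent_space A x \<Longrightarrow> g x w 0 = 0"
  using bilinear_formD(4)[OF bilinear _ _ , of w x w w 0] by simp

lemma subspace_normal: "tvec.subspace (normal p)"
proof (rule tvec.subspaceI)
  show "0 \<in> normal p"
    unfolding normal_iff using g_zero tangential_tangent target.tangent_space_zero by blast
  fix v w assume v: "v \<in> normal p" and w: "w \<in> normal p"
  show "v + w \<in> normal p"
    unfolding normal_iff
  proof (intro conjI ballI)
    show "v + w \<in> tangent_space A (\<iota> p)"
      by (rule target.tangent_space_add[OF normal_tangent[OF v] normal_tangent[OF w]])
    fix t assume t: "t \<in> tangential p"
    show "g (\<iota> p) t (v + w) = 0"
      using bilinear_formD(2)[OF bilinear normal_tangent[OF v] normal_tangent[OF w] tangential_tangent[OF t]]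
        v w t unfolding normal_iff by simp
  qed
next
  fix a v assume v: "v \<in> normal p"
  show "a *\<^sub>T v \<in> normal p"
    unfolding normal_iff
  proof (intro conjI ballI)
    show "a *\<^sub>T v \<in> tangent_space A (\<iota> p)"
      by (rule target.tangent_space_scale[OF normal_tangent[OF v]])
    fix t assume t: "t \<in> tangential p"
    show "g (\<iota> p) t (a *\<^sub>T v) = 0"
      using bilinear_formD(4)[OF bilinear normal_tangent[OF v] normal_tangent[OF v] tangential_tangent[OF t]]
        v t unfolding normal_iff by simp
  qed
qed

lemmas normal_diff = tvec.subspace_diff[OF subspace_normal]
  and normal_scale = tvec.subspace_scale[OF subspace_normal]
  and normal_zero = tvec.subspace_0[OF subspace_normal]

text \<open>Such a vector is orthogonal to itself.\<close>

lemma normal_tangential_zero: "w \<in> normal p \<Longrightarrow> w \<in> tangential p \<Longrightarrow> w = 0"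
  using riemannian_metricD(2)[OF metric] normal_tangent unfolding normal_iff by fastforce

lemma \<eta>_normal:
  assumes "w \<in> normal p" shows "\<eta> (\<iota> p) w = 0"
proof -
  note w = normal_tangent[OF assms] and \<xi> = section_near_in_tangent_space[OF \<xi>_field]
  have "\<eta> (\<iota> p) w = g (\<iota> p) (\<xi> (\<iota> p)) w"
    using g_\<xi>[OF w] riemannian_metricD(1)[OF metric w \<xi>] by simp
  then show ?thesis using assms \<xi>_tangent unfolding normal_iff by simp
qed

text \<open>A tangential t equals \<eta>(t) \<xi> - \<phi> \<phi> t. The first part is orthogonal to
  \<phi> w because \<eta>(\<phi> w) = 0; for the second, compatibility of g with \<phi> turns
  g(\<phi> \<phi> t, \<phi> w) into g(\<phi> t, w), and \<phi> t is tangential by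
  invariance.\<close>

lemma \<phi>_normal:
  assumes w: "w \<in> normal p" shows "\<phi> (\<iota> p) w \<in> normal p"
  unfolding normal_iff
proof (intro conjI ballI)
  note wT = normal_tangent[OF w] and \<xi>T = section_near_in_tangent_space[OF \<xi>_field]
  show \<phi>w: "\<phi> (\<iota> p) w \<in> tangent_space A (\<iota> p)" by (rule endomorphism_fieldD(1)[OF endo wT wT])
  fix t assume t: "t \<in> tangential p"
  note tT = tangential_tangent[OF t] and \<phi>tT = tangential_tangent[OF \<phi>_tangent[OF t]]
  have "g (\<iota> p) (\<phi> (\<iota> p) (\<phi> (\<iota> p) t)) (\<phi> (\<iota> p) w) = 0"
    using g_\<phi>_\<phi>[OF \<phi>tT wT] w \<phi>_tangent[OF t] \<eta>_\<phi>[OF tT] unfolding normal_iff by simp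
  moreover have "\<phi> (\<iota> p) (\<phi> (\<iota> p) t) = \<eta> (\<iota> p) t *\<^sub>T \<xi> (\<iota> p) - t"
    unfolding \<phi>_\<phi>[OF tT] by simp
  moreover have "g (\<iota> p) (\<eta> (\<iota> p) t *\<^sub>T \<xi> (\<iota> p) - t) (\<phi> (\<iota> p) w)
      = \<eta> (\<iota> p) t * g (\<iota> p) (\<xi> (\<iota> p)) (\<phi> (\<iota> p) w) - g (\<iota> p) t (\<phi> (\<iota> p) w)"
    using \<xi>T \<phi>w tT
    by (simp add: g_diff(1) target.tangent_space_scale bilinear_formD(3)[OF bilinear \<xi>T \<xi>T \<phi>w])
  moreover have "g (\<iota> p) (\<xi> (\<iota> p)) (\<phi> (\<iota> p) w) = 0"
    using riemannian_metricD(1)[OF metric \<xi>T \<phi>w] g_\<xi>[OF \<phi>w] \<eta>_\<phi>[OF wT] by simp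
  ultimately show "g (\<iota> p) t (\<phi> (\<iota> p) w) = 0" by simp
qed

section \<open>Symmetry and normality of the second fundamental form\<close>

definition h :: "('n \<Rightarrow> 'n tvec) \<Rightarrow> ('n \<Rightarrow> 'n tvec) \<Rightarrow> 'n \<Rightarrow> 'm tvec" where
  "h = second_fundamental_form A \<iota> D nablaM"

lemma h_eq: "h X Y p = D p (X p) (push Y) - pushforward A \<iota> p (nablaM p (X p) Y)"
  by (simp add: h_def second_fundamental_form_def)

context
  fixes p :: 'n and X Y :: "'n \<Rightarrow> 'n tvec"
  assumes X: "vector_field_near B p X" and Y: "vector_field_near B p Y"
begin

lemma h_tangent: "h X Y p \<in> tangent_space A (\<iota> p)"
  unfolding h_eq
  by (intro target.tangent_space_diff D_in_tangent_space section_pushforward Y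
      pushforward_in_tangent_space M.D_in_tangent_space section_near_in_tangent_space[OF X])

text \<open>Both connections are torsion-free, so the two antisymmetrised derivatives equal the same
  pushed-forward bracket and cancel.\<close>

lemma h_sym: "h X Y p = h Y X p"
proof -
  have "nablaM p (X p) Y - nablaM p (Y p) X = lie_bracket B X Y p"
    using levi_civitaM X Y unfolding levi_civita_def by blast
  then have "D p (X p) (push Y) - D p (Y p) (push X)
      = pushforward A \<iota> p (nablaM p (X p) Y) - pushforward A \<iota> p (nablaM p (Y p) X)"
    using D_torsion_free[OF X Y] by (simp add: pushforward_diff[symmetric])
  then show ?thesis unfolding h_eq by (simp add: algebra_simps)
qed

text \<open>Differentiating g(Y, Z) along X with either connection gives the same number, so the
  difference of the connections is skew with respect to the metric.\<close>

lemma h_metric_antisym: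
  assumes Z: "vector_field_near B p Z"
  shows "g (\<iota> p) (h X Y p) (push Z p) = - g (\<iota> p) (h X Z p) (push Y p)"
proof -
  note Xp = section_near_in_tangent_space[OF X]
    and PY = section_near_in_tangent_space[OF section_pushforward[OF Y]]
    and PZ = section_near_in_tangent_space[OF section_pushforward[OF Z]]
  note DY = D_in_tangent_space[OF section_pushforward[OF Y] Xp]
    and DZ = D_in_tangent_space[OF section_pushforward[OF Z] Xp]
    and MY = pushforward_in_tangent_space[OF M.D_in_tangent_space[OF Y Xp]]
    and MZ = pushforward_in_tangent_space[OF M.D_in_tangent_space[OF Z Xp]]
  have "X p (\<lambda>q. induced_metric A \<iota> g q (Y q) (Z q)) =
      induced_metric A \<iota> g p (nablaM p (X p) Y) (Z p) + induced_metric A \<iota> g p (Y p) (nablaM p (X p) Z)"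
    using levi_civitaM Xp Y Z unfolding levi_civita_def by blast
  then have "g (\<iota> p) (D p (X p) (push Y)) (push Z p) + g (\<iota> p) (push Y p) (D p (X p) (push Z))
      = g (\<iota> p) (pushforward A \<iota> p (nablaM p (X p) Y)) (push Z p)
      + g (\<iota> p) (push Y p) (pushforward A \<iota> p (nablaM p (X p) Z))"
    using D_metric[OF Xp section_pushforward[OF Y] section_pushforward[OF Z]]
    unfolding induced_metric_def by simp
  moreover have "g (\<iota> p) (push Y p) (D p (X p) (push Z)) = g (\<iota> p) (D p (X p) (push Z)) (push Y p)"
    "g (\<iota> p) (push Y p) (pushforward A \<iota> p (nablaM p (X p) Z))
      = g (\<iota> p) (pushforward A \<iota> p (nablaM p (X p) Z)) (push Y p)"
    by (rule riemannian_metricD(1)[OF metric PY DZ], rule riemannian_metricD(1)[OF metric PY MZ])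
  ultimately show ?thesis
    unfolding h_eq g_diff(1)[OF DY MY PZ] g_diff(1)[OF DZ MZ PY] by simp
qed

end

text \<open>The trilinear form \<open>g (h(X, Y), Z)\<close> is symmetric in the first two and antisymmetric in the last
  two arguments, hence zero.\<close>

lemma h_normal:
  assumes X: "vector_field_near B p X" and Y: "vector_field_near B p Y"
  shows "h X Y p \<in> normal p"
  unfolding normal_iff
proof (intro conjI ballI)
  show hT: "h X Y p \<in> tangent_space A (\<iota> p)" by (rule h_tangent[OF X Y])
  fix t assume "t \<in> tangential p"
  then obtain v where v: "v \<in> tangent_space B p" and t: "t = pushforward A \<iota> p v" by blast
  obtain Z where Z: "vector_field_near B p Z" and Zp: "Z p = v"
    by (rule source.tangent_extend[OF v])
  let ?S = "\<lambda>X Y Z. g (\<iota> p) (h X Y p) (push Z p)"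
  have "?S X Y Z = ?S Y X Z" using h_sym[OF X Y] by simp
  also have "\<dots> = - ?S Y Z X" by (rule h_metric_antisym[OF Y X Z])
  also have "\<dots> = - ?S Z Y X" using h_sym[OF Y Z] by simp
  also have "\<dots> = ?S Z X Y" using h_metric_antisym[OF Z Y X] by simp
  also have "\<dots> = ?S X Z Y" using h_sym[OF Z X] by simp
  also have "\<dots> = - ?S X Y Z" by (rule h_metric_antisym[OF X Z Y])
  finally have "?S X Y Z = 0" by simp
  then show "g (\<iota> p) t (h X Y p) = 0"
    unfolding t Zp using riemannian_metricD(1)[OF metric hT pushforward_in_tangent_space[OF v]] by simp
qed

text \<open>The Gauss formula as a characterisation: to find h it suffices to split the ambient
  derivative into a normal and a tangential part, without computing the induced connection.\<close>

lemma h_eqI: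
  assumes X: "vector_field_near B p X" and Y: "vector_field_near B p Y" and w: "w \<in> normal p"
    and tangential: "D p (X p) (push Y) - w \<in> tangential p"
  shows "h X Y p = w"
proof -
  have "pushforward A \<iota> p (nablaM p (X p) Y) \<in> tangential p"
    by (intro imageI M.D_in_tangent_space[OF Y] section_near_in_tangent_space[OF X])
  from tangential_diff[OF tangential this] have "h X Y p - w \<in> tangential p"
    unfolding h_eq by (simp add: algebra_simps)
  moreover have "h X Y p - w \<in> normal p" by (rule normal_diff[OF h_normal[OF X Y] w])
  ultimately have "h X Y p - w = 0" by (intro normal_tangential_zero)
  then show ?thesis by simp
qed

section \<open>The field \<xi> on the submanifold and the derivative of \<phi> along it\<close>

definition \<xi>M :: "'n \<Rightarrow> 'n tvec" where
  "\<xi>M = induced_field B A \<iota> \<xi>"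

lemma push_\<xi>M: "pushforward A \<iota> p (\<xi>M p) = \<xi> (\<iota> p)"
  unfolding \<xi>M_def induced_field_def by (rule f_inv_into_f[OF \<xi>_tangent])

text \<open>\<open>inv_into\<close> selects preimages point by point; that they fit together
  smoothly is the content of \<open>section_lift\<close>.\<close>

lemma \<xi>M_field: "vector_field_near B p \<xi>M"
proof -
  have "vector_field_near B p (\<lambda>q. inv_into (tangent_space B q) (pushforward A \<iota> q) (\<xi> (\<iota> q)))"
    by (rule section_lift[OF metric inj section_pullback[OF \<xi>_field]]) (simp add: \<xi>_tangent)
  then show ?thesis unfolding \<xi>M_def induced_field_def .
qed

lemma D_\<xi>: "v \<in> tangent_space B p \<Longrightarrow>
    D p v (\<lambda>q. \<xi> (\<iota> q)) = (- F (\<iota> p)) *\<^sub>T \<phi> (\<iota> p) (pushforward A \<iota> p v)"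
  using D_pullback[OF _ \<xi>_field] nabla_\<xi>[OF pushforward_in_tangent_space] by simp

text \<open>By the second structure equation the ambient derivative of \<xi> is a multiple of \<phi>
  of a tangential vector, which invariance makes tangential, so its normal part is 0.\<close>

lemma h_\<xi>:
  assumes X: "vector_field_near B p X" shows "h X \<xi>M p = 0"
proof (rule h_eqI[OF X \<xi>M_field normal_zero])
  note Xp = section_near_in_tangent_space[OF X]
  show "D p (X p) (push \<xi>M) - 0 \<in> tangential p"
    unfolding push_\<xi>M D_\<xi>[OF Xp] diff_zero by (intro tangential_scale \<phi>_tangent imageI Xp)
qed

lemma h_\<xi>_left: "vector_field_near B p X \<Longrightarrow> h \<xi>M X p = 0"
  using h_sym[OF \<xi>M_field] h_\<xi> by simp

lemma push_nablaM_\<xi>: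
  assumes X: "vector_field_near B p X"
  shows "pushforward A \<iota> p (nablaM p (X p) \<xi>M) = (- F (\<iota> p)) *\<^sub>T \<phi> (\<iota> p) (push X p)"
  using h_\<xi>[OF X] D_\<xi>[OF section_near_in_tangent_space[OF X]] unfolding h_eq push_\<xi>M by simp

text \<open>The first structure equation for arbitrary sections along the immersion. Its right-hand
  side has, besides \<phi> of the derivative, only terms linear over functions in V, so both sides
  acquire the same Leibniz term.\<close>

lemma D_\<phi>:
  assumes v: "v \<in> tangent_space B p" and V: "section_near B A \<iota> p V"
  shows "D p v (\<lambda>q. \<phi> (\<iota> q) (V q)) = \<phi> (\<iota> p) (D p v V) + F (\<iota> p) *\<^sub>T
    (g (\<iota> p) (pushforward A \<iota> p v) (V p) *\<^sub>T \<xi> (\<iota> p) - \<eta> (\<iota> p) (V p) *\<^sub>T pushforward A \<iota> p v)"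
  using V
proof (induction rule: section_induct)
  case (pullback Y)
  have \<phi>Y: "vector_field_near A (\<iota> p) (\<lambda>r. \<phi> r (Y r))"
    using endo pullback unfolding endomorphism_field_def by blast
  show ?case
    using nabla_\<phi>[OF pushforward_in_tangent_space[OF v] pullback]
    unfolding D_pullback[OF v \<phi>Y] D_pullback[OF v pullback] by (simp add: algebra_simps)
next
  case (add V W)
  note \<phi>V = endomorphism_field_section[OF endo add(1)] and \<phi>W = endomorphism_field_section[OF endo add(2)]
  note VT = section_near_in_tangent_space[OF add(1)] and WT = section_near_in_tangent_space[OF add(2)]
    and vT = pushforward_in_tangent_space[OF v]
    and DVT = D_in_tangent_space[OF add(1) v] and DWT = D_in_tangent_space[OF add(2) v]
  have "\<forall>\<^sub>F q in nhds p. \<phi> (\<iota> q) (V q) + \<phi> (\<iota> q) (W q) = \<phi> (\<iota> q) (V q + W q)"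
    using eventually_section_tangent[OF add(1)] eventually_section_tangent[OF add(2)]
    by eventually_elim (simp add: endomorphism_fieldD[OF endo])
  from D_cong[OF v section_add[OF \<phi>V \<phi>W] this]
  have eq: "D p v (\<lambda>q. \<phi> (\<iota> q) (V q + W q)) = D p v (\<lambda>q. \<phi> (\<iota> q) (V q)) + D p v (\<lambda>q. \<phi> (\<iota> q) (W q))"
    unfolding D_add[OF v \<phi>V \<phi>W] by simp
  show ?case
    unfolding eq add(3,4) D_add[OF v add(1,2)] endomorphism_fieldD(2)[OF endo DVT DWT]
      bilinear_formD(2)[OF bilinear VT WT vT] one_formD(1)[OF oneform VT WT]
    by (simp add: fun_eq_iff tvec_apply algebra_simps)
next
  case (scale f V)
  note \<phi>V = endomorphism_field_section[OF endo scale(2)]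
  note VT = section_near_in_tangent_space[OF scale(2)] and vT = pushforward_in_tangent_space[OF v]
    and DVT = D_in_tangent_space[OF scale(2) v]
  have "\<forall>\<^sub>F q in nhds p. f q *\<^sub>T \<phi> (\<iota> q) (V q) = \<phi> (\<iota> q) (f q *\<^sub>T V q)"
    using eventually_section_tangent[OF scale(2)]
    by eventually_elim (simp add: endomorphism_fieldD[OF endo])
  from D_cong[OF v section_scale[OF scale(1) \<phi>V] this]
  have eq: "D p v (\<lambda>q. \<phi> (\<iota> q) (f q *\<^sub>T V q)) = v f *\<^sub>T \<phi> (\<iota> p) (V p) + f p *\<^sub>T D p v (\<lambda>q. \<phi> (\<iota> q) (V q))"
    unfolding D_scale[OF v scale(1) \<phi>V] by simp
  have \<phi>eq: "\<phi> (\<iota> p) (v f *\<^sub>T V p + f p *\<^sub>T D p v V)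
      = v f *\<^sub>T \<phi> (\<iota> p) (V p) + f p *\<^sub>T \<phi> (\<iota> p) (D p v V)"
    using VT DVT by (simp add: endomorphism_fieldD[OF endo] target.tangent_space_scale)
  show ?case
    unfolding eq scale(3) D_scale[OF v scale(1,2)] \<phi>eq bilinear_formD(4)[OF bilinear VT VT vT]
      one_formD(2)[OF oneform VT VT]
    by (simp add: fun_eq_iff tvec_apply algebra_simps)
next
  case (cong V W)
  have "\<forall>\<^sub>F q in nhds p. \<phi> (\<iota> q) (V q) = \<phi> (\<iota> q) (W q)"
    by (rule eventually_mono[OF cong(2)]) simp
  from D_cong[OF v endomorphism_field_section[OF endo cong(1)] this]
  show ?case
    using cong(3) D_cong[OF v cong(1,2)] eventually_nhds_x_imp_x[OF cong(2)] by simp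
qed

section \<open>The semi-symmetric connection\<close>

definition nablaS :: "'n \<Rightarrow> 'n tvec \<Rightarrow> ('n \<Rightarrow> 'n tvec) \<Rightarrow> 'n tvec" where
  "nablaS = semi_symmetric_connection (induced_metric A \<iota> g) (induced_one_form A \<iota> \<eta>) \<xi>M nablaM"

lemma nablaS_eq: "nablaS p v Y = nablaM p v Y + \<eta> (\<iota> p) (push Y p) *\<^sub>T v
    - g (\<iota> p) (pushforward A \<iota> p v) (push Y p) *\<^sub>T \<xi>M p"
  by (simp add: nablaS_def semi_symmetric_connection_def induced_metric_def induced_one_form_def)

lemma nablaS_field:
  assumes X: "vector_field_near B p X" and Y: "vector_field_near B p Y"
  shows "vector_field_near B p (\<lambda>q. nablaS q (X q) Y)"
  unfolding nablaS_eq
  by (intro M.section_diff M.section_add M.section_scale M.D_section X Y \<xi>M_field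
      one_form_section[OF oneform] metric_section section_pushforward)

text \<open>The leading \<open>push X p\<close> is the semi-symmetric term with \<eta>(\<xi>) = 1;
  it becomes the identity part of \<open>K\<close> below.\<close>

lemma push_nablaS_\<xi>:
  assumes X: "vector_field_near B p X"
  shows "pushforward A \<iota> p (nablaS p (X p) \<xi>M) = push X p + (- F (\<iota> p)) *\<^sub>T \<phi> (\<iota> p) (push X p)
    - \<eta> (\<iota> p) (push X p) *\<^sub>T \<xi> (\<iota> p)"
  unfolding nablaS_eq pushforward_add pushforward_diff pushforward_scale push_nablaM_\<xi>[OF X] push_\<xi>M
    \<eta>_\<xi> g_\<xi>[OF section_near_in_tangent_space[OF section_pushforward[OF X]]]
  by (simp add: algebra_simps)

text \<open>The pushforward of the differentiated \<xi> is known as a section along the immersion,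
  so \<open>D_\<phi>\<close> and \<open>D_\<xi>\<close> apply to it directly and no lift of \<phi> Y
  to the submanifold is required. The derivative of F is harmless, since it multiplies the
  tangential vector \<phi> Y.\<close>

lemma h_nablaS_\<xi>:
  assumes Z: "vector_field_near B p Z" and Y: "vector_field_near B p Y"
  shows "h Z (\<lambda>q. nablaS q (Y q) \<xi>M) p = h Z Y p - F (\<iota> p) *\<^sub>T \<phi> (\<iota> p) (h Z Y p)"
proof (rule h_eqI[OF Z nablaS_field[OF Y \<xi>M_field]])
  note Zp = section_near_in_tangent_space[OF Z]
  note hT = h_normal[OF Z Y]
  show "h Z Y p - F (\<iota> p) *\<^sub>T \<phi> (\<iota> p) (h Z Y p) \<in> normal p"
    by (intro normal_diff normal_scale \<phi>_normal hT)
  note V = section_pushforward[OF Y]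
  note \<phi>V = endomorphism_field_section[OF endo V]
  have mF: "smooth_near B (\<lambda>q. - F (\<iota> q)) p"
    by (intro source.smooth_near_uminus smooth_near_pullback F_smooth)
  note \<eta>V = one_form_section[OF oneform V]
  note \<xi>S = section_pullback[OF \<xi>_field, of p]
  have "\<forall>\<^sub>F q in nhds p. push Y q + (- F (\<iota> q)) *\<^sub>T \<phi> (\<iota> q) (push Y q)
      - \<eta> (\<iota> q) (push Y q) *\<^sub>T \<xi> (\<iota> q) = pushforward A \<iota> q (nablaS q (Y q) \<xi>M)"
    by (rule eventually_mono[OF section_near_eventually[OF Y]]) (simp only: push_nablaS_\<xi>)
  from D_cong[OF Zp section_diff[OF section_add[OF V section_scale[OF mF \<phi>V]] section_scale[OF \<eta>V \<xi>S]] this]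
  have D: "D p (Z p) (push (\<lambda>q. nablaS q (Y q) \<xi>M)) =
      D p (Z p) (push Y) + (Z p (\<lambda>q. - F (\<iota> q)) *\<^sub>T \<phi> (\<iota> p) (push Y p)
        + (- F (\<iota> p)) *\<^sub>T D p (Z p) (\<lambda>q. \<phi> (\<iota> q) (push Y q)))
      - (Z p (\<lambda>q. \<eta> (\<iota> q) (push Y q)) *\<^sub>T \<xi> (\<iota> p)
        + \<eta> (\<iota> p) (push Y p) *\<^sub>T D p (Z p) (\<lambda>q. \<xi> (\<iota> q)))"
    unfolding D_diff[OF Zp section_add[OF V section_scale[OF mF \<phi>V]] section_scale[OF \<eta>V \<xi>S]]
      D_add[OF Zp V section_scale[OF mF \<phi>V]] D_scale[OF Zp mF \<phi>V] D_scale[OF Zp \<eta>V \<xi>S] by simp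
  define T where "T = pushforward A \<iota> p (nablaM p (Z p) Y)"
  have T: "T \<in> tangential p" unfolding T_def by (intro imageI M.D_in_tangent_space[OF Y] Zp)
  have DV: "D p (Z p) (push Y) = h Z Y p + T" unfolding h_eq T_def by simp
  have \<phi>DV: "\<phi> (\<iota> p) (h Z Y p + T) = \<phi> (\<iota> p) (h Z Y p) + \<phi> (\<iota> p) T"
    by (rule endomorphism_fieldD(2)[OF endo normal_tangent[OF hT] tangential_tangent[OF T]])
  \<comment> \<open>After the expected normal vector is subtracted, every remaining summand is
    \<xi>, a pushed-forward vector or \<phi> of one, with coefficients.\<close>
  have "D p (Z p) (push (\<lambda>q. nablaS q (Y q) \<xi>M)) - (h Z Y p - F (\<iota> p) *\<^sub>T \<phi> (\<iota> p) (h Z Y p)) =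
      T + Z p (\<lambda>q. - F (\<iota> q)) *\<^sub>T \<phi> (\<iota> p) (push Y p) + (- F (\<iota> p)) *\<^sub>T (\<phi> (\<iota> p) T + F (\<iota> p) *\<^sub>T
        (g (\<iota> p) (push Z p) (push Y p) *\<^sub>T \<xi> (\<iota> p) - \<eta> (\<iota> p) (push Y p) *\<^sub>T push Z p))
      - (Z p (\<lambda>q. \<eta> (\<iota> q) (push Y q)) *\<^sub>T \<xi> (\<iota> p)
        + \<eta> (\<iota> p) (push Y p) *\<^sub>T (- F (\<iota> p)) *\<^sub>T \<phi> (\<iota> p) (push Z p))"
    unfolding D D_\<phi>[OF Zp V] D_\<xi>[OF Zp] DV \<phi>DV by (simp add: fun_eq_iff tvec_apply algebra_simps)
  also have "\<dots> \<in> tangential p"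
    by (intro tangential_add tangential_diff tangential_scale T \<phi>_tangent \<xi>_tangent imageI Zp
        section_near_in_tangent_space[OF Y])
  finally show "D p (Z p) (push (\<lambda>q. nablaS q (Y q) \<xi>M))
      - (h Z Y p - F (\<iota> p) *\<^sub>T \<phi> (\<iota> p) (h Z Y p)) \<in> tangential p" .
qed

text \<open>\<open>normal_part\<close> is a definite description. At 0 the decomposition is the
  trivial one, and it is unique because normal and tangential vectors meet only in 0.\<close>

lemma normal_part_zero: "normal_part B A \<iota> g p 0 = 0"
  unfolding normal_part_def
proof (rule the_equality)
  show "0 \<in> normal p \<and> 0 - 0 \<in> tangential p" using normal_zero tangential_zero by simp
  fix u assume u: "u \<in> normal p \<and> 0 - u \<in> tangential p"
  then have "u \<in> tangential p" using tangential_diff[OF tangential_zero, of "0 - u"] by simp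
  then show "u = 0" using u normal_tangential_zero by blast
qed

text \<open>Every section to which the normal derivative is applied below vanishes near the point,
  so this evaluates all the derivative terms that occur.\<close>

lemma normal_part_Dss_zero:
  "v \<in> tangent_space B p \<Longrightarrow> \<forall>\<^sub>F q in nhds p. V q = 0 \<Longrightarrow> normal_part B A \<iota> g p (Dss p v V) = 0"
  by (simp add: ss.D_zero normal_part_zero)

section \<open>Covariant derivatives of h with \<xi> in its arguments\<close>

abbreviation cov :: "('n \<Rightarrow> 'n tvec) \<Rightarrow> ('n \<Rightarrow> 'n tvec) \<Rightarrow> ('n \<Rightarrow> 'n tvec) \<Rightarrow> 'n \<Rightarrow> 'm tvec" where
  "cov \<equiv> cov_deriv_form B A \<iota> g Dss nablaS h"

text \<open>By \<open>h_nablaS_\<xi>\<close>, replacing an argument Y of h by the semi-symmetric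
  derivative of \<xi> along Y amounts to applying \<open>K\<close> to the value. Since \<phi> is a
  complex structure on normal vectors, \<open>K\<close> is there multiplication by 1 - iF.\<close>

definition K :: "'n \<Rightarrow> 'm tvec \<Rightarrow> 'm tvec" where
  "K p w = w - F (\<iota> p) *\<^sub>T \<phi> (\<iota> p) w"

lemma K_normal: "w \<in> normal p \<Longrightarrow> K p w \<in> normal p"
  unfolding K_def by (intro normal_diff normal_scale \<phi>_normal)

lemma K_zero: "K p 0 = 0"
  using endomorphism_fieldD(3)[OF endo target.tangent_space_zero target.tangent_space_zero,
      where a = 0 and p = "\<iota> p"]
  by (simp add: K_def)

text \<open>Applying \<phi> to w = F \<phi> w gives \<phi> w = -F w, as \<eta> vanishes on normal
  vectors. Substituting this back leaves a multiple of w by 1 + F squared.\<close>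

lemma K_eq_zero:
  assumes w: "w \<in> normal p" and K: "K p w = 0"
  shows "w = 0"
proof -
  note wT = normal_tangent[OF w] and \<phi>wT = normal_tangent[OF \<phi>_normal[OF w]]
  let ?F = "F (\<iota> p)"
  have 1: "w = ?F *\<^sub>T \<phi> (\<iota> p) w" using K unfolding K_def by simp
  then have "\<phi> (\<iota> p) w = ?F *\<^sub>T \<phi> (\<iota> p) (\<phi> (\<iota> p) w)"
    using endomorphism_fieldD(3)[OF endo \<phi>wT \<phi>wT] by metis
  also have "\<phi> (\<iota> p) (\<phi> (\<iota> p) w) = - w" by (simp add: \<phi>_\<phi>[OF wT] \<eta>_normal[OF w])
  finally have 2: "\<phi> (\<iota> p) w = ?F *\<^sub>T - w" .
  have "(1 + ?F\<^sup>2) *\<^sub>T w = 0"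
    using 1 unfolding 2 by (simp add: tvec.scale_left_distrib power2_eq_square eq_neg_iff_add_eq_0)
  moreover have "1 + ?F\<^sup>2 \<noteq> 0" using zero_le_power2[of ?F] by linarith
  ultimately show ?thesis using tvec.scale_eq_0_iff by blast
qed

text \<open>Two of the three summands contain h with an undifferentiated \<xi> and vanish, the first
  one because h(Z, \<xi>) is 0 on a whole neighbourhood. Only the summand in which \<xi> is
  differentiated survives.\<close>

lemma cov_\<xi>_right:
  assumes Y: "vector_field_near B p Y" and Z: "vector_field_near B p Z"
  shows "cov Y Z \<xi>M p = - K p (h Z Y p)"
proof -
  have "\<forall>\<^sub>F q in nhds p. h Z \<xi>M q = 0"
    by (rule eventually_mono[OF section_near_eventually[OF Z]]) (rule h_\<xi>)
  then show ?thesis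
    unfolding cov_deriv_form_def h_\<xi>[OF nablaS_field[OF Y Z]] h_nablaS_\<xi>[OF Z Y]
    by (simp add: normal_part_Dss_zero section_near_in_tangent_space[OF Y] K_def)
qed

text \<open>The version with \<xi> in the other slot: the second derivative at (\<xi>, \<xi>) has
  one middle summand of each kind.\<close>

lemma cov_\<xi>_left:
  assumes Y: "vector_field_near B p Y" and Z: "vector_field_near B p Z"
  shows "cov Y \<xi>M Z p = - K p (h Z Y p)"
proof -
  have "\<forall>\<^sub>F q in nhds p. h \<xi>M Z q = 0"
    by (rule eventually_mono[OF section_near_eventually[OF Z]]) (rule h_\<xi>_left)
  then show ?thesis
    unfolding cov_deriv_form_def h_\<xi>_left[OF nablaS_field[OF Y Z]]
      h_sym[OF nablaS_field[OF Y \<xi>M_field] Z] h_nablaS_\<xi>[OF Z Y]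
    by (simp add: normal_part_Dss_zero section_near_in_tangent_space[OF Y] K_def)
qed

lemma cov_\<xi>_\<xi>: "vector_field_near B p Y \<Longrightarrow> cov Y \<xi>M \<xi>M p = 0"
  by (simp add: cov_\<xi>_right \<xi>M_field h_\<xi>_left K_zero)

text \<open>The outer summands vanish by \<open>cov_\<xi>_\<xi>\<close>. Each middle summand
  contributes one \<open>K\<close> from the first derivative of h and another from the derivative of
  \<xi>, and the two minus signs cancel. Because h is symmetric, the exchanged directions in the
  third summand give the same vector as the second.\<close>

lemma cov2_\<xi>_\<xi>:
  assumes X: "vector_field_near B p X" and Y: "vector_field_near B p Y"
  shows "cov_deriv2_form B A \<iota> g Dss nablaS h \<xi>M \<xi>M X Y p = 2 *\<^sub>T K p (K p (h X Y p))"
proof -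
  have cov0: "\<forall>\<^sub>F q in nhds p. cov Y \<xi>M \<xi>M q = 0"
    by (rule eventually_mono[OF section_near_eventually[OF Y]]) (rule cov_\<xi>_\<xi>)
  have hY: "h Y (\<lambda>q. nablaS q (X q) \<xi>M) p = K p (h X Y p)"
    unfolding h_nablaS_\<xi>[OF Y X] h_sym[OF Y X] K_def ..
  have hX: "h (\<lambda>q. nablaS q (Y q) \<xi>M) X p = K p (h X Y p)"
    unfolding h_sym[OF nablaS_field[OF Y \<xi>M_field] X] h_nablaS_\<xi>[OF X Y] K_def ..
  have two: "2 *\<^sub>T w = w + w" for w :: "'m tvec" by (simp add: fun_eq_iff tvec_apply)
  show ?thesis
    unfolding cov_deriv2_form_def cov_\<xi>_right[OF Y nablaS_field[OF X \<xi>M_field]]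
      cov_\<xi>_left[OF X nablaS_field[OF Y \<xi>M_field]] cov_\<xi>_\<xi>[OF nablaS_field[OF X Y]] hX
      h_sym[OF nablaS_field[OF X \<xi>M_field] Y] hY two
      normal_part_Dss_zero[OF section_near_in_tangent_space[OF X] cov0] by simp
qed

lemma recurrent_imp_totally_geodesic:
  assumes "generalized_2_recurrent B A \<iota> g Dss nablaS h"
  shows "totally_geodesic B h"
  unfolding totally_geodesic_def
proof (intro allI impI)
  fix p X Y assume X: "vector_field_near B p X" and Y: "vector_field_near B p Y"
  obtain \<psi> \<rho> where "cov_deriv2_form B A \<iota> g Dss nablaS h \<xi>M \<xi>M X Y p
      = \<psi> p (X p) (Y p) *\<^sub>T h \<xi>M \<xi>M p + \<rho> p (X p) *\<^sub>T cov Y \<xi>M \<xi>M p"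
    using assms X Y \<xi>M_field unfolding generalized_2_recurrent_def by blast
  then have "2 *\<^sub>T K p (K p (h X Y p)) = 0"
    unfolding cov2_\<xi>_\<xi>[OF X Y] cov_\<xi>_\<xi>[OF Y] h_\<xi>[OF \<xi>M_field] by simp
  \<comment> \<open>Both applications of \<open>K\<close> are undone by its injectivity on normal
    vectors; \<open>K_normal\<close> keeps the intermediate vector normal.\<close>
  then have "K p (K p (h X Y p)) = 0" by simp
  then show "h X Y p = 0"
    using K_eq_zero K_normal h_normal[OF X Y] by blast
qed

text \<open>The hypothesis gives h = 0 only at points near which the arguments are fields. Hence
  vanishing is carried through as a local statement, first for h and then for its derivative, and
  the zero forms serve as \<psi> and \<rho>.\<close>

lemma totally_geodesic_imp_recurrent:
  assumes "totally_geodesic B h"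
  shows "generalized_2_recurrent B A \<iota> g Dss nablaS h"
proof -
  have h0: "h X Y p = 0" if "vector_field_near B p X" "vector_field_near B p Y" for X Y p
    using assms that unfolding totally_geodesic_def by blast
  have cov0: "cov Y Z W p = 0" if Y: "vector_field_near B p Y" and Z: "vector_field_near B p Z"
    and W: "vector_field_near B p W" for Y Z W p
  proof -
    have "\<forall>\<^sub>F q in nhds p. h Z W q = 0"
      using section_near_eventually[OF Z] section_near_eventually[OF W] by eventually_elim (rule h0)
    then show ?thesis
      unfolding cov_deriv_form_def h0[OF nablaS_field[OF Y Z] W] h0[OF Z nablaS_field[OF Y W]]
      by (simp add: normal_part_Dss_zero section_near_in_tangent_space[OF Y])
  qed
  have "cov_deriv2_form B A \<iota> g Dss nablaS h Z W X Y p = 0"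
    if X: "vector_field_near B p X" and Y: "vector_field_near B p Y"
      and Z: "vector_field_near B p Z" and W: "vector_field_near B p W" for X Y Z W p
  proof -
    have "\<forall>\<^sub>F q in nhds p. cov Y Z W q = 0"
      using section_near_eventually[OF Y] section_near_eventually[OF Z] section_near_eventually[OF W]
      by eventually_elim (rule cov0)
    then show ?thesis
      unfolding cov_deriv2_form_def cov0[OF Y nablaS_field[OF X Z] W] cov0[OF X Z nablaS_field[OF Y W]]
        cov0[OF nablaS_field[OF X Y] Z W]
      by (simp add: normal_part_Dss_zero section_near_in_tangent_space[OF X])
  qed
  moreover have "two_form B (\<lambda>p v w. 0)" "one_form B (\<lambda>p v. 0)"
    unfolding two_form_def bilinear_form_def one_form_def by (simp_all add: source.smooth_near_const)
  ultimately show ?thesis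
    unfolding generalized_2_recurrent_def
    by (intro exI[of _ "\<lambda>p v w. 0"] exI[of _ "\<lambda>p v. 0"]) (simp add: h0 cov0)
qed

end

section \<open>Passage from the stated hypotheses to the geometric setting\<close>

theorem theorem4p4:
  fixes A :: "('m::{t2_space,second_countable_topology}, 'e::euclidean_space) atlas"
    and B :: "('n::{t2_space,second_countable_topology}, 'k::euclidean_space) atlas"
    and \<iota> :: "'n \<Rightarrow> 'm" and n :: nat
    and \<phi> :: "'m \<Rightarrow> 'm tvec \<Rightarrow> 'm tvec" and \<xi> :: "'m \<Rightarrow> 'm tvec"
    and \<eta> :: "'m \<Rightarrow> 'm tvec \<Rightarrow> real" and g :: "'m \<Rightarrow> 'm tvec \<Rightarrow> 'm tvec \<Rightarrow> real"
    and f1 f2 f3 :: "'m \<Rightarrow> real"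
  assumes "generalized_sasakian_space_form n A \<phi> \<xi> \<eta> g nabla f1 f2 f3"
    and "structure_equations A \<phi> \<xi> \<eta> g nabla f1 f3"
    and "invariant_submanifold B A \<iota> \<phi> \<xi>"
    and "levi_civita B (induced_metric A \<iota> g) nablaM"
    and "pullback_connection B A \<iota> nabla D"
    and "pullback_connection B A \<iota> (semi_symmetric_connection g \<eta> \<xi> nabla) Dss"
    and "h = second_fundamental_form A \<iota> D nablaM"
    and "nablaMss = semi_symmetric_connection (induced_metric A \<iota> g) (induced_one_form A \<iota> \<eta>)
                      (induced_field B A \<iota> \<xi>) nablaM"
    and "\<forall>x. (f1 x - f3 x)\<^sup>2 + 1 \<noteq> 0"
  shows "generalized_2_recurrent B A \<iota> g Dss nablaMss h \<longleftrightarrow> totally_geodesic B h"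
proof -
  note form = assms(1)[unfolded generalized_sasakian_space_form_def]
  have contact: "almost_contact_metric A \<phi> \<xi> \<eta> g" and lc: "levi_civita A g nabla"
    and smooth: "\<And>x. smooth_near A f1 x" "\<And>x. smooth_near A f3 x"
    using form by blast+
  have A: "smooth_atlas A" and metric: "riemannian_metric A g"
    using contact unfolding almost_contact_metric_def by blast+
  have B: "smooth_atlas B" and map: "smooth_map B A \<iota>"
    and inj: "\<And>p. inj_on (pushforward A \<iota> p) (tangent_space B p)"
    and \<xi>: "\<And>p. \<xi> (\<iota> p) \<in> pushforward A \<iota> p ` tangent_space B p"
    and \<phi>: "\<And>p. \<phi> (\<iota> p) ` pushforward A \<iota> p ` tangent_space B p \<subseteq> pushforward A \<iota> p ` tangent_space B p"
    using assms(3) unfolding invariant_submanifold_def immersion_def by blast+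
  have D: "connection_along B A \<iota> D" and Dss: "connection_along B A \<iota> Dss"
    using assms(5,6) unfolding pullback_connection_def by blast+
  note str = assms(2)[unfolded structure_equations_def]
  interpret A: manifold A by unfold_locales (rule A)
  interpret S: invariant_geometry B A \<iota> D g nabla \<phi> \<xi> \<eta> "\<lambda>x. f1 x - f3 x" nablaM Dss
  proof unfold_locales
    show "smooth_near A (\<lambda>x. f1 x - f3 x) x" for x
      by (rule A.smooth_near_diff[OF smooth])
  qed (fact A B map D metric lc assms(5) inj contact \<xi> assms(4) Dss | use str \<phi> in blast)+
  have "h = S.h" "nablaMss = S.nablaS"
    unfolding S.h_def S.nablaS_def S.\<xi>M_def by (fact assms(7,8))+
  then show ?thesis
    using S.recurrent_imp_totally_geodesic S.totally_geodesic_imp_recurrent by blast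
qed

end
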